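(* Let $\mathcal{F}\subseteq[\mathcal{C}]^{<\omega}$ be hereditary and $C$-measurable in $[\mathcal{C}]^{<\omega}$, where $\mathcal{C}=2^\omega$ is the Cantor set, and assume that $$\limsup_{n\to\infty}\frac{\log_2 d_{\mathcal{F}}(2^n)}{\log_2 n}=+\infty.$$ Let $f:\omega\to\omega$ be such that $n\geq f(n)>0$ for all $n\geq1$ and $\lim_{n\to\infty}\frac{f(n)}{n}=0$. Then for every perfect $P\subseteq\mathcal{C}$ there exists a perfect $Q\subseteq P$ such that $\mathcal{F}$ is $f$-filling over $Q$.
   Context: $\mathcal{C}=2^\omega$ is the Cantor set and $<$ is its strict lexicographical ordering. For $k\geq 1$, $[\mathcal{C}]^k$ is the set of all $k$-element subsets of $\mathcal{C}$, identified with the $<$-increasing sequences of length $k$ (so $[\mathcal{C}]^k$ is an open subset of $\mathcal{C}^k$, hence a Polish space). The set $[\mathcal{C}]^{<\omega}=\bigcup_{k\geq1}[\mathcal{C}]^k$ is the Polish space which is the topological direct sum of the spaces $[\mathcal{C}]^k$, $k\geq1$ (the empty set plays no role). A family $\mathcal{F}\subseteq[\mathcal{C}]^{<\omega}$ is hereditary if every (nonempty) subset of a member of $\mathcal{F}$ belongs to $\mathcal{F}$. For $n\geq1$, $$d_{\mathcal{F}}(n)=\min_{F\in[\mathcal{C}]^n}\max\{|G|: G\subseteq F\text{ and }G\in\mathcal{F}\},$$ with the maximum over an empty collection taken to be $0$. For $A\subseteq\mathcal{C}$ and $f$ as in the claim, $\mathcal{F}$ is $f$-filling over $A$ if for every $n\geq1$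 and every $F\subseteq A$ with $|F|=n$ there exists $G\subseteq F$ with $G\in\mathcal{F}$ and $|G|\geq f(n)$. A subset of a Polish space is $C$-measurable if it belongs to the smallest $\sigma$-algebra which contains the open sets and is closed under the Souslin operation. Perfect means nonempty, closed and without isolated points. *)

theory Defs
  imports "HOL-Analysis.Analysis"
begin

text \<open>The topology on \<^typ>\<open>nat \<Rightarrow> bool\<close> is the library's product topology with discrete factors.
  The library order on this type is pointwise, so the lexicographic order is a separate relation.\<close>

type_synonym cantor = "nat \<Rightarrow> bool"

definition cantor_less :: "cantor \<Rightarrow> cantor \<Rightarrow> bool" (infix \<open>\<sqsubset>\<close> 50) where
  "x \<sqsubset> y \<longleftrightarrow> (\<exists>n. (\<forall>m<n. x m = y m) \<and> \<not> x n \<and> y n)"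

definition fin_sets :: "cantor set set" where
  "fin_sets = {F. finite F \<and> F \<noteq> {}}"

definition incr_seqs :: "nat \<Rightarrow> (nat \<Rightarrow> cantor) topology" where
  "incr_seqs k = subtopology (product_topology (\<lambda>_. euclidean) {..<k})
     {s. monotone_on {..<k} (<) (\<sqsubset>) s}"

definition incr_enum :: "cantor set \<Rightarrow> nat \<Rightarrow> cantor" where
  "incr_enum F = (THE s. s \<in> extensional {..<card F} \<and>
     monotone_on {..<card F} (<) (\<sqsubset>) s \<and> s ` {..<card F} = F)"

text \<open>The map below is a bijection onto the topological sum of the spaces of increasing
  sequences (see \<open>bij_betw_fin_sets\<close>), so the pullback makes it a homeomorphism.\<close>

definition fin_sets_topology :: "cantor set topology" where
  "fin_sets_topology = pullback_topology fin_sets (\<lambda>F. (card F, incr_enum F))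
     (sum_topology incr_seqs {1..})"

definition souslin_op :: "(nat list \<Rightarrow> 'a set) \<Rightarrow> 'a set" where
  "souslin_op A = (\<Union>x :: nat \<Rightarrow> nat. \<Inter>n. A (map x [0..<n]))"

definition C_measurable_sets :: "'a topology \<Rightarrow> 'a set set" where
  "C_measurable_sets X = \<Inter>{M. sigma_algebra (topspace X) M \<and> {U. openin X U} \<subseteq> M \<and>
     (\<forall>A. range A \<subseteq> M \<longrightarrow> souslin_op A \<in> M)}"

definition hereditary :: "cantor set set \<Rightarrow> bool" where
  "hereditary \<F> \<longleftrightarrow> (\<forall>F\<in>\<F>. \<forall>G\<subseteq>F. G \<noteq> {} \<longrightarrow> G \<in> \<F>)"

text \<open>Inserting 0 handles the maximum over an empty collection. The outer set is an infinite
  family of values, but it is a nonempty subset of \<open>{0..n}\<close> for \<open>n \<ge> 1\<close>.\<close>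

definition min_filling :: "cantor set set \<Rightarrow> nat \<Rightarrow> nat" where
  "min_filling \<F> n = Min {Max (insert 0 (card ` {G. G \<subseteq> F \<and> G \<in> \<F>})) | F. finite F \<and> card F = n}"

definition filling :: "(nat \<Rightarrow> nat) \<Rightarrow> cantor set set \<Rightarrow> cantor set \<Rightarrow> bool" where
  "filling f \<F> A \<longleftrightarrow> (\<forall>n\<ge>1. \<forall>F\<subseteq>A. finite F \<and> card F = n \<longrightarrow>
     (\<exists>G\<subseteq>F. G \<in> \<F> \<and> f n \<le> card G))"

definition perfect :: "'a::topological_space set \<Rightarrow> bool" where
  "perfect P \<longleftrightarrow> P \<noteq> {} \<and> closed P \<and> (\<forall>x. \<not> x isolated_in P)"

lemma linorder_cantor: "class.linorder (\<lambda>x y. x \<sqsubset> y \<or> x = y) (\<sqsubset>)"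
proof -
  have trans: "x \<sqsubset> z" if xy: "x \<sqsubset> y" and yz: "y \<sqsubset> z" for x y z
  proof -
    obtain i where i: "\<forall>m<i. x m = y m" "\<not> x i" "y i"
      using xy by (auto simp: cantor_less_def)
    obtain j where j: "\<forall>m<j. y m = z m" "\<not> y j" "z j"
      using yz by (auto simp: cantor_less_def)
    have "(\<forall>m<min i j. x m = z m) \<and> \<not> x (min i j) \<and> z (min i j)"
      using i j by (cases i j rule: linorder_cases) (auto simp: min_def)
    then show ?thesis unfolding cantor_less_def by (rule exI)
  qed
  have irrefl: "\<not> x \<sqsubset> x" for x by (simp add: cantor_less_def)
  have total: "x \<sqsubset> y \<or> x = y \<or> y \<sqsubset> x" for x y
  proof (cases "x = y")
    case False
    then have ex: "\<exists>n. x n \<noteq> y n" by (simp add: fun_eq_iff)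
    define n where "n = (LEAST n. x n \<noteq> y n)"
    have "x n \<noteq> y n" "\<forall>m<n. x m = y m"
      using LeastI_ex[OF ex] not_less_Least[of _ "\<lambda>n. x n \<noteq> y n"]
      unfolding n_def[symmetric] by blast+
    then show ?thesis by (auto simp: cantor_less_def)
  qed simp
  show ?thesis
    by unfold_locales (use trans irrefl total in blast)+
qed

lemma incr_enum_ex1:
  assumes "finite F"
  shows "\<exists>!s. s \<in> extensional {..<card F} \<and>
     monotone_on {..<card F} (<) (\<sqsubset>) s \<and> s ` {..<card F} = F"
proof -
  interpret C: linorder "\<lambda>x y. x \<sqsubset> y \<or> x = y" "(\<sqsubset>)"
    by (rule linorder_cantor)
  let ?k = "card F"
  obtain xs where xs: "sorted_wrt (\<sqsubset>) xs" "set xs = F"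
    using C.ex1_sorted_list_for_set_if_finite[OF assms] by blast
  have uniq: "ys = xs" if "sorted_wrt (\<sqsubset>) ys" "set ys = F" for ys
    using C.ex1_sorted_list_for_set_if_finite[OF assms] xs that by blast
  have len: "length xs = ?k"
    using xs C.strict_sorted_iff distinct_card by metis
  show ?thesis
  proof (rule ex1I)
    show "(\<lambda>i\<in>{..<?k}. xs ! i) \<in> extensional {..<?k} \<and>
      monotone_on {..<?k} (<) (\<sqsubset>) (\<lambda>i\<in>{..<?k}. xs ! i) \<and> (\<lambda>i\<in>{..<?k}. xs ! i) ` {..<?k} = F"
      using xs len by (auto simp: monotone_on_def sorted_wrt_iff_nth_less in_set_conv_nth)
  next
    fix s
    assume s: "s \<in> extensional {..<?k} \<and> monotone_on {..<?k} (<) (\<sqsubset>) s \<and> s ` {..<?k} = F"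
    have "map s [0..<?k] = xs"
      using s by (intro uniq) (auto simp: monotone_on_def sorted_wrt_iff_nth_less atLeast0LessThan)
    then have "xs ! i = s i" if "i < ?k" for i
      using that by auto
    with s show "s = (\<lambda>i\<in>{..<?k}. xs ! i)"
      by (auto simp: extensional_def fun_eq_iff)
  qed
qed

lemma bij_betw_fin_sets:
  "bij_betw (\<lambda>F. (card F, incr_enum F)) fin_sets (topspace (sum_topology incr_seqs {1..}))"
proof (rule bij_betw_byWitness[where f' = "\<lambda>(k, s). s ` {..<k}"])
  interpret C: linorder "\<lambda>x y. x \<sqsubset> y \<or> x = y" "(\<sqsubset>)"
    by (rule linorder_cantor)
  have enum: "incr_enum F \<in> extensional {..<card F} \<and>
     monotone_on {..<card F} (<) (\<sqsubset>) (incr_enum F) \<and> incr_enum F ` {..<card F} = F"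
    if "F \<in> fin_sets" for F
    using theI'[OF incr_enum_ex1] that by (simp add: incr_enum_def fin_sets_def)
  have top: "topspace (sum_topology incr_seqs {1..}) =
      Sigma {1..} (\<lambda>k. {s. s \<in> extensional {..<k} \<and> monotone_on {..<k} (<) (\<sqsubset>) s})"
    by (auto simp: topspace_sum_topology incr_seqs_def PiE_def)
  have card: "card (s ` {..<k}) = k" if "monotone_on {..<k} (<) (\<sqsubset>) s" for s and k :: nat
  proof -
    have "inj_on s {..<k}"
      using that C.less_irrefl unfolding monotone_on_def inj_on_def
      by (metis linorder_neqE_nat)
    then show ?thesis by (simp add: card_image)
  qed
  have enum_image: "incr_enum (s ` {..<k}) = s"
    if "s \<in> extensional {..<k}" "monotone_on {..<k} (<) (\<sqsubset>) s" for s and k :: nat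
    unfolding incr_enum_def
    by (rule the1_equality[OF incr_enum_ex1]) (use that card in auto)
  show "\<forall>F\<in>fin_sets. (\<lambda>(k, s). s ` {..<k}) (card F, incr_enum F) = F"
    using enum by auto
  show "\<forall>p\<in>topspace (sum_topology incr_seqs {1..}).
      (card ((\<lambda>(k, s). s ` {..<k}) p), incr_enum ((\<lambda>(k, s). s ` {..<k}) p)) = p"
    unfolding top using card enum_image by auto
  show "(\<lambda>F. (card F, incr_enum F)) ` fin_sets \<subseteq> topspace (sum_topology incr_seqs {1..})"
    unfolding top using enum by (auto simp: fin_sets_def Suc_le_eq card_gt_0_iff)
  show "(\<lambda>(k, s). s ` {..<k}) ` topspace (sum_topology incr_seqs {1..}) \<subseteq> fin_sets"
    unfolding top by (auto simp: fin_sets_def lessThan_empty_iff)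
qed

end

(*
  Every perfect set contains a homeomorphic copy of the Cantor set, embedded along a tree, so it
  suffices to find, for each N and each such copy, a smaller copy all of whose N-element subsets
  are in the family: with N_j such that f(n) <= 2^(-j-1) n for n > N_j, a fusion gives Q whose
  2^j cones at level j have all their subsets of size at most N_j in the family, and a set
  of n <= N_j points with n > N_(j-1) has at least n / 2^j >= f(n) of its points in one cone.

  For fixed N one first makes membership of N-element sets depend only on the order in which the
  N points split off (Blass' theorem): C-measurable sets have the Baire property, so by
  Mycielski's argument membership is decided at the last splitting, and the Halpern-Laeuchli
  theorem, applied N times, removes the dependence on the letters between the splittings.
  In a skew subtree no two nodes split at the same level. There, 2^n points forming a complete
  binary tree have a subset in the family of size greater than (n + 1)^(N - 1); by the
  order-shattering version of the Sauer-Shelah lemma it contains N points splitting in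
  any prescribed order. Hence all splitting orders have the good colour.
*)
theory Submission
  imports Defs "HOL-Library.Sublist"
begin

text \<open>The splitting order of the points cannot be removed from the colouring: for N >= 3 each
  of the (N - 1)! orders occurs in every perfect set, so colouring by the order has no homogeneous
  perfect set. Hence no good order can be selected; each of them has to be met inside some member of
  the family. The hypothesis on the limsup says that d(2^n) exceeds every fixed power of n for
  infinitely many n. This is what the polynomial bound asks for: (n + 1)^(N - 1) estimates the
  number of 0-1 patterns of length n with fewer than N - 1 ones. Plain shattering would not do. It
  yields a set of coordinates on which all traces occur, but members with the same trace so far may
  differ at an earlier coordinate outside this set and thus split in the wrong order. Order
  shattering yields a tree that splits at the marked levels and follows a single direction at all
  others. The Halpern-Laeuchli theorem is reduced to words over a finite alphabet, and these are
  handled by an ultrafilter that is invariant under replacing the variable by a letter.\<close>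

section \<open>Idempotent ultrafilters\<close>

definition ultra :: "'a filter \<Rightarrow> bool" where
  "ultra F \<longleftrightarrow> F \<noteq> bot \<and> (\<forall>P. eventually P F \<or> eventually (\<lambda>x. \<not> P x) F)"

text \<open>For ultrafilters this is the extension of concatenation to the Stone-Cech
  compactification of the words; it is continuous in the left factor.\<close>

definition fprod :: "'a list filter \<Rightarrow> 'a list filter \<Rightarrow> 'a list filter" (infixl \<open>\<odot>\<close> 70) where
  "F \<odot> G = Abs_filter (\<lambda>P. \<forall>\<^sub>F x in F. \<forall>\<^sub>F y in G. P (x @ y))"

lemma eventually_fprod:
  "eventually P (F \<odot> G) \<longleftrightarrow> (\<forall>\<^sub>F x in F. \<forall>\<^sub>F y in G. P (x @ y))"
proof -
  have "is_filter (\<lambda>P. \<forall>\<^sub>F x in F. \<forall>\<^sub>F y in G. P (x @ y))"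
  proof
    fix P Q
    assume "\<forall>\<^sub>F x in F. \<forall>\<^sub>F y in G. P (x @ y)" "\<forall>\<^sub>F x in F. \<forall>\<^sub>F y in G. Q (x @ y)"
    then show "\<forall>\<^sub>F x in F. \<forall>\<^sub>F y in G. P (x @ y) \<and> Q (x @ y)"
      by eventually_elim (rule eventually_conj)
  next
    fix P Q :: "'a list \<Rightarrow> bool"
    assume "\<forall>x. P x \<longrightarrow> Q x" "\<forall>\<^sub>F x in F. \<forall>\<^sub>F y in G. P (x @ y)"
    then show "\<forall>\<^sub>F x in F. \<forall>\<^sub>F y in G. Q (x @ y)"
      by (auto elim!: eventually_mono)
  qed simp
  then show ?thesis
    unfolding fprod_def by (rule eventually_Abs_filter)
qed

lemma fprod_assoc: "F \<odot> G \<odot> H = F \<odot> (G \<odot> H)"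
  by (simp add: filter_eq_iff eventually_fprod)

lemma fprod_mono: "F \<le> F' \<Longrightarrow> G \<le> G' \<Longrightarrow> F \<odot> G \<le> F' \<odot> G'"
  by (auto simp: le_filter_def eventually_fprod elim!: eventually_mono)

lemma fprod_eq_bot_iff: "F \<odot> G = bot \<longleftrightarrow> F = bot \<or> G = bot"
  using eventually_fprod[of "\<lambda>_. False" F G]
  by (cases "G = bot") (simp_all add: eventually_const_iff)

lemma ultra_not: "ultra F \<Longrightarrow> (\<forall>\<^sub>F x in F. \<not> P x) \<longleftrightarrow> \<not> (\<forall>\<^sub>F x in F. P x)"
  using eventually_conj_iff[of P "\<lambda>x. \<not> P x" F] by (auto simp: ultra_def)

lemma ultra_fprod: "ultra F \<Longrightarrow> ultra G \<Longrightarrow> ultra (F \<odot> G)"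
  unfolding ultra_def[of "F \<odot> G"]
  by (auto simp: fprod_eq_bot_iff eventually_fprod ultra_not) (auto simp: ultra_def)

lemma ultra_filtermap: "ultra F \<Longrightarrow> ultra (filtermap f F)"
  by (auto simp: ultra_def eventually_filtermap filtermap_bot_iff)

lemma ultra_le_eq: "ultra F \<Longrightarrow> ultra G \<Longrightarrow> F \<le> G \<Longrightarrow> F = G"
  unfolding filter_eq_iff le_filter_def by (meson ultra_not)

text \<open>Zorn's lemma for nonempty closed sets of ultrafilters. Compactness enters as properness
  of the infimum of a chain: if False held eventually in the infimum, it would do so in one of the
  members.\<close>

lemma ex_minimal_filter:
  fixes F0 :: "'a filter"
  assumes F0: "P F0" "F0 \<noteq> bot"
    and chain: "\<And>B. B \<noteq> {} \<Longrightarrow> (\<forall>F\<in>B. P F \<and> F \<noteq> bot) \<Longrightarrow> (\<forall>F\<in>B. \<forall>G\<in>B. F \<le> G \<or> G \<le> F) \<Longrightarrow> P (Inf B)"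
  obtains F where "F \<le> F0" "P F" "F \<noteq> bot" "\<And>G. P G \<Longrightarrow> G \<noteq> bot \<Longrightarrow> G \<le> F \<Longrightarrow> G = F"
proof -
  let ?S = "{F. P F \<and> F \<noteq> bot \<and> F \<le> F0}"
  have "\<exists>m\<in>?S. \<forall>a\<in>?S. (\<lambda>x y. y \<le> x) m a \<longrightarrow> a = m"
  proof (rule predicate_Zorn)
    show "partial_order_on ?S (relation_of (\<lambda>x y. y \<le> x) ?S)"
      by (rule partial_order_on_relation_ofI) auto
    fix B assume "B \<in> Chains (relation_of (\<lambda>x y. y \<le> x) ?S)"
    then have sub: "B \<subseteq> ?S" and ch: "\<forall>F\<in>B. \<forall>G\<in>B. F \<le> G \<or> G \<le> F"
      by (auto simp: Chains_def relation_of_def)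
    show "\<exists>u\<in>?S. \<forall>a\<in>B. u \<le> a"
    proof (cases "B = {}")
      case False
      have "eventually Q (Inf B) \<longleftrightarrow> (\<exists>b\<in>B. eventually Q b)" for Q
        by (rule eventually_Inf_base[OF False]) (use ch in \<open>auto simp: inf.absorb1 inf.absorb2 intro: order_refl\<close>)
      then have "Inf B \<noteq> bot"
        using sub by (auto simp: trivial_limit_def)
      moreover have "P (Inf B)"
        using False sub ch by (intro chain) auto
      moreover have "Inf B \<le> F0"
        using False sub by (auto intro: Inf_lower2)
      ultimately show ?thesis
        by (intro bexI[of _ "Inf B"]) (auto intro: Inf_lower)
    qed (use F0 in auto)
  qed
  then obtain F where "F \<in> ?S" "\<forall>a\<in>?S. a \<le> F \<longrightarrow> a = F" by auto
  then show thesis by (intro that[of F]) auto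
qed

lemma ex_ultra_le:
  assumes "F \<noteq> bot" obtains q where "ultra q" "q \<le> F"
proof -
  obtain q where q: "q \<le> F" "q \<noteq> bot" "\<And>G. G \<noteq> bot \<Longrightarrow> G \<le> q \<Longrightarrow> G = q"
    by (rule ex_minimal_filter[of "\<lambda>_. True" F]) (use assms in auto)
  have "eventually P q \<or> (\<forall>\<^sub>F x in q. \<not> P x)" for P
  proof (cases "inf q (principal {x. P x}) = bot")
    case True
    then show ?thesis by (auto simp: trivial_limit_def eventually_inf_principal)
  next
    case False
    then have "inf q (principal {x. P x}) = q" by (intro q) auto
    then show ?thesis using eventually_inf_principal[of P q "{x. P x}"] by simp
  qed
  then show thesis using q by (intro that[of q]) (auto simp: ultra_def)
qed

text \<open>Ellis' lemma on idempotents in compact right topological semigroups. A filter plays the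
  part of the closed set of the ultrafilters finer than it; minimality is in the finer order.\<close>

lemma ex_idempotent_ultra:
  assumes "F0 \<odot> F0 \<le> F0" "F0 \<noteq> bot"
  obtains q where "ultra q" "q \<le> F0" "q \<odot> q = q"
proof -
  obtain F where F: "F \<le> F0" "F \<odot> F \<le> F" "F \<noteq> bot"
      and min: "\<And>G. G \<odot> G \<le> G \<Longrightarrow> G \<noteq> bot \<Longrightarrow> G \<le> F \<Longrightarrow> G = F"
  proof (rule ex_minimal_filter[of "\<lambda>F. F \<odot> F \<le> F" F0])
    fix B :: "'a list filter set"
    assume B: "B \<noteq> {}" "\<forall>F\<in>B. F \<odot> F \<le> F \<and> F \<noteq> bot" "\<forall>F\<in>B. \<forall>G\<in>B. F \<le> G \<or> G \<le> F"
    show "Inf B \<odot> Inf B \<le> Inf B"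
    proof (rule Inf_greatest)
      fix F assume "F \<in> B"
      then show "Inf B \<odot> Inf B \<le> F"
        using B fprod_mono[of "Inf B" F "Inf B" F] by (meson Inf_lower order_trans)
    qed
  qed (use assms in auto)
  obtain q where q: "ultra q" "q \<le> F" using ex_ultra_le F(3) by blast
  \<comment> \<open>For the minimal closed semigroup S given by \<open>F\<close>, the set S q is
    again a closed semigroup inside S.\<close>
  have "F \<odot> q = F"
  proof (rule min)
    have "F \<odot> q \<odot> (F \<odot> q) = F \<odot> (q \<odot> F) \<odot> q" by (simp add: fprod_assoc)
    also have "\<dots> \<le> F \<odot> F \<odot> q"
      using q F by (intro fprod_mono order_refl) (meson fprod_mono order_refl order_trans)
    also have "\<dots> \<le> F \<odot> q" using F by (intro fprod_mono) auto
    finally show "F \<odot> q \<odot> (F \<odot> q) \<le> F \<odot> q" .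
    show "F \<odot> q \<noteq> bot" using F q by (auto simp: fprod_eq_bot_iff ultra_def)
    show "F \<odot> q \<le> F" using F q by (meson fprod_mono order_refl order_trans)
  qed
  \<comment> \<open>\<open>F'\<close> stands for the ultrafilters x finer than \<open>F\<close> with
    x q = q: this equation says that \<open>T P\<close> holds x-eventually whenever \<open>P\<close>
    holds q-eventually. They form a closed semigroup, nonempty because q lies in S q = S, hence all
    of S; so q is one of them.\<close>
  define T where "T P x \<longleftrightarrow> (\<forall>\<^sub>F y in q. P (x @ y))" for P x
  let ?B = "(\<lambda>P. principal {x. T P x}) ` {P. eventually P q}"
  define F' where "F' = inf F (Inf ?B)"
  have ev: "eventually Q (Inf ?B) \<longleftrightarrow> (\<exists>P. eventually P q \<and> (\<forall>x. T P x \<longrightarrow> Q x))" for Q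
  proof -
    have "eventually Q (Inf ?B) \<longleftrightarrow> (\<exists>b\<in>?B. eventually Q b)"
    proof (rule eventually_Inf_base)
      show "?B \<noteq> {}" by (auto intro: exI[of _ "\<lambda>_. True"])
      fix A B assume "A \<in> ?B" "B \<in> ?B"
      then obtain P1 P2 where P: "eventually P1 q" "eventually P2 q"
        "A = principal {x. T P1 x}" "B = principal {x. T P2 x}" by auto
      then show "\<exists>x\<in>?B. x \<le> inf A B"
        by (intro bexI[of _ "principal {x. T (\<lambda>y. P1 y \<and> P2 y) x}"] image_eqI[OF refl])
          (auto simp: T_def eventually_conj_iff)
    qed
    then show ?thesis by (auto simp: eventually_principal)
  qed
  have ev': "eventually Q F' \<longleftrightarrow> (\<exists>P R. eventually P q \<and> eventually R F \<and> (\<forall>x. T P x \<and> R x \<longrightarrow> Q x))"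
    (is "_ \<longleftrightarrow> ?rhs") for Q
  proof
    assume "eventually Q F'"
    then obtain R A where "eventually R F" "eventually A (Inf ?B)" "\<And>x. R x \<and> A x \<longrightarrow> Q x"
      unfolding F'_def eventually_inf by blast
    moreover from this(2) obtain P where "eventually P q" "\<And>x. T P x \<longrightarrow> A x"
      unfolding ev by blast
    ultimately show ?rhs by (intro exI[of _ P] exI[of _ R]) blast
  next
    assume ?rhs
    then obtain P R where PR: "eventually P q" "eventually R F" "\<And>x. T P x \<and> R x \<longrightarrow> Q x"
      by blast
    then have "eventually (T P) (Inf ?B)" unfolding ev by blast
    with PR show "eventually Q F'"
      unfolding F'_def eventually_inf by (intro exI[of _ R] exI[of _ "T P"]) auto
  qed
  have "F' = F"
  proof (rule min)
    show "F' \<le> F" by (simp add: F'_def)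
    show "F' \<noteq> bot"
    proof
      assume "F' = bot"
      then obtain P R where PR: "eventually P q" "eventually R F" "\<And>x. R x \<Longrightarrow> \<not> T P x"
        using ev'[of "\<lambda>_. False"] by auto
      then have "\<forall>\<^sub>F x in F. \<forall>\<^sub>F y in q. \<not> P (x @ y)"
        unfolding T_def using q(1) by (auto simp: ultra_not elim: eventually_mono)
      then have "\<forall>\<^sub>F x in F \<odot> q. \<not> P x" by (simp add: eventually_fprod)
      with \<open>F \<odot> q = F\<close> q have "\<forall>\<^sub>F x in q. \<not> P x" by (simp add: filter_leD)
      with PR(1) q(1) show False by (simp add: ultra_not)
    qed
    show "F' \<odot> F' \<le> F'"
    proof (rule filter_leI)
      fix Q assume "eventually Q F'"
      then obtain P R where PR: "eventually P q" "eventually R F" "\<And>x. T P x \<Longrightarrow> R x \<Longrightarrow> Q x"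
        unfolding ev' by blast
      have "eventually R (F' \<odot> F')"
        using PR(2) F(2) \<open>F' \<le> F\<close> by (meson filter_leD fprod_mono order_refl order_trans)
      moreover have "eventually (T P) (F' \<odot> F')"
        unfolding eventually_fprod
      proof (subst ev', intro exI conjI allI impI)
        show "eventually P q" "eventually (\<lambda>_. True) F" using PR by auto
        \<comment> \<open>\<open>T P (x @ y)\<close> is \<open>T\<close> of the shifted predicate
          \<open>\<lambda>y. P (x @ y)\<close> at \<open>y\<close>, and this predicate holds
          q-eventually by \<open>T P x\<close>.\<close>
        fix x assume "T P x \<and> True"
        then have "eventually (\<lambda>y. P (x @ y)) q" by (simp add: T_def)
        then show "\<forall>\<^sub>F y in F'. T P (x @ y)"
          unfolding ev' by (intro exI[of _ "\<lambda>y. P (x @ y)"] exI[of _ "\<lambda>_. True"]) (simp add: T_def)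
      qed
      ultimately show "eventually Q (F' \<odot> F')"
        by eventually_elim (rule PR(3))
    qed
  qed
  have "q \<odot> q \<le> q"
  proof (rule filter_leI)
    fix P assume "eventually P q"
    then have "eventually (T P) F'" unfolding ev' by (meson eventually_True)
    with \<open>F' = F\<close> q(2) show "eventually P (q \<odot> q)"
      by (simp add: filter_leD eventually_fprod T_def[abs_def])
  qed
  then have "q \<odot> q = q" using q(1) ultra_fprod ultra_le_eq by blast
  with q F(1) show thesis by (intro that) auto
qed

text \<open>Elements of the closed left ideal generated by an idempotent f have the form r f, and r
  f f = r f. The proof avoids exhibiting r: a failure would already show at a single word
  \<open>x\<close>, where it contradicts the idempotence of f.\<close>

lemma fprod_idempotent_right:
  assumes "ultra p" "ultra f" "f \<odot> f = f" "p \<le> principal K \<odot> f"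
  shows "p \<odot> f = p"
proof (rule ultra_le_eq)
  show "p \<odot> f \<le> p"
  proof (rule filter_leI, rule ccontr)
    fix P assume P: "eventually P p" "\<not> eventually P (p \<odot> f)"
    have uf: "ultra (p \<odot> f)" using assms ultra_fprod by blast
    define B where "B x \<longleftrightarrow> (\<forall>\<^sub>F y in f. \<not> P (x @ y))" for x
    have "eventually B p"
      using P(2) ultra_not[OF uf, of P] by (simp add: eventually_fprod B_def[abs_def])
    then have "\<forall>\<^sub>F x in p. P x \<and> B x" using P(1) by (simp add: eventually_conj_iff)
    then have "\<not> (\<forall>\<^sub>F x in p. \<not> (P x \<and> B x))"
      using ultra_not[OF assms(1), of "\<lambda>x. P x \<and> B x"] by blast
    then have "\<not> (\<forall>\<^sub>F x in principal K \<odot> f. \<not> (P x \<and> B x))"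
      using filter_leD[OF assms(4)] by blast
    then obtain x where "\<not> (\<forall>\<^sub>F y in f. \<not> (P (x @ y) \<and> B (x @ y)))"
      by (auto simp: eventually_fprod eventually_principal)
    then have "\<forall>\<^sub>F y in f. P (x @ y) \<and> B (x @ y)"
      using assms(2) ultra_not[of f "\<lambda>y. P (x @ y) \<and> B (x @ y)"] by blast
    then have 1: "\<forall>\<^sub>F y in f. P (x @ y)" and 2: "\<forall>\<^sub>F y in f. B (x @ y)"
      by (auto simp: eventually_conj_iff)
    from 2 have "\<forall>\<^sub>F y in f \<odot> f. \<not> P (x @ y)" by (simp add: eventually_fprod B_def)
    with 1 assms(2,3) show False by (simp add: ultra_not)
  qed
qed (use assms ultra_fprod in auto)

section \<open>The Carlson--Simpson theorem\<close>

definition inst :: "'a \<Rightarrow> 'a option list \<Rightarrow> 'a list" where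
  "inst a = map (case_option a id)"

text \<open>\<open>None\<close> is the variable. Take an idempotent p of constant words in a minimal
  left ideal and an idempotent q of variable words below p. Substituting a letter fixes p and maps q
  to an idempotent below p, which is p itself by minimality; so the required equation becomes p q =
  q.\<close>

lemma ex_variable_ultra:
  obtains q :: "'a option list filter"
  where "ultra q" "\<forall>\<^sub>F w in q. None \<in> set w"
    "\<And>a. filtermap (\<lambda>w. map Some (inst a w)) q \<odot> q = q"
proof -
  define S :: "'a option list set" where "S = {w. None \<notin> set w}"
  define V :: "'a option list set" where "V = {w. None \<in> set w}"
  define sub where "sub a w = map Some (inst a w)" for a and w :: "'a option list"
  let ?ideal = "\<lambda>F. F \<le> principal S \<and> (\<forall>x\<in>S. filtermap ((@) x) F \<le> F)"
  \<comment> \<open>\<open>G\<close> is a minimal closed left ideal of the ultrafilters of constant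
    words.\<close>
  obtain G where G: "G \<le> principal S" "\<And>x. x \<in> S \<Longrightarrow> filtermap ((@) x) G \<le> G" "G \<noteq> bot"
    and G_min: "\<And>F. ?ideal F \<Longrightarrow> F \<noteq> bot \<Longrightarrow> F \<le> G \<Longrightarrow> F = G"
  proof (rule ex_minimal_filter[of ?ideal "principal S"])
    show "?ideal (principal S)" "principal S \<noteq> bot"
      by (auto simp: S_def principal_eq_bot_iff intro: exI[of _ "[]"])
    fix B :: "'a option list filter set"
    assume B: "B \<noteq> {}" "\<forall>F\<in>B. ?ideal F \<and> F \<noteq> bot"
    then have "Inf B \<le> principal S" by (meson Inf_lower2 all_not_in_conv)
    moreover have "filtermap ((@) x) (Inf B) \<le> Inf B" if "x \<in> S" for x
      using B that by (intro Inf_greatest) (meson Inf_lower filtermap_mono order_trans)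
    ultimately show "?ideal (Inf B)" by blast
  qed auto
  have SG: "principal S \<odot> G \<le> G"
    using G(2) by (auto simp: le_filter_def eventually_fprod eventually_principal eventually_filtermap)
  then have "G \<odot> G \<le> G" using fprod_mono[OF G(1) order_refl] order_trans by blast
  then obtain p where p: "ultra p" "p \<le> G" "p \<odot> p = p" using ex_idempotent_ultra G(3) by blast
  have "principal V \<odot> p \<odot> principal V \<le> principal V"
    by (auto simp: le_filter_def eventually_fprod eventually_principal V_def)
  then have "principal V \<odot> p \<odot> (principal V \<odot> p) \<le> principal V \<odot> p"
    using fprod_mono[OF _ order_refl] by (simp add: fprod_assoc[symmetric])
  moreover have "principal V \<odot> p \<noteq> bot"
    using p(1) by (auto simp: fprod_eq_bot_iff principal_eq_bot_iff ultra_def V_def intro: exI[of _ "[None]"])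
  ultimately obtain e where e: "ultra e" "e \<le> principal V \<odot> p" "e \<odot> e = e"
    using ex_idempotent_ultra by blast
  have ep: "e \<odot> p = e" using fprod_idempotent_right e(1,2) p(1,3) by blast
  \<comment> \<open>Only e p = e is known so far; multiplying by p on the left gives an idempotent
    that absorbs p on both sides.\<close>
  define q where "q = p \<odot> e"
  have q: "ultra q" "p \<odot> q = q" "q \<odot> p = q" "q \<odot> q = q"
    using p e ep by (simp_all add: q_def ultra_fprod fprod_assoc) (simp_all add: fprod_assoc[symmetric])
  have "eventually (\<lambda>w. w \<in> V) (principal V \<odot> p)"
    by (simp add: eventually_fprod eventually_principal V_def)
  then have "eventually (\<lambda>w. w \<in> V) e" using e(2) filter_leD by blast
  then have "eventually (\<lambda>w. w \<in> V) q"
    unfolding q_def eventually_fprod by (auto simp: V_def elim: eventually_mono)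
  moreover have "filtermap (sub a) q = p" for a
  proof -
    let ?f = "filtermap (sub a) q"
    have hom: "filtermap (sub a) (F \<odot> F') = filtermap (sub a) F \<odot> filtermap (sub a) F'" for F F'
      by (simp add: filter_eq_iff eventually_filtermap eventually_fprod sub_def inst_def)
    have "\<forall>\<^sub>F w in p. w \<in> S" using order_trans[OF p(2) G(1)] by (simp add: le_principal)
    then have "\<forall>\<^sub>F w in p. sub a w = w"
    proof eventually_elim
      case (elim w)
      then show ?case unfolding sub_def inst_def S_def
        by (auto intro!: map_idI split: option.splits) (metis option.exhaust)
    qed
    then have "eventually (\<lambda>w. P (sub a w) = P w) p" for P
      by eventually_elim simp
    then have sub_p: "filtermap (sub a) p = p"
      unfolding filter_eq_iff eventually_filtermap by (intro allI eventually_subst)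
    have f: "ultra ?f" "?f \<odot> ?f = ?f" "p \<odot> ?f = ?f" "?f \<odot> p = ?f"
      using q hom[of q q] hom[of p q] hom[of q p] sub_p by (auto intro: ultra_filtermap)
    have fS: "?f \<le> principal S"
      by (auto simp: le_principal eventually_filtermap sub_def S_def)
    \<comment> \<open>Since \<open>?f = ?f \<odot> p\<close>, the left ideal of \<open>?f\<close>
      lies in \<open>G\<close> and equals it by minimality. Hence p lies in it and p f = p, while
      also p f = f.\<close>
    have "principal S \<odot> ?f = G"
    proof (rule G_min)
      have "x @ y \<in> S" if "x \<in> S" "y \<in> S" for x y using that by (auto simp: S_def)
      then have SS: "principal S \<odot> principal S \<le> principal S"
        by (auto simp: le_filter_def eventually_fprod eventually_principal)
      then have "principal S \<odot> ?f \<le> principal S"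
        using fprod_mono[OF order_refl fS] order_trans by blast
      moreover have "filtermap ((@) x) (principal S \<odot> ?f) \<le> principal S \<odot> ?f" if "x \<in> S" for x
        using that by (auto simp: le_filter_def eventually_fprod eventually_principal
            eventually_filtermap S_def simp flip: append_assoc)
      ultimately show "?ideal (principal S \<odot> ?f)" by blast
      show "principal S \<odot> ?f \<noteq> bot"
        using f(1) by (auto simp: fprod_eq_bot_iff principal_eq_bot_iff ultra_def S_def intro: exI[of _ "[]"])
      have "principal S \<odot> ?f = principal S \<odot> (?f \<odot> p)" by (simp add: f)
      also have "\<dots> \<le> principal S \<odot> (principal S \<odot> G)"
        using fS p(2) by (intro fprod_mono order_refl)
      also have "\<dots> \<le> principal S \<odot> G" using SG by (intro fprod_mono order_refl)
      also have "\<dots> \<le> G" by (rule SG)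
      finally show "principal S \<odot> ?f \<le> G" .
    qed
    then have "p \<odot> ?f = p" using fprod_idempotent_right p(1,2) f(1,2) by blast
    with f show ?thesis by simp
  qed
  ultimately show thesis
    using q by (intro that[of q]) (simp_all add: V_def sub_def[abs_def])
qed

lemma ultra_finite_range:
  assumes "ultra q" "finite (range g)"
  obtains c where "\<forall>\<^sub>F x in q. g x = c"
proof -
  have "\<exists>c. \<forall>\<^sub>F x in q. g x = c"
  proof (rule ccontr)
    assume "\<not> ?thesis"
    then have "\<forall>c\<in>range g. \<forall>\<^sub>F x in q. g x \<noteq> c" using ultra_not[OF assms(1)] by blast
    then have "\<forall>\<^sub>F x in q. \<forall>c\<in>range g. g x \<noteq> c"
      by (intro eventually_ball_finite assms)
    then have "\<forall>\<^sub>F x in q. False" by eventually_elim auto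
    then show False using assms(1) by (simp add: ultra_def)
  qed
  with that show thesis by blast
qed

definition winst :: "(nat \<Rightarrow> 'a option list) \<Rightarrow> 'a list \<Rightarrow> 'a list" where
  "winst w as = concat (map (\<lambda>i. inst (as ! i) (w i)) [0..<length as])"

text \<open>The tree built in \<open>halpern_laeuchli\<close> splits at the first variable of a
  word, so this is the part of the word that belongs to the node before the splitting.\<close>

definition vprefix :: "'a option list \<Rightarrow> 'a list" where
  "vprefix w = map the (takeWhile (\<lambda>b. b \<noteq> None) w)"

lemma winst_snoc: "winst w (as @ [a]) = winst w as @ inst a (w (length as))"
proof -
  have "map (\<lambda>i. inst ((as @ [a]) ! i) (w i)) [0..<length as] =
      map (\<lambda>i. inst (as ! i) (w i)) [0..<length as]"
    by (rule map_cong) (auto simp: nth_append)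
  then show ?thesis by (simp add: winst_def del: map_eq_conv)
qed

lemma winst_Nil [simp]: "winst w [] = []"
  by (simp add: winst_def)

lemma vprefix_append: "vprefix (map Some s @ w) = s @ vprefix w"
  by (induction s) (simp_all add: vprefix_def)

text \<open>The Carlson--Simpson theorem. Each word is followed only up to its first variable.\<close>

lemma carlson_simpson:
  fixes col :: "'a list \<Rightarrow> 'c"
  assumes "finite (range col)" "finite A"
  obtains w c where "\<And>k. None \<in> set (w k)"
    "\<And>as. set as \<subseteq> A \<Longrightarrow> col (winst w as @ vprefix (w (length as))) = c"
proof -
  obtain q :: "'a option list filter" where q: "ultra q" "\<forall>\<^sub>F w in q. None \<in> set w"
    "\<And>a. filtermap (\<lambda>w. map Some (inst a w)) q \<odot> q = q"
    using ex_variable_ultra by blast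
  have "finite (range (\<lambda>w. col (vprefix w)))"
    by (rule finite_subset[OF _ assms(1)]) auto
  then obtain c where c: "\<forall>\<^sub>F w in q. col (vprefix w) = c"
    using ultra_finite_range[OF q(1), of "\<lambda>w. col (vprefix w)"] by blast
  \<comment> \<open>\<open>nxt D w u\<close> says that \<open>u\<close> may follow every instance of
    \<open>w\<close> without leaving \<open>D\<close>. Invariance of q under substitution turns
    \<open>D\<close> holding q-eventually into \<open>nxt D w\<close> holding q-eventually, for
    q-almost all w.\<close>
  define nxt where "nxt D w u \<longleftrightarrow> (\<forall>a\<in>A. D (map Some (inst a w) @ u))"
    for D :: "'a option list \<Rightarrow> bool" and w u
  define good where "good D w \<longleftrightarrow> None \<in> set w \<and> D w \<and> eventually (nxt D w) q" for D w
  have ex: "\<exists>w. good D w" if "eventually D q" for D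
  proof -
    have "\<forall>\<^sub>F w in q. \<forall>\<^sub>F u in q. D (map Some (inst a w) @ u)" for a
    proof -
      have "eventually D (filtermap (\<lambda>w. map Some (inst a w)) q \<odot> q)"
        by (simp add: q(3) that)
      then show ?thesis by (simp add: eventually_fprod eventually_filtermap)
    qed
    then have "\<forall>\<^sub>F w in q. \<forall>a\<in>A. \<forall>\<^sub>F u in q. D (map Some (inst a w) @ u)"
      using assms(2) by (intro eventually_ball_finite) auto
    then have "\<forall>\<^sub>F w in q. eventually (nxt D w) q"
      by eventually_elim (auto simp: nxt_def[abs_def] intro!: eventually_ball_finite assms)
    then have "\<forall>\<^sub>F w in q. good D w"
      unfolding good_def using q(2) that by (auto simp: eventually_conj_iff)
    then show ?thesis using q(1) eventually_happens'[of q "good D"] by (simp add: ultra_def)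
  qed
  \<comment> \<open>\<open>D k u\<close>: after any instance of the first k words with letters from
    \<open>A\<close>, the continuation by \<open>u\<close> has colour \<open>c\<close> when read up
    to its first variable.\<close>
  define D where "D = rec_nat (\<lambda>w. col (vprefix w) = c) (\<lambda>_ D. nxt D (SOME w. good D w))"
  define w where "w k = (SOME w. good (D k) w)" for k
  have D: "D 0 = (\<lambda>w. col (vprefix w) = c)" "\<And>k. D (Suc k) = nxt (D k) (w k)"
    by (simp_all add: D_def w_def)
  have "eventually (D k) q" for k
  proof (induction k)
    case (Suc k)
    from someI_ex[OF ex[OF Suc]] show ?case by (simp add: D good_def w_def)
  qed (simp add: D c)
  then have w: "good (D k) (w k)" for k
    unfolding w_def by (intro someI_ex[of "good (D k)"] ex)
  have "D (length as) u \<Longrightarrow> D 0 (map Some (winst w as) @ u)" if "set as \<subseteq> A" for as u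
    using that
  proof (induction as arbitrary: u rule: rev_induct)
    case (snoc a as)
    then have "D (length as) (map Some (inst a (w (length as))) @ u)" by (auto simp: D nxt_def)
    with snoc show ?case by (simp add: winst_snoc)
  qed simp
  then have "col (winst w as @ vprefix (w (length as))) = c" if "set as \<subseteq> A" for as
    using w[of "length as"] that by (force simp: D(1) good_def vprefix_append)
  moreover have "None \<in> set (w k)" for k using w by (simp add: good_def)
  ultimately show thesis using that by blast
qed

section \<open>Embeddings of the binary tree\<close>

definition pre :: "(nat \<Rightarrow> 'a) \<Rightarrow> nat \<Rightarrow> 'a list" where
  "pre x n = map x [0..<n]"

definition tree_emb :: "(bool list \<Rightarrow> bool list) \<Rightarrow> bool" where
  "tree_emb \<phi> \<longleftrightarrow> (\<forall>s b. prefix (\<phi> s @ [b]) (\<phi> (s @ [b])))"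

text \<open>Tuples of nodes on a common level must be mapped to such tuples, since the colourings of
  tuples are transported along these maps.\<close>

definition strong_emb :: "(bool list \<Rightarrow> bool list) \<Rightarrow> bool" where
  "strong_emb \<phi> \<longleftrightarrow> tree_emb \<phi> \<and> (\<forall>s t. length s = length t \<longrightarrow> length (\<phi> s) = length (\<phi> t))"

text \<open>The map induced on branches. With \<open>Suc n\<close> the index is in range, because an
  embedding does not shorten nodes.\<close>

definition tlim :: "(bool list \<Rightarrow> bool list) \<Rightarrow> cantor \<Rightarrow> cantor" where
  "tlim \<phi> x n = \<phi> (pre x (Suc n)) ! n"

text \<open>The lexicographic order restricted to incomparable nodes, so that it persists to all
  extensions.\<close>

definition node_less :: "bool list \<Rightarrow> bool list \<Rightarrow> bool" (infix \<open>\<prec>\<^sub>l\<close> 50) where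
  "s \<prec>\<^sub>l t \<longleftrightarrow> (\<exists>u. prefix (u @ [False]) s \<and> prefix (u @ [True]) t)"

lemma length_pre [simp]: "length (pre x n) = n"
  by (simp add: pre_def)

lemma nth_pre [simp]: "i < n \<Longrightarrow> pre x n ! i = x i"
  by (simp add: pre_def)

lemma pre_0 [simp]: "pre x 0 = []"
  by (simp add: pre_def)

lemma pre_Suc: "pre x (Suc n) = pre x n @ [x n]"
  by (simp add: pre_def)

lemma take_pre [simp]: "take m (pre x n) = pre x (min m n)"
  by (simp add: pre_def take_map min_def)

lemma pre_eq_iff: "pre x n = pre y n \<longleftrightarrow> (\<forall>i<n. x i = y i)"
  by (auto simp: pre_def)

lemma pre_eq_mono: "pre x n = pre y n \<Longrightarrow> m \<le> n \<Longrightarrow> pre x m = pre y m"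
  by (simp add: pre_eq_iff)

lemma prefix_pre: "m \<le> n \<Longrightarrow> prefix (pre x m) (pre x n)"
  using take_is_prefix[of m "pre x n"] by simp

lemma prefix_pre_iff: "prefix s (pre x n) \<longleftrightarrow> length s \<le> n \<and> pre x (length s) = s"
proof
  assume s: "prefix s (pre x n)"
  then have "length s \<le> n" using prefix_length_le by fastforce
  with s show "length s \<le> n \<and> pre x (length s) = s"
    by (auto simp: prefix_def list_eq_iff_nth_eq nth_append)
next
  assume "length s \<le> n \<and> pre x (length s) = s"
  then show "prefix s (pre x n)" using prefix_pre[of "length s" n x] by simp
qed

lemma ex_pre: "\<exists>x :: nat \<Rightarrow> 'a. pre x (length s) = s"
  by (rule exI[of _ "\<lambda>i. s ! i"]) (simp add: list_eq_iff_nth_eq)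

lemma strong_embD [dest]: "strong_emb \<phi> \<Longrightarrow> tree_emb \<phi>"
  by (simp add: strong_emb_def)

lemma strong_emb_length: "strong_emb \<phi> \<Longrightarrow> length s = length t \<Longrightarrow> length (\<phi> s) = length (\<phi> t)"
  unfolding strong_emb_def by blast

lemma tree_emb_prefix:
  assumes "tree_emb \<phi>" "prefix s t" shows "prefix (\<phi> s) (\<phi> t)"
  using assms(2)
proof (induction t rule: rev_induct)
  case (snoc b t)
  moreover have "prefix (\<phi> t) (\<phi> (t @ [b]))"
    using assms(1) append_prefixD unfolding tree_emb_def by blast
  ultimately show ?case by (auto simp: prefix_snoc)
qed (use assms in auto)

lemma tree_emb_snoc:
  "tree_emb \<phi> \<Longrightarrow> prefix (s @ [b]) t \<Longrightarrow> prefix (\<phi> s @ [b]) (\<phi> t)"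
  using tree_emb_prefix[of \<phi> "s @ [b]" t] prefix_order.trans[of "\<phi> s @ [b]" "\<phi> (s @ [b])" "\<phi> t"]
  by (simp add: tree_emb_def)

lemma tree_emb_length: "tree_emb \<phi> \<Longrightarrow> length s \<le> length (\<phi> s)"
proof (induction s rule: rev_induct)
  case (snoc b s)
  then show ?case using prefix_length_le[of "\<phi> s @ [b]" "\<phi> (s @ [b])"] by (simp add: tree_emb_def)
qed simp

lemma tree_emb_comp: "tree_emb \<phi> \<Longrightarrow> tree_emb \<psi> \<Longrightarrow> tree_emb (\<phi> \<circ> \<psi>)"
  unfolding tree_emb_def[of "\<phi> \<circ> \<psi>"] by (simp add: tree_emb_snoc tree_emb_def)

lemma strong_emb_comp: "strong_emb \<phi> \<Longrightarrow> strong_emb \<psi> \<Longrightarrow> strong_emb (\<phi> \<circ> \<psi>)"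
  unfolding strong_emb_def[of "\<phi> \<circ> \<psi>"]
  using strong_emb_length[of \<phi>] strong_emb_length[of \<psi>] tree_emb_comp strong_embD
  by (metis comp_apply)

lemma tlim_pre:
  assumes "tree_emb \<phi>"
  shows "pre (tlim \<phi> x) (length (\<phi> (pre x n))) = \<phi> (pre x n)"
proof (rule nth_equalityI)
  fix i assume i: "i < length (pre (tlim \<phi> x) (length (\<phi> (pre x n))))"
  have i': "i < length (\<phi> (pre x (Suc i)))"
    using tree_emb_length[OF assms, of "pre x (Suc i)"] by simp
  have "prefix (\<phi> (pre x (Suc i))) (\<phi> (pre x n)) \<or> prefix (\<phi> (pre x n)) (\<phi> (pre x (Suc i)))"
    using tree_emb_prefix[OF assms] prefix_pre[of "Suc i" n x] prefix_pre[of n "Suc i" x]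
      nat_le_linear[of n "Suc i"] by blast
  then have "\<phi> (pre x (Suc i)) ! i = \<phi> (pre x n) ! i"
    using i i' by (auto simp: prefix_def nth_append)
  with i show "pre (tlim \<phi> x) (length (\<phi> (pre x n))) ! i = \<phi> (pre x n) ! i"
    by (simp add: tlim_def)
qed simp

lemma tlim_eqI:
  assumes "tree_emb \<phi>" "\<And>n. pre y (length (\<phi> (pre x n))) = \<phi> (pre x n)"
  shows "tlim \<phi> x = y"
proof
  fix n
  have "n < length (\<phi> (pre x (Suc n)))"
    using tree_emb_length[OF assms(1), of "pre x (Suc n)"] by simp
  then show "tlim \<phi> x n = y n"
    using arg_cong[OF assms(2)[of "Suc n"], of "\<lambda>s. s ! n"] by (simp add: tlim_def)
qed

lemma tlim_pre_eq:
  assumes "tree_emb \<phi>" "pre x n = pre y n"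
  shows "pre (tlim \<phi> x) n = pre (tlim \<phi> y) n"
proof (rule pre_eq_mono)
  show "pre (tlim \<phi> x) (length (\<phi> (pre y n))) = pre (tlim \<phi> y) (length (\<phi> (pre y n)))"
    using tlim_pre[OF assms(1), of x n] unfolding assms(2) tlim_pre[OF assms(1)] .
  show "n \<le> length (\<phi> (pre y n))"
    using tree_emb_length[OF assms(1), of "pre y n"] by simp
qed

lemma tlim_comp:
  assumes "tree_emb \<phi>" "tree_emb \<psi>"
  shows "tlim (\<phi> \<circ> \<psi>) x = tlim \<phi> (tlim \<psi> x)"
proof (rule tlim_eqI[OF tree_emb_comp[OF assms]])
  fix n
  show "pre (tlim \<phi> (tlim \<psi> x)) (length ((\<phi> \<circ> \<psi>) (pre x n))) = (\<phi> \<circ> \<psi>) (pre x n)"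
    using tlim_pre[OF assms(1), of "tlim \<psi> x" "length (\<psi> (pre x n))"] tlim_pre[OF assms(2), of x n]
    by simp
qed

lemma node_less_prefix: "s \<prec>\<^sub>l t \<Longrightarrow> prefix s s' \<Longrightarrow> prefix t t' \<Longrightarrow> s' \<prec>\<^sub>l t'"
  unfolding node_less_def by (meson prefix_order.trans)

lemma node_less_emb: "tree_emb \<phi> \<Longrightarrow> s \<prec>\<^sub>l t \<Longrightarrow> \<phi> s \<prec>\<^sub>l \<phi> t"
  unfolding node_less_def using tree_emb_snoc by blast

lemma node_less_snoc: "s @ [False] \<prec>\<^sub>l s @ [True]"
  by (auto simp: node_less_def)

lemma prefix_snoc_pre_iff: "prefix (u @ [b]) (pre x n) \<longleftrightarrow>
    length u < n \<and> pre x (length u) = u \<and> x (length u) = b"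
  by (auto simp: prefix_pre_iff pre_Suc)

lemma cantor_less_iff: "x \<sqsubset> y \<longleftrightarrow> (\<exists>n. pre x n \<prec>\<^sub>l pre y n)"
proof
  assume "x \<sqsubset> y"
  then obtain n where n: "\<forall>m<n. x m = y m" "\<not> x n" "y n" by (auto simp: cantor_less_def)
  then have "pre x n = pre y n" by (simp add: pre_eq_iff)
  with n have "pre x (Suc n) \<prec>\<^sub>l pre y (Suc n)"
    by (auto simp: node_less_def pre_Suc intro!: exI[of _ "pre y n"])
  then show "\<exists>n. pre x n \<prec>\<^sub>l pre y n" ..
next
  assume "\<exists>n. pre x n \<prec>\<^sub>l pre y n"
  then obtain n u where "pre x (length u) = u" "pre y (length u) = u" "\<not> x (length u)" "y (length u)"
    unfolding node_less_def prefix_snoc_pre_iff by blast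
  then have "\<forall>m<length u. x m = y m" "\<not> x (length u)" "y (length u)"
    by (simp_all flip: pre_eq_iff)
  then show "x \<sqsubset> y" unfolding cantor_less_def by blast
qed

lemma node_less_pre_mono: "pre x n \<prec>\<^sub>l pre y n \<Longrightarrow> n \<le> m \<Longrightarrow> pre x m \<prec>\<^sub>l pre y m"
  by (meson node_less_prefix prefix_pre)

lemma tlim_less:
  assumes "tree_emb \<phi>" "x \<sqsubset> y" shows "tlim \<phi> x \<sqsubset> tlim \<phi> y"
proof -
  obtain n where "pre x n \<prec>\<^sub>l pre y n" using assms(2) cantor_less_iff by blast
  then have "\<phi> (pre x n) \<prec>\<^sub>l \<phi> (pre y n)" by (rule node_less_emb[OF assms(1)])
  then have "pre (tlim \<phi> x) (length (\<phi> (pre x n))) \<prec>\<^sub>l pre (tlim \<phi> y) (length (\<phi> (pre y n)))"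
    by (simp add: tlim_pre assms(1))
  then have "pre (tlim \<phi> x) (max (length (\<phi> (pre x n))) (length (\<phi> (pre y n)))) \<prec>\<^sub>l
     pre (tlim \<phi> y) (max (length (\<phi> (pre x n))) (length (\<phi> (pre y n))))"
    by (rule node_less_prefix) (auto intro: prefix_pre)
  then show ?thesis using cantor_less_iff by blast
qed

lemma cantor_less_irrefl [simp]: "\<not> x \<sqsubset> x"
  by (simp add: cantor_less_def)

lemma cantor_less_total: "x \<noteq> y \<Longrightarrow> x \<sqsubset> y \<or> y \<sqsubset> x"
  and cantor_less_trans: "x \<sqsubset> y \<Longrightarrow> y \<sqsubset> z \<Longrightarrow> x \<sqsubset> z"
proof -
  interpret C: linorder "\<lambda>x y. x \<sqsubset> y \<or> x = y" "(\<sqsubset>)" by (rule linorder_cantor)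
  show "x \<noteq> y \<Longrightarrow> x \<sqsubset> y \<or> y \<sqsubset> x" by (simp add: C.neq_iff)
  show "x \<sqsubset> y \<Longrightarrow> y \<sqsubset> z \<Longrightarrow> x \<sqsubset> z" by (rule C.less_trans)
qed

lemma inj_tlim: "tree_emb \<phi> \<Longrightarrow> inj (tlim \<phi>)"
proof (rule injI, rule ccontr)
  fix x y assume "tree_emb \<phi>" "tlim \<phi> x = tlim \<phi> y" "x \<noteq> y"
  then show False
    using cantor_less_total[of x y] tlim_less[of \<phi> x y] tlim_less[of \<phi> y x] by auto
qed

section \<open>Open, compact and perfect sets in terms of finite prefixes\<close>

lemma open_cantor_iff:
  "open (S :: (nat \<Rightarrow> 'a :: discrete_topology) set) \<longleftrightarrow> (\<forall>x\<in>S. \<exists>n. \<forall>y. pre y n = pre x n \<longrightarrow> y \<in> S)"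
proof
  assume "open S"
  then have *: "\<forall>x\<in>S. \<exists>U. finite {i. U i \<noteq> UNIV} \<and> (\<forall>i. open (U i)) \<and> x \<in> Pi\<^sub>E UNIV U \<and> Pi\<^sub>E UNIV U \<subseteq> S"
    by (simp add: open_fun_def openin_product_topology_alt)
  show "\<forall>x\<in>S. \<exists>n. \<forall>y. pre y n = pre x n \<longrightarrow> y \<in> S"
  proof
    fix x assume "x \<in> S"
    with * obtain U where U: "finite {i. U i \<noteq> UNIV}" "x \<in> Pi\<^sub>E UNIV U" "Pi\<^sub>E UNIV U \<subseteq> S" by meson
    obtain n where n: "\<forall>i\<in>{i. U i \<noteq> UNIV}. i < n" using finite_nat_set_iff_bounded[THEN iffD1, OF U(1)] by blast
    have "y \<in> S" if "pre y n = pre x n" for y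
    proof -
      have "y i \<in> U i" for i using n that U(2) by (cases "U i = UNIV") (auto simp: pre_eq_iff PiE_def)
      then show ?thesis using U(3) by (auto simp: PiE_def)
    qed
    then show "\<exists>n. \<forall>y. pre y n = pre x n \<longrightarrow> y \<in> S" by blast
  qed
next
  assume *: "\<forall>x\<in>S. \<exists>n. \<forall>y. pre y n = pre x n \<longrightarrow> y \<in> S"
  show "open S"
    unfolding open_fun_def openin_product_topology_alt
  proof (intro conjI ballI)
    fix x assume "x \<in> S"
    then obtain n where n: "\<And>y. pre y n = pre x n \<Longrightarrow> y \<in> S" using * by blast
    show "\<exists>U. finite {i \<in> UNIV. U i \<noteq> topspace euclidean} \<and> (\<forall>i\<in>UNIV. openin euclidean (U i)) \<and>
        x \<in> Pi\<^sub>E UNIV U \<and> Pi\<^sub>E UNIV U \<subseteq> S"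
    proof (intro exI conjI)
      let ?U = "\<lambda>i. if i < n then {x i} else UNIV"
      have "{i. ?U i \<noteq> UNIV} \<subseteq> {..<n}" by auto
      then show "finite {i \<in> UNIV. ?U i \<noteq> topspace euclidean}" using finite_subset by fastforce
      show "Pi\<^sub>E UNIV ?U \<subseteq> S"
      proof
        fix y assume "y \<in> Pi\<^sub>E UNIV ?U"
        then have "y i = x i" if "i < n" for i using PiE_mem[of y UNIV ?U i] that by simp
        then show "y \<in> S" by (intro n) (simp add: pre_eq_iff)
      qed
    qed (auto simp: open_discrete)
  qed
qed

lemma closed_cantorD:
  assumes "closed (S :: cantor set)" "\<And>n. \<exists>y\<in>S. pre y n = pre x n"
  shows "x \<in> S"
proof (rule ccontr)
  assume "x \<notin> S"
  moreover have "open (- S)" using assms(1) by (simp add: open_closed)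
  ultimately obtain n where "\<forall>y. pre y n = pre x n \<longrightarrow> y \<in> - S"
    unfolding open_cantor_iff by blast
  with assms(2) show False by blast
qed

lemma compact_cantor: "compact (UNIV :: cantor set)"
proof -
  have "compact_space (euclidean :: bool topology)"
    by (simp add: compact_space_def finite_imp_compact)
  then have "compact_space (product_topology (\<lambda>_. euclidean :: bool topology) (UNIV :: nat set))"
    by (simp add: compact_space_product_topology)
  then have "compactin euclidean (UNIV :: cantor set)"
    by (simp only: euclidean_product_topology compact_space_def topspace_euclidean)
  then show ?thesis by (simp only: compactin_euclidean_iff)
qed

lemma perfect_range_tlim:
  assumes "tree_emb \<phi>" shows "perfect (range (tlim \<phi>))"
  unfolding perfect_def
proof (intro conjI allI notI)
  have "continuous_on UNIV (tlim \<phi>)"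
    unfolding continuous_on_open_vimage[OF open_UNIV]
  proof (intro allI impI)
    fix B :: "cantor set" assume B: "open B"
    show "open (tlim \<phi> -` B \<inter> UNIV)"
      unfolding open_cantor_iff
    proof
      fix x assume "x \<in> tlim \<phi> -` B \<inter> UNIV"
      then obtain n where n: "\<And>y. pre y n = pre (tlim \<phi> x) n \<Longrightarrow> y \<in> B"
        using B unfolding open_cantor_iff by blast
      have "tlim \<phi> y \<in> B" if "pre y n = pre x n" for y
        using that by (intro n tlim_pre_eq[OF assms])
      then show "\<exists>n. \<forall>y. pre y n = pre x n \<longrightarrow> y \<in> tlim \<phi> -` B \<inter> UNIV"
        by blast
    qed
  qed
  then have "compact (range (tlim \<phi>))"
    using compact_continuous_image compact_cantor by blast
  then have "compactin euclidean (range (tlim \<phi>))" by (simp only: compactin_euclidean_iff)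
  moreover have "\<exists>U V. open U \<and> open V \<and> x \<in> U \<and> y \<in> V \<and> disjnt U V" if "x \<noteq> y" for x y :: bool
    using that by (intro exI[of _ "{x}"] exI[of _ "{y}"]) (simp add: open_discrete)
  then have "Hausdorff_space (euclidean :: bool topology)"
    by (simp add: Hausdorff_space_def)
  then have "Hausdorff_space (product_topology (\<lambda>_. euclidean :: bool topology) (UNIV :: nat set))"
    by (simp add: Hausdorff_space_product_topology)
  then have "Hausdorff_space (euclidean :: cantor topology)"
    by (simp only: euclidean_product_topology)
  ultimately show "closed (range (tlim \<phi>))"
    using compactin_imp_closedin closed_closedin by blast
next
  fix z assume "z isolated_in range (tlim \<phi>)"
  then obtain x T where T: "open T" "T \<inter> range (tlim \<phi>) = {tlim \<phi> x}"
    by (auto simp: isolated_in_def)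
  then obtain n where n: "\<forall>y. pre y n = pre (tlim \<phi> x) n \<longrightarrow> y \<in> T"
    unfolding open_cantor_iff by blast
  define y where "y = x(n := \<not> x n)"
  have "pre y n = pre x n" by (simp add: y_def pre_eq_iff)
  then have "tlim \<phi> y \<in> T" using n tlim_pre_eq[OF assms] by blast
  with T(2) have "tlim \<phi> y = tlim \<phi> x" by blast
  then have "y = x" using inj_tlim[OF assms] by (simp add: inj_eq)
  then show False by (auto simp: y_def fun_eq_iff dest: spec[of _ n])
qed auto

text \<open>The infinite composition of \<open>B j\<close>, \<open>B (j + 1)\<close>, ... . It makes
  sense when \<open>B i\<close> fixes all nodes shorter than \<open>i\<close>: then a node
  \<open>s\<close> is moved only by the factors with index at most \<open>length s\<close>.\<close>

function fuse :: "(nat \<Rightarrow> bool list \<Rightarrow> bool list) \<Rightarrow> nat \<Rightarrow> bool list \<Rightarrow> bool list" where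
  "fuse B j s = (if length s < j then s else B j (fuse B (Suc j) s))"
  by pat_completeness auto
termination by (relation "Wellfounded.measure (\<lambda>(B, j, s). Suc (length s) - j)") auto

declare fuse.simps [simp del]

lemma fuse_id: "length s < j \<Longrightarrow> fuse B j s = s"
  by (simp add: fuse.simps)

lemma fuse_unfold:
  assumes "\<And>s. length s < j \<Longrightarrow> B j s = s"
  shows "fuse B j = B j \<circ> fuse B (Suc j)"
proof
  fix s show "fuse B j s = (B j \<circ> fuse B (Suc j)) s"
    using assms fuse.simps[of B j s] by (cases "length s < j") (auto simp: fuse_id)
qed

lemma tree_emb_fuse:
  assumes "\<And>j. tree_emb (B j)" "\<And>j s. length s < j \<Longrightarrow> B j s = s"
  shows "tree_emb (fuse B j)"
  unfolding tree_emb_def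
proof (intro allI)
  fix s b
  show "prefix (fuse B j s @ [b]) (fuse B j (s @ [b]))"
  proof (induction "Suc (Suc (length s)) - j" arbitrary: j)
    case 0
    then show ?case by (simp add: fuse_id)
  next
    case (Suc k)
    have "prefix (fuse B (Suc j) s @ [b]) (fuse B (Suc j) (s @ [b]))"
      using Suc by (intro Suc) simp
    then show ?case
      using tree_emb_snoc[OF assms(1)[of j]] fuse_unfold[of j B] by (simp add: assms(2))
  qed
qed

lemma strong_emb_fuse:
  assumes "\<And>j. strong_emb (B j)" "\<And>j s. length s < j \<Longrightarrow> B j s = s"
  shows "strong_emb (fuse B j)"
  unfolding strong_emb_def
proof (intro conjI allI impI)
  show "tree_emb (fuse B j)" using assms by (intro tree_emb_fuse) auto
  fix s t :: "bool list" assume "length s = length t"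
  then show "length (fuse B j s) = length (fuse B j t)"
  proof (induction "Suc (length s) - j" arbitrary: j)
    case (Suc k)
    then have "length (fuse B (Suc j) s) = length (fuse B (Suc j) t)" by simp
    then show ?case using fuse_unfold[of j B] by (simp add: assms(2)) (rule strong_emb_length[OF assms(1)])
  qed (simp add: fuse_id)
qed

section \<open>The Halpern--Laeuchli theorem and end-homogeneity\<close>

lemma vprefix_split: "None \<in> set w \<Longrightarrow> \<exists>r. w = map Some (vprefix w) @ None # r"
  by (induction w) (auto simp: vprefix_def split: option.splits)

text \<open>The Halpern--Laeuchli theorem for the \<open>2 ^ j\<close> trees above the nodes of level \<open>j\<close>. It is the
  Carlson--Simpson theorem for the alphabet \<open>Pow {\<sigma>. length \<sigma> = j}\<close>: a letter is a simultaneous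
  choice of a direction in each of these trees.\<close>

lemma halpern_laeuchli:
  fixes col :: "(bool list \<Rightarrow> bool list) \<Rightarrow> 'c" and j :: nat
  assumes fin: "finite (range col)"
    and dep: "\<And>x y. (\<And>\<sigma>. length \<sigma> = j \<Longrightarrow> x \<sigma> = y \<sigma>) \<Longrightarrow> col x = col y"
  shows "\<exists>\<Theta>. strong_emb \<Theta> \<and> (\<forall>s. length s < j \<longrightarrow> \<Theta> s = s) \<and>
    (\<exists>c. \<forall>x n. (\<forall>\<sigma>. length \<sigma> = j \<longrightarrow> prefix \<sigma> (x \<sigma>) \<and> length (x \<sigma>) = n) \<longrightarrow> col (\<Theta> \<circ> x) = c)"
proof -
  \<comment> \<open>A word over the alphabet extends all nodes of level \<open>j\<close> at once:
    the coordinate \<sigma> of a letter \<open>a\<close> is the truth value of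
    \<open>\<sigma> \<in> a\<close>.\<close>
  define col' :: "bool list set list \<Rightarrow> 'c" where "col' W = col (\<lambda>\<sigma>. \<sigma> @ map (\<lambda>a. \<sigma> \<in> a) W)" for W
  let ?A = "Pow {\<sigma> :: bool list. length \<sigma> = j}"
  have "finite (range col')"
    by (rule finite_subset[OF _ fin]) (auto simp: col'_def)
  moreover have "finite ?A" using finite_lists_length_eq[of "UNIV :: bool set" j] by simp
  ultimately obtain w c where w: "\<And>k. None \<in> set (w k)"
    and c: "\<And>as. set as \<subseteq> ?A \<Longrightarrow> col' (winst w as @ vprefix (w (length as))) = c"
    by (rule carlson_simpson) blast
  \<comment> \<open>The coordinate \<sigma> of the variable words, with the bits of \<open>y\<close>
    put in for the variables. \<open>T\<close> continues up to the next variable, where the tree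
    above \<sigma> splits. The lengths depend on \<open>length y\<close> only.\<close>
  define K where "K \<sigma> y = concat (map (\<lambda>i. map (case_option (y ! i) (\<lambda>a. \<sigma> \<in> a)) (w i)) [0..<length y])"
    for \<sigma> :: "bool list" and y :: "bool list"
  define T where "T \<sigma> y = K \<sigma> y @ map (\<lambda>a. \<sigma> \<in> a) (vprefix (w (length y)))" for \<sigma> y
  define \<Theta> where "\<Theta> s = (if length s < j then s else take j s @ T (take j s) (drop j s))" for s
  have K_snoc: "K \<sigma> (y @ [b]) = K \<sigma> y @ map (case_option b (\<lambda>a. \<sigma> \<in> a)) (w (length y))" for \<sigma> y b
  proof -
    have "map (\<lambda>i. map (case_option ((y @ [b]) ! i) (\<lambda>a. \<sigma> \<in> a)) (w i)) [0..<length y] =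
        map (\<lambda>i. map (case_option (y ! i) (\<lambda>a. \<sigma> \<in> a)) (w i)) [0..<length y]"
      by (rule map_cong) (auto simp: nth_append)
    then show ?thesis by (simp add: K_def del: map_eq_conv)
  qed
  have T_snoc: "prefix (T \<sigma> y @ [b]) (T \<sigma> (y @ [b]))" for \<sigma> y b
  proof -
    obtain r where r: "w (length y) = map Some (vprefix (w (length y))) @ None # r"
      using vprefix_split[OF w] by blast
    have "map (case_option b (\<lambda>a. \<sigma> \<in> a)) (w (length y)) =
        map (\<lambda>a. \<sigma> \<in> a) (vprefix (w (length y))) @ b # map (case_option b (\<lambda>a. \<sigma> \<in> a)) r"
      by (subst r) simp
    then show ?thesis by (simp add: T_def K_snoc)
  qed
  have "tree_emb \<Theta>"
    unfolding tree_emb_def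
  proof (intro allI)
    fix s :: "bool list" and b
    consider "Suc (length s) < j" | "Suc (length s) = j" | "j \<le> length s" by linarith
    then show "prefix (\<Theta> s @ [b]) (\<Theta> (s @ [b]))"
      by cases (use T_snoc in \<open>auto simp: \<Theta>_def\<close>)
  qed
  moreover have "length (\<Theta> s) = length (\<Theta> t)" if "length s = length t" for s t
    using that by (simp add: \<Theta>_def T_def K_def length_concat comp_def)
  ultimately have "strong_emb \<Theta>" unfolding strong_emb_def by blast
  moreover have "col (\<Theta> \<circ> x) = c"
    if x: "\<forall>\<sigma>. length \<sigma> = j \<longrightarrow> prefix \<sigma> (x \<sigma>) \<and> length (x \<sigma>) = n" for x n
  proof -
    \<comment> \<open>The letters that lead from level \<open>j\<close> to \<open>x\<close>, read in
      all trees simultaneously.\<close>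
    define as where "as = map (\<lambda>i. {\<sigma>. length \<sigma> = j \<and> x \<sigma> ! (j + i)}) [0..<n - j]"
    have "col (\<Theta> \<circ> x) = col' (winst w as @ vprefix (w (length as)))"
      unfolding col'_def
    proof (rule dep)
      fix \<sigma> :: "bool list" assume \<sigma>: "length \<sigma> = j"
      with x have "prefix \<sigma> (x \<sigma>)" "length (x \<sigma>) = n" by blast+
      then have x\<sigma>: "take j (x \<sigma>) = \<sigma>" "length (drop j (x \<sigma>)) = n - j" "j \<le> n"
        using \<sigma> by (auto simp: prefix_def)
      have "K \<sigma> (drop j (x \<sigma>)) = map (\<lambda>a. \<sigma> \<in> a) (winst w as)"
        unfolding K_def winst_def inst_def map_concat map_map
      proof (rule arg_cong[of _ _ concat], rule map_cong)
        show "[0..<length (drop j (x \<sigma>))] = [0..<length as]" using x\<sigma> by (simp add: as_def)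
        fix i assume "i \<in> set [0..<length as]"
        then have "i < n - j" by (simp add: as_def)
        then show "map (case_option (drop j (x \<sigma>) ! i) (\<lambda>a. \<sigma> \<in> a)) (w i) =
            (map (\<lambda>a. \<sigma> \<in> a) \<circ> (\<lambda>i. map (case_option (as ! i) id) (w i))) i"
          using \<sigma> x\<sigma> \<open>length (x \<sigma>) = n\<close> by (auto simp: as_def split: option.splits)
      qed
      moreover have "length as = length (drop j (x \<sigma>))" using x\<sigma> by (simp add: as_def)
      ultimately show "(\<Theta> \<circ> x) \<sigma> = \<sigma> @ map (\<lambda>a. \<sigma> \<in> a) (winst w as @ vprefix (w (length as)))"
        using x\<sigma> \<open>length (x \<sigma>) = n\<close> by (simp add: \<Theta>_def T_def)
    qed
    also have "\<dots> = c" by (rule c) (auto simp: as_def)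
    finally show ?thesis .
  qed
  moreover have "\<Theta> s = s" if "length s < j" for s
    using that by (simp add: \<Theta>_def)
  ultimately show ?thesis by blast
qed

section \<open>Tuples of nodes on one level and their end-homogeneous colourings\<close>

definition level_tuple :: "bool list list \<Rightarrow> bool" where
  "level_tuple X \<longleftrightarrow> sorted_wrt (\<prec>\<^sub>l) X \<and> (\<exists>n. \<forall>s\<in>set X. length s = n)"

definition extends :: "bool list list \<Rightarrow> bool list list \<Rightarrow> bool" where
  "extends Z X \<longleftrightarrow> list_all2 prefix Z X \<and> (\<exists>n. \<forall>s\<in>set X. length s = n)"

text \<open>The nodes that do not split continue with \<open>False\<close>. This is what happens in
  the skew subtree at a level where one of its nodes splits.\<close>

definition split_at :: "bool list list \<Rightarrow> nat \<Rightarrow> bool list list" where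
  "split_at X i = map (\<lambda>s. s @ [False]) (take (Suc i) X) @ (X ! i @ [True]) #
     map (\<lambda>s. s @ [False]) (drop (Suc i) X)"

text \<open>\<open>C X \<kappa>\<close> is the colour of the \<open>N\<close>-tuple that arises from the \<open>m\<close>-tuple \<open>X\<close> by the
  \<open>N - m\<close> successive splittings \<open>\<kappa>\<close>.\<close>

definition end_homogeneous :: "nat \<Rightarrow> nat \<Rightarrow> (bool list list \<Rightarrow> nat list \<Rightarrow> bool) \<Rightarrow> bool" where
  "end_homogeneous N m C \<longleftrightarrow> (\<forall>Z X \<kappa>. level_tuple Z \<longrightarrow> length Z = m \<longrightarrow> extends Z X \<longrightarrow>
     length \<kappa> = N - m \<longrightarrow> set \<kappa> \<subseteq> {..<N} \<longrightarrow> C X \<kappa> = C Z \<kappa>)"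

definition split_compatible :: "nat \<Rightarrow> nat \<Rightarrow> (bool list list \<Rightarrow> nat list \<Rightarrow> bool) \<Rightarrow> bool" where
  "split_compatible N m C \<longleftrightarrow> (\<forall>X i \<kappa>. level_tuple X \<longrightarrow> length X = m \<longrightarrow> i < m \<longrightarrow>
     length \<kappa> = N - Suc m \<longrightarrow> set \<kappa> \<subseteq> {..<N} \<longrightarrow> C (split_at X i) \<kappa> = C X (i # \<kappa>))"

lemma node_less_irrefl [simp]: "\<not> s \<prec>\<^sub>l s"
  by (auto simp: node_less_def prefix_def)

lemma level_tuple_distinct: "level_tuple X \<Longrightarrow> distinct X"
  unfolding level_tuple_def by (auto simp: distinct_conv_nth sorted_wrt_iff_nth_less)
    (metis linorder_neqE_nat node_less_irrefl)

lemma extends_level_tuple: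
  assumes "level_tuple Z" "extends Z X" shows "level_tuple X"
proof -
  have "X ! i \<prec>\<^sub>l X ! k" if "i < k" "k < length X" for i k
  proof (rule node_less_prefix[of "Z ! i" "Z ! k"])
    show "Z ! i \<prec>\<^sub>l Z ! k" "prefix (Z ! i) (X ! i)" "prefix (Z ! k) (X ! k)"
      using that assms
      by (auto simp: level_tuple_def extends_def sorted_wrt_iff_nth_less list_all2_conv_all_nth)
  qed
  then show ?thesis
    using assms(2) by (simp add: level_tuple_def extends_def sorted_wrt_iff_nth_less)
qed

lemma level_tuple_map:
  assumes "strong_emb \<psi>" "level_tuple X" shows "level_tuple (map \<psi> X)"
proof -
  obtain n where n: "\<forall>s\<in>set X. length s = n" using assms(2) by (auto simp: level_tuple_def)
  have "length (\<psi> s) = length (\<psi> (replicate n False))" if "s \<in> set X" for s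
    using n that by (intro strong_emb_length[OF assms(1)]) simp
  moreover have "sorted_wrt (\<prec>\<^sub>l) (map \<psi> X)"
    using assms node_less_emb[OF strong_embD[OF assms(1)]]
    by (simp add: level_tuple_def sorted_wrt_iff_nth_less)
  ultimately show ?thesis unfolding level_tuple_def by auto
qed

lemma extends_map:
  assumes "strong_emb \<psi>" "extends Z X" shows "extends (map \<psi> Z) (map \<psi> X)"
proof -
  obtain n where n: "\<forall>s\<in>set X. length s = n" using assms(2) by (auto simp: extends_def)
  have "length (\<psi> s) = length (\<psi> (replicate n False))" if "s \<in> set X" for s
    using n that by (intro strong_emb_length[OF assms(1)]) simp
  moreover have "list_all2 prefix (map \<psi> Z) (map \<psi> X)"
    using assms tree_emb_prefix[of \<psi>] by (auto simp: extends_def list_all2_conv_all_nth)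
  ultimately show ?thesis unfolding extends_def by auto
qed

lemma length_split_at: "i < length X \<Longrightarrow> length (split_at X i) = Suc (length X)"
  by (simp add: split_at_def)

lemma level_tuple_split_at:
  assumes "level_tuple X" "i < length X" shows "level_tuple (split_at X i)"
proof -
  have X: "X = take i X @ X ! i # drop (Suc i) X" using assms(2) by (simp add: id_take_nth_drop)
  have s: "sorted_wrt (\<prec>\<^sub>l) (take i X @ X ! i # drop (Suc i) X)"
    using assms(1) X by (simp add: level_tuple_def)
  have mono: "s \<prec>\<^sub>l t \<Longrightarrow> s @ [b] \<prec>\<^sub>l t @ [b']" for s t b b'
    by (rule node_less_prefix) auto
  have "sorted_wrt (\<prec>\<^sub>l) (split_at X i)"
    using s unfolding split_at_def take_Suc_conv_app_nth[OF assms(2)]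
    by (auto simp: sorted_wrt_append sorted_wrt_map mono node_less_snoc elim!: sorted_wrt_mono_rel[rotated])
  moreover obtain n where "\<forall>s\<in>set X. length s = n" using assms(1) by (auto simp: level_tuple_def)
  then have "\<forall>s\<in>set (split_at X i). length s = Suc n"
    using assms(2) by (auto simp: split_at_def dest: in_set_takeD in_set_dropD)
  ultimately show ?thesis unfolding level_tuple_def by blast
qed

lemma extends_split_at_map:
  assumes "strong_emb \<psi>" "level_tuple X" "i < length X"
  shows "extends (split_at (map \<psi> X) i) (map \<psi> (split_at X i))"
proof -
  have p: "prefix (\<psi> s @ [b]) (\<psi> (s @ [b]))" for s b
    using assms(1) by (auto simp: strong_emb_def tree_emb_def)
  have "list_all2 prefix (split_at (map \<psi> X) i) (map \<psi> (split_at X i))"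
    unfolding split_at_def using assms(3) p
    by (auto simp: list_all2_map1 list_all2_map2 take_map drop_map intro!: list_all2_appendI list_all2_refl)
  then show ?thesis
    using level_tuple_map[OF assms(1) level_tuple_split_at[OF assms(2,3)]]
    by (simp add: extends_def level_tuple_def)
qed

lemma end_homogeneous_map:
  assumes "strong_emb \<psi>" "end_homogeneous N m C"
  shows "end_homogeneous N m (\<lambda>X. C (map \<psi> X))"
  unfolding end_homogeneous_def
proof (intro allI impI)
  fix Z X \<kappa>
  assume "level_tuple Z" "length Z = m" "extends Z X" "length \<kappa> = N - m" "set \<kappa> \<subseteq> {..<N}"
  then show "C (map \<psi> X) \<kappa> = C (map \<psi> Z) \<kappa>"
    using assms(2)[unfolded end_homogeneous_def, rule_format, of "map \<psi> Z" "map \<psi> X" \<kappa>]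
      level_tuple_map[OF assms(1)] extends_map[OF assms(1)] by simp
qed

text \<open>An embedding does not commute with \<open>split_at\<close>: the image of a split tuple
  only extends the split of the image tuple. End-homogeneity for \<open>Suc m\<close> bridges the
  gap.\<close>

lemma split_compatible_map:
  assumes "strong_emb \<psi>" "end_homogeneous N (Suc m) C" "split_compatible N m C"
  shows "split_compatible N m (\<lambda>X. C (map \<psi> X))"
  unfolding split_compatible_def
proof (intro allI impI)
  fix X i \<kappa>
  assume X: "level_tuple X" "length X = m" "i < m" "length \<kappa> = N - Suc m" "set \<kappa> \<subseteq> {..<N}"
  note lt = level_tuple_map[OF assms(1) X(1)]
  have "C (map \<psi> (split_at X i)) \<kappa> = C (split_at (map \<psi> X) i) \<kappa>"
    using X lt extends_split_at_map[OF assms(1) X(1), of i]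
    by (intro assms(2)[unfolded end_homogeneous_def, rule_format])
      (simp_all add: level_tuple_split_at length_split_at)
  also have "\<dots> = C (map \<psi> X) (i # \<kappa>)"
    using X lt by (intro assms(3)[unfolded split_compatible_def, rule_format]) simp_all
  finally show "C (map \<psi> (split_at X i)) \<kappa> = C (map \<psi> X) (i # \<kappa>)" .
qed

text \<open>A fusion of \<open>halpern_laeuchli\<close> over all levels. Step \<open>j\<close>
  equalizes the colours of all extensions of each m-tuple of level \<open>j\<close>, and the later
  steps fix that level.\<close>

lemma ex_end_homogeneous:
  "\<exists>\<psi>. strong_emb \<psi> \<and> end_homogeneous N m (\<lambda>X. C (map \<psi> X))"
proof -
  \<comment> \<open>The whole table of colours of the tuples above level \<open>j\<close> counts as
    one colour, so a single embedding serves all tuples; the bounds on \<open>\<kappa>\<close> keep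
    the table finite.\<close>
  define col where "col j \<alpha> x = {(S, \<kappa>). (length S = m \<and> set S \<subseteq> {\<sigma>. length \<sigma> = j}) \<and>
      (length \<kappa> = N - m \<and> set \<kappa> \<subseteq> {..<N}) \<and> C (map \<alpha> (map x S)) \<kappa>}"
    for j and \<alpha> x :: "bool list \<Rightarrow> bool list"
  define sel where "sel j x n \<longleftrightarrow> (\<forall>\<sigma>. length \<sigma> = j \<longrightarrow> prefix \<sigma> (x \<sigma>) \<and> length (x \<sigma>) = n)"
    for j n and x :: "bool list \<Rightarrow> bool list"
  have "\<exists>\<Theta>. strong_emb \<Theta> \<and> (\<forall>s. length s < j \<longrightarrow> \<Theta> s = s) \<and>
      (\<exists>c. \<forall>x n. sel j x n \<longrightarrow> col j \<alpha> (\<Theta> \<circ> x) = c)" for j \<alpha>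
    unfolding sel_def
  proof (rule halpern_laeuchli)
    have "finite {\<sigma> :: bool list. length \<sigma> = j}"
      using finite_lists_length_eq[of "UNIV :: bool set" j] by simp
    then have fin: "finite ({S. set S \<subseteq> {\<sigma> :: bool list. length \<sigma> = j} \<and> length S = m} \<times>
        {\<kappa>. set \<kappa> \<subseteq> {..<N} \<and> length \<kappa> = N - m})"
      by (intro finite_cartesian_product finite_lists_length_eq) auto
    show "finite (range (col j \<alpha>))"
      by (rule finite_subset[OF _ finite_Pow_iff[THEN iffD2, OF fin]]) (auto simp: col_def)
  next
    fix x y :: "bool list \<Rightarrow> bool list"
    assume xy: "\<And>\<sigma>. length \<sigma> = j \<Longrightarrow> x \<sigma> = y \<sigma>"
    have "map x S = map y S" if "set S \<subseteq> {\<sigma>. length \<sigma> = j}" for S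
      using that xy by (auto intro: map_cong)
    then have "C (map \<alpha> (map x S)) \<kappa> = C (map \<alpha> (map y S)) \<kappa>" if "set S \<subseteq> {\<sigma>. length \<sigma> = j}" for S \<kappa>
      using that by metis
    then show "col j \<alpha> x = col j \<alpha> y" unfolding col_def by blast
  qed
  then obtain Th where Th: "\<And>j \<alpha>. strong_emb (Th j \<alpha>)" "\<And>j \<alpha> s. length s < j \<Longrightarrow> Th j \<alpha> s = s"
    "\<And>j \<alpha>. \<exists>c. \<forall>x n. sel j x n \<longrightarrow> col j \<alpha> (Th j \<alpha> \<circ> x) = c"
    by metis
  define \<alpha> where "\<alpha> = rec_nat id (\<lambda>j \<alpha>. \<alpha> \<circ> Th j \<alpha>)"
  define B where "B j = Th j (\<alpha> j)" for j
  have \<alpha>_Suc: "\<alpha> (Suc j) = \<alpha> j \<circ> B j" for j by (simp add: \<alpha>_def B_def)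
  have B: "\<And>j. strong_emb (B j)" "\<And>j s. length s < j \<Longrightarrow> B j s = s"
    by (simp_all add: B_def Th)
  have \<gamma>: "fuse B 0 = \<alpha> j \<circ> fuse B j" for j
  proof (induction j)
    case (Suc j)
    then show ?case using fuse_unfold[of j B] B(2) by (simp add: \<alpha>_Suc comp_assoc)
  qed (simp add: \<alpha>_def)
  have "end_homogeneous N m (\<lambda>X. C (map (fuse B 0) X))"
    unfolding end_homogeneous_def
  proof (intro allI impI)
    fix Z X \<kappa>
    assume Z: "level_tuple Z" "length Z = m" and X: "extends Z X"
      and \<kappa>: "length \<kappa> = N - m" "set \<kappa> \<subseteq> {..<N}"
    show "C (map (fuse B 0) X) \<kappa> = C (map (fuse B 0) Z) \<kappa>"
    proof (cases "Z = []")
      case True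
      then show ?thesis using X by (simp add: extends_def)
    next
      case False
      obtain j where j: "\<forall>s\<in>set Z. length s = j" using Z(1) by (auto simp: level_tuple_def)
      obtain n where n: "\<forall>s\<in>set X. length s = n" using X by (auto simp: extends_def)
      have ZX: "list_all2 prefix Z X" using X by (simp add: extends_def)
      then have len: "length Z = length X" by (rule list_all2_lengthD)
      have pZX: "prefix (Z ! k) (X ! k)" if "k < length X" for k
        using ZX that len by (simp add: list_all2_conv_all_nth)
      have "j \<le> n"
        using False len j n pZX[of 0] prefix_length_le[of "Z ! 0" "X ! 0"] by (cases Z; cases X) auto
      \<comment> \<open>A choice of extensions for all nodes of level \<open>j\<close> that agrees
        with \<open>X\<close> above \<open>Z\<close>. It is compared with \<open>id\<close>, which
        chooses the nodes of level \<open>j\<close> themselves; by distinctness of \<open>Z\<close>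
        it is well defined there.\<close>
      define x' where "x' \<sigma> = (case map_of (zip Z X) \<sigma> of Some t \<Rightarrow> t | None \<Rightarrow> \<sigma> @ replicate (n - j) False)" for \<sigma>
      have nth: "x' (Z ! k) = X ! k" if "k < length X" for k
        using that len level_tuple_distinct[OF Z(1)] by (simp add: x'_def map_of_zip_nth)
      then have mapX: "map x' Z = X" using len by (simp add: list_eq_iff_nth_eq)
      have x': "prefix \<sigma> (x' \<sigma>) \<and> length (x' \<sigma>) = n" if "length \<sigma> = j" for \<sigma>
      proof (cases "\<sigma> \<in> set Z")
        case True
        then obtain k where "k < length Z" "\<sigma> = Z ! k" by (auto simp: in_set_conv_nth)
        then show ?thesis using nth pZX n len by simp
      next
        case False
        then have "map_of (zip Z X) \<sigma> = None" using len by (simp add: map_of_zip_is_None)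
        then show ?thesis using that \<open>j \<le> n\<close> by (simp add: x'_def)
      qed
      let ?F = "fuse B (Suc j)"
      have F: "strong_emb ?F" by (intro strong_emb_fuse B)
      have F_id: "?F \<sigma> = \<sigma>" if "length \<sigma> = j" for \<sigma> using that by (simp add: fuse_id)
      have "prefix \<sigma> (?F (x' \<sigma>)) \<and> length (?F (x' \<sigma>)) = length (?F (replicate n False))"
        if "length \<sigma> = j" for \<sigma>
        using tree_emb_prefix[OF strong_embD[OF F], of \<sigma> "x' \<sigma>"]
          strong_emb_length[OF F, of "x' \<sigma>" "replicate n False"] x'[OF that] F_id[OF that] by simp
      then have "sel j (?F \<circ> x') (length (?F (replicate n False)))" by (simp add: sel_def)
      moreover have "sel j id j" by (simp add: sel_def)
      ultimately have "col j (\<alpha> j) (B j \<circ> (?F \<circ> x')) = col j (\<alpha> j) (B j \<circ> id)"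
        using Th(3)[of j "\<alpha> j"] unfolding B_def by metis
      moreover have "set Z \<subseteq> {\<sigma>. length \<sigma> = j}" using j by auto
      ultimately have "C (map (\<alpha> j) (map (B j \<circ> (?F \<circ> x')) Z)) \<kappa> = C (map (\<alpha> j) (map (B j \<circ> id) Z)) \<kappa>"
        using \<kappa> Z(2) unfolding col_def set_eq_iff by (auto dest: spec[of _ "(Z, \<kappa>)"])
      moreover have "map (\<alpha> j) (map (B j \<circ> (?F \<circ> x')) Z) = map (fuse B 0) X"
        by (simp add: \<gamma>[of "Suc j"] \<alpha>_Suc flip: mapX)
      moreover have "map (\<alpha> j) (map (B j \<circ> id) Z) = map (fuse B 0) Z"
        using j F_id by (simp add: \<gamma>[of "Suc j"] \<alpha>_Suc)
      ultimately show ?thesis by (simp only:)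
    qed
  qed
  then show ?thesis using strong_emb_fuse[of B 0] B by blast
qed

text \<open>Descending induction on m, starting at N, where \<open>\<kappa>\<close> is empty. The
  colour of an m-tuple is defined through its splittings into m + 1 nodes and then made
  end-homogeneous by a further embedding, which does not harm the larger m.\<close>

lemma ex_end_homogeneous_chain:
  assumes "\<And>Z X. level_tuple Z \<Longrightarrow> length Z = N \<Longrightarrow> extends Z X \<Longrightarrow> c X = c Z"
  shows "\<exists>\<psi> C. strong_emb \<psi> \<and> (\<forall>X. length X = N \<longrightarrow> C X [] = c (map \<psi> X)) \<and>
    (\<forall>m\<le>N. end_homogeneous N m C) \<and> (\<forall>m<N. split_compatible N m C)"
proof -
  have "\<exists>\<psi> C. strong_emb \<psi> \<and> (\<forall>X. length X = N \<longrightarrow> C X [] = c (map \<psi> X)) \<and>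
      (\<forall>m. N - k \<le> m \<longrightarrow> m \<le> N \<longrightarrow> end_homogeneous N m C) \<and>
      (\<forall>m. N - k \<le> m \<longrightarrow> m < N \<longrightarrow> split_compatible N m C)" if "k \<le> N" for k
    using that
  proof (induction k)
    case 0
    have "strong_emb (\<lambda>s. s)" by (simp add: strong_emb_def tree_emb_def)
    moreover have "end_homogeneous N N (\<lambda>X \<kappa>. c X)"
      using assms by (simp add: end_homogeneous_def)
    ultimately show ?case
      by (intro exI[of _ "\<lambda>s. s"] exI[of _ "\<lambda>X \<kappa>. c X"]) (simp add: le_antisym)
  next
    case (Suc k)
    then obtain \<psi> C where IH: "strong_emb \<psi>" "\<And>X. length X = N \<Longrightarrow> C X [] = c (map \<psi> X)"
      "\<And>m. N - k \<le> m \<Longrightarrow> m \<le> N \<Longrightarrow> end_homogeneous N m C"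
      "\<And>m. N - k \<le> m \<Longrightarrow> m < N \<Longrightarrow> split_compatible N m C"
      by auto
    define M where "M = N - Suc k"
    have M: "M < N" "Suc M = N - k" using Suc.prems by (auto simp: M_def)
    \<comment> \<open>\<open>hd \<kappa>\<close> is the node to be split next; this makes
      \<open>C'\<close> compatible with splitting at \<open>M\<close> by definition.\<close>
    define C' where "C' X \<kappa> = (if length X = M then C (split_at X (hd \<kappa>)) (tl \<kappa>) else C X \<kappa>)" for X \<kappa>
    have eh: "end_homogeneous N m C'" if "N - k \<le> m" "m \<le> N" for m
    proof -
      have "C' X \<kappa> = C X \<kappa>" if "length X = m" for X \<kappa>
        using that \<open>N - k \<le> m\<close> M by (simp add: C'_def)
      then show ?thesis using IH(3)[OF that]
        unfolding end_homogeneous_def extends_def by (metis list_all2_lengthD)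
    qed
    have sp: "split_compatible N m C'" if "M \<le> m" "m < N" for m
    proof (cases "m = M")
      case True
      then show ?thesis by (auto simp: split_compatible_def C'_def length_split_at)
    next
      case False
      then have m: "N - k \<le> m" using that M by simp
      then show ?thesis using IH(4)[OF m \<open>m < N\<close>] M
        by (auto simp: split_compatible_def C'_def length_split_at)
    qed
    obtain \<psi>' where \<psi>': "strong_emb \<psi>'" "end_homogeneous N M (\<lambda>X. C' (map \<psi>' X))"
      using ex_end_homogeneous by blast
    let ?D = "\<lambda>X. C' (map \<psi>' X)"
    show ?case
      unfolding M_def[symmetric]
    proof (intro exI[of _ "\<psi> \<circ> \<psi>'"] exI[of _ ?D] conjI allI impI)
      show "strong_emb (\<psi> \<circ> \<psi>')" using IH(1) \<psi>'(1) by (rule strong_emb_comp)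
      show "?D X [] = c (map (\<psi> \<circ> \<psi>') X)" if "length X = N" for X
        using that M IH(2)[of "map \<psi>' X"] by (simp add: C'_def)
      show "end_homogeneous N m ?D" if "M \<le> m" "m \<le> N" for m
      proof (cases "m = M")
        case False
        then show ?thesis using that M by (intro end_homogeneous_map \<psi>' eh) auto
      qed (use \<psi>' in simp)
      show "split_compatible N m ?D" if "M \<le> m" "m < N" for m
        using that M by (intro split_compatible_map \<psi>' eh sp) auto
    qed
  qed
  from this[of N] show ?thesis by simp
qed

section \<open>The Baire property\<close>

definition meager :: "'a::topological_space set \<Rightarrow> bool" where
  "meager A \<longleftrightarrow> (\<exists>K :: nat \<Rightarrow> 'a set. (\<forall>n. closed (K n) \<and> interior (K n) = {}) \<and> A \<subseteq> (\<Union>n. K n))"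

definition baire_property :: "'a::topological_space set \<Rightarrow> bool" where
  "baire_property A \<longleftrightarrow> (\<exists>U. open U \<and> meager ((A - U) \<union> (U - A)))"

lemma meager_subset: "meager A \<Longrightarrow> B \<subseteq> A \<Longrightarrow> meager B"
  unfolding meager_def by (meson order_trans)

lemma meager_nowhere_dense: "closed A \<Longrightarrow> interior A = {} \<Longrightarrow> meager A"
  unfolding meager_def by (rule exI[of _ "\<lambda>_. A"]) auto

lemma meager_UN_nat:
  fixes A :: "nat \<Rightarrow> 'a::topological_space set"
  assumes "\<And>n. meager (A n)" shows "meager (\<Union>n. A n)"
proof -
  have "\<forall>n. \<exists>K :: nat \<Rightarrow> 'a set. (\<forall>m. closed (K m) \<and> interior (K m) = {}) \<and> A n \<subseteq> (\<Union>m. K m)"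
    using assms unfolding meager_def by blast
  then obtain K :: "nat \<Rightarrow> nat \<Rightarrow> 'a set" where K: "\<And>n. (\<forall>m. closed (K n m) \<and> interior (K n m) = {}) \<and> A n \<subseteq> (\<Union>m. K n m)"
    by metis
  show ?thesis
    unfolding meager_def
  proof (intro exI conjI allI)
    let ?K = "\<lambda>k. K (fst (prod_decode k)) (snd (prod_decode k))"
    show "closed (?K k)" "interior (?K k) = {}" for k using K by auto
    show "(\<Union>n. A n) \<subseteq> (\<Union>k. ?K k)"
    proof
      fix x assume "x \<in> (\<Union>n. A n)"
      then obtain n m where "x \<in> K n m" using K by blast
      then show "x \<in> (\<Union>k. ?K k)" by (intro UN_I[of "prod_encode (n, m)"]) auto
    qed
  qed
qed

lemma meager_empty [simp]: "meager {}"
  by (rule meager_nowhere_dense) auto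

lemma meager_UN:
  assumes "countable I" "\<And>i. i \<in> I \<Longrightarrow> meager (A i)" shows "meager (\<Union>i\<in>I. A i)"
proof (cases "I = {}")
  case False
  have "meager (\<Union>n. A (from_nat_into I n))"
    by (intro meager_UN_nat assms(2) from_nat_into False)
  moreover have "(\<Union>i\<in>I. A i) \<subseteq> (\<Union>n. A (from_nat_into I n))"
    using from_nat_into_surj[OF assms(1)] by fast
  ultimately show ?thesis by (rule meager_subset)
qed simp

lemma meager_Un: "meager A \<Longrightarrow> meager B \<Longrightarrow> meager (A \<union> B)"
  using meager_UN[of "{True, False}" "\<lambda>b. if b then A else B"] by (auto simp: Un_commute)

lemma baire_property_open: "open U \<Longrightarrow> baire_property U"
  unfolding baire_property_def by (rule exI[of _ U]) auto

lemma baire_property_meager: "meager A \<Longrightarrow> baire_property A"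
  unfolding baire_property_def by (rule exI[of _ "{}"]) auto

text \<open>The complement of A agrees with the exterior of U up to a meager set, because the
  boundary of an open set is nowhere dense.\<close>

lemma baire_property_Compl:
  assumes "baire_property A" shows "baire_property (- A)"
proof -
  obtain U where U: "open U" "meager ((A - U) \<union> (U - A))" using assms by (auto simp: baire_property_def)
  have "interior (closure U - U) = {}"
  proof -
    have "interior (closure U - U) \<inter> U = {}" using interior_subset by blast
    then have "interior (closure U - U) \<inter> closure U = {}" by (simp add: open_Int_closure_eq_empty)
    then show ?thesis using interior_subset by blast
  qed
  moreover have "closed (closure U - U)" using U(1) by (simp add: closed_Diff)
  ultimately have "meager (closure U - U)" by (intro meager_nowhere_dense)
  then have "meager (((A - U) \<union> (U - A)) \<union> (closure U - U))" by (intro meager_Un U)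
  then have "meager ((- A - - closure U) \<union> (- closure U - - A))"
    by (rule meager_subset) (use closure_subset in auto)
  then show ?thesis unfolding baire_property_def by (intro exI[of _ "- closure U"]) auto
qed

lemma baire_property_UN:
  fixes A :: "nat \<Rightarrow> 'a::topological_space set"
  assumes "\<And>n. baire_property (A n)" shows "baire_property (\<Union>n. A n)"
proof -
  have "\<forall>n. \<exists>U. open U \<and> meager ((A n - U) \<union> (U - A n))"
    using assms unfolding baire_property_def by blast
  then obtain U where U: "\<And>n. open (U n) \<and> meager ((A n - U n) \<union> (U n - A n))"
    by metis
  have "meager (\<Union>n. (A n - U n) \<union> (U n - A n))" using U by (intro meager_UN_nat) blast
  then have "meager (((\<Union>n. A n) - (\<Union>n. U n)) \<union> ((\<Union>n. U n) - (\<Union>n. A n)))"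
    by (rule meager_subset) blast
  then show ?thesis unfolding baire_property_def using U by blast
qed

lemma baire_property_Un:
  assumes "baire_property A" "baire_property B" shows "baire_property (A \<union> B)"
proof -
  have "baire_property (\<Union>n::nat. if n = 0 then A else B)"
    by (rule baire_property_UN) (use assms in auto)
  moreover have "(\<Union>n::nat. if n = 0 then A else B) = A \<union> B"
    by (auto split: if_splits intro: exI[of _ "Suc 0"])
  ultimately show ?thesis by simp
qed

lemma baire_property_Int: "baire_property A \<Longrightarrow> baire_property B \<Longrightarrow> baire_property (A \<inter> B)"
  using baire_property_Compl[OF baire_property_Un[OF baire_property_Compl baire_property_Compl], of A B]
  by (simp add: Compl_Un)

lemma baire_property_Diff: "baire_property A \<Longrightarrow> baire_property B \<Longrightarrow> baire_property (A - B)"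
  by (simp add: Diff_eq baire_property_Int baire_property_Compl)

text \<open>Let U be the union of the basic open sets in which A is meager; by countability A is
  meager in U. The hull is -U together with the meager set A \<inter> U. If B contains A, then -U -
  B agrees with an open W up to a meager set; A is meager in W, so W lies in U and -U - B is
  meager.\<close>

lemma ex_baire_hull:
  fixes A :: "'a::topological_space set" and \<B> :: "'a set set"
  assumes \<B>: "countable \<B>" "topological_basis \<B>"
  obtains E where "A \<subseteq> E" "baire_property E"
    "\<And>B. A \<subseteq> B \<Longrightarrow> baire_property B \<Longrightarrow> meager (E - B)"
proof -
  define U where "U = (\<Union>b\<in>{b \<in> \<B>. meager (A \<inter> b)}. b)"
  have "open U" using \<B>(2) by (auto simp: U_def intro: topological_basis_open)
  have "meager (\<Union>b\<in>{b \<in> \<B>. meager (A \<inter> b)}. A \<inter> b)"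
    by (rule meager_UN) (use \<B>(1) in auto)
  then have AU: "meager (A \<inter> U)" by (rule meager_subset) (auto simp: U_def)
  show thesis
  proof
    show "A \<subseteq> - U \<union> (A \<inter> U)" by blast
    show "baire_property (- U \<union> (A \<inter> U))"
      using \<open>open U\<close> AU by (intro baire_property_Un baire_property_Compl baire_property_open baire_property_meager)
    fix B assume B: "A \<subseteq> B" "baire_property B"
    then have "baire_property (- U - B)"
      using \<open>open U\<close> by (intro baire_property_Diff baire_property_Compl[OF baire_property_open])
    then obtain W where W: "open W" "meager (((- U - B) - W) \<union> (W - (- U - B)))"
      unfolding baire_property_def by blast
    have "W \<subseteq> U"
    proof
      fix x assume "x \<in> W"
      then obtain b where b: "b \<in> \<B>" "x \<in> b" "b \<subseteq> W"
        using \<B>(2) W(1) topological_basisE by metis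
      have "meager (A \<inter> b)" by (rule meager_subset[OF W(2)]) (use b B in auto)
      with b show "x \<in> U" by (auto simp: U_def)
    qed
    then show "meager (- U \<union> (A \<inter> U) - B)"
      using B(1) by (intro meager_subset[OF W(2)]) blast
  qed
qed

text \<open>Nikodym's theorem. In the proof, \<open>E s\<close> is a hull of the contribution of the branches
  through \<open>s\<close>.\<close>

lemma baire_property_souslin_op:
  fixes A :: "nat list \<Rightarrow> 'a::topological_space set" and \<B> :: "'a set set"
  assumes \<B>: "countable \<B>" "topological_basis \<B>"
    and A: "\<And>s. baire_property (A s)" shows "baire_property (souslin_op A)"
proof -
  define S where "S s = (\<Union>x\<in>{x :: nat \<Rightarrow> nat. pre x (length s) = s}. \<Inter>n. A (pre x n))" for s
  have S_sub: "S s \<subseteq> A s" for s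
  proof
    fix z assume "z \<in> S s"
    then obtain x where "pre x (length s) = s" "z \<in> (\<Inter>n. A (pre x n))" by (auto simp: S_def)
    then show "z \<in> A s" by (metis INT_iff UNIV_I)
  qed
  have S_Suc: "S s \<subseteq> (\<Union>n. S (s @ [n]))" for s
    by (force simp: S_def pre_Suc)
  have "\<exists>E. S s \<subseteq> E \<and> baire_property E \<and>
      (\<forall>B. S s \<subseteq> B \<longrightarrow> baire_property B \<longrightarrow> meager (E - B))" for s
    by (rule ex_baire_hull[OF \<B>, of "S s"]) blast
  then have "\<forall>s. \<exists>E. S s \<subseteq> E \<and> baire_property E \<and>
      (\<forall>B. S s \<subseteq> B \<longrightarrow> baire_property B \<longrightarrow> meager (E - B))"
    by blast
  then have "\<exists>H. \<forall>s. S s \<subseteq> H s \<and> baire_property (H s) \<and>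
      (\<forall>B. S s \<subseteq> B \<longrightarrow> baire_property B \<longrightarrow> meager (H s - B))"
    by (rule choice)
  then obtain H where H: "\<And>s. S s \<subseteq> H s" "\<And>s. baire_property (H s)"
    "\<And>s B. S s \<subseteq> B \<Longrightarrow> baire_property B \<Longrightarrow> meager (H s - B)"
    by blast
  \<comment> \<open>The intersection with \<open>A s\<close> ensures that a point in all
    \<open>E\<close> along a branch lies in the Souslin set.\<close>
  define E where "E s = H s \<inter> A s" for s
  have E: "S s \<subseteq> E s" "baire_property (E s)" for s
    using H S_sub A by (auto simp: E_def intro: baire_property_Int)
  \<comment> \<open>The points of \<open>E s\<close> that no successor of \<open>s\<close> retains.
    The union over the successors contains \<open>S s\<close>, so minimality of the hull makes
    \<open>D s\<close> meager; outside all \<open>D s\<close> one can follow a branch from the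
    root.\<close>
  define D where "D s = E s - (\<Union>n. E (s @ [n]))" for s
  have "meager (D s)" for s
  proof (rule meager_subset)
    show "meager (H s - (\<Union>n. E (s @ [n])))"
      using S_Suc[of s] E(1) by (intro H(3) baire_property_UN E(2)) blast
  qed (auto simp: D_def E_def)
  then have D: "meager (\<Union>s. D s)" by (intro meager_UN) auto
  have soS: "souslin_op A = S []" by (simp add: souslin_op_def S_def pre_def)
  have "E [] - S [] \<subseteq> (\<Union>s. D s)"
  proof
    fix z assume z: "z \<in> E [] - S []"
    show "z \<in> (\<Union>s. D s)"
    proof (rule ccontr)
      assume "z \<notin> (\<Union>s. D s)"
      then have "\<exists>n. z \<in> E s \<longrightarrow> z \<in> E (s @ [n])" for s by (auto simp: D_def)
      then obtain g where g: "\<And>s. z \<in> E s \<Longrightarrow> z \<in> E (s @ [g s])" by metis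
      define t where "t = rec_nat [] (\<lambda>_ s. s @ [g s])"
      have t: "t 0 = []" "\<And>k. t (Suc k) = t k @ [g (t k)]" by (simp_all add: t_def)
      have "pre (\<lambda>k. g (t k)) n = t n" for n by (induction n) (simp_all add: t pre_Suc)
      moreover have "z \<in> E (t n)" for n by (induction n) (use z in \<open>simp_all add: t g\<close>)
      ultimately have "z \<in> A (pre (\<lambda>k. g (t k)) n)" for n by (simp add: E_def)
      then have "z \<in> S []" unfolding S_def by auto
      with z show False by blast
    qed
  qed
  then have "baire_property (E [] - (E [] - S []))"
    by (intro baire_property_Diff E baire_property_meager[OF meager_subset[OF D]])
  moreover have "E [] - (E [] - S []) = S []" using E(1) by blast
  ultimately show ?thesis by (simp add: soS)
qed

section \<open>The Baire property of C-measurable families\<close>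

lemma topological_basis_cantor: "topological_basis (range (\<lambda>s. {x :: cantor. pre x (length s) = s}))"
proof (rule topological_basisI)
  fix S :: "cantor set" assume "S \<in> range (\<lambda>s. {x. pre x (length s) = s})"
  then obtain s where S: "S = {x. pre x (length s) = s}" by blast
  show "open S"
    unfolding open_cantor_iff
  proof (intro ballI exI[of _ "length s"] allI impI)
    fix x y assume "x \<in> S" "pre y (length s) = pre x (length s)"
    then show "y \<in> S" by (simp add: S)
  qed
next
  fix S :: "cantor set" and x assume "open S" "x \<in> S"
  then obtain n where "\<forall>y. pre y n = pre x n \<longrightarrow> y \<in> S" unfolding open_cantor_iff by blast
  then show "\<exists>B'\<in>range (\<lambda>s. {x. pre x (length s) = s}). x \<in> B' \<and> B' \<subseteq> S"
    by (intro bexI[of _ "{y. pre y (length (pre x n)) = pre x n}"] rangeI) auto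
qed

text \<open>One point codes an N-tuple of points, so the category arguments for tuples take place in
  \<open>cantor\<close> itself.\<close>

definition deinterleave :: "nat \<Rightarrow> cantor \<Rightarrow> nat \<Rightarrow> cantor" where
  "deinterleave N z i = (\<lambda>n. z (n * N + i))"

lemma pre_deinterleave:
  assumes "pre z (n * N) = pre z' (n * N)" "i < N"
  shows "pre (deinterleave N z i) n = pre (deinterleave N z' i) n"
proof -
  have "m * N + i < n * N" if "m < n" for m
  proof -
    have "m * N + i < Suc m * N" using assms(2) by simp
    also have "\<dots> \<le> n * N" using that by (intro mult_le_mono1) simp
    finally show ?thesis .
  qed
  then show ?thesis using assms(1) by (simp add: pre_eq_iff deinterleave_def)
qed

lemma ex_deinterleave:
  assumes "N > 0"
  obtains z where "\<And>i. i < N \<Longrightarrow> deinterleave N z i = x i"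
proof
  show "deinterleave N (\<lambda>k. x (k mod N) (k div N)) i = x i" if "i < N" for i
    using that by (simp add: deinterleave_def fun_eq_iff)
qed

lemma fin_sets_enum:
  assumes "monotone_on {..<N} (<) (\<sqsubset>) s" "N > 0"
  shows "s ` {..<N} \<in> fin_sets" "card (s ` {..<N}) = N" "incr_enum (s ` {..<N}) = restrict s {..<N}"
proof -
  have "inj_on s {..<N}"
    using assms(1) cantor_less_irrefl unfolding monotone_on_def inj_on_def
    by (metis linorder_neqE_nat)
  then show card: "card (s ` {..<N}) = N" by (simp add: card_image)
  show "s ` {..<N} \<in> fin_sets" using assms(2) by (auto simp: fin_sets_def)
  show "incr_enum (s ` {..<N}) = restrict s {..<N}"
    unfolding incr_enum_def
    by (rule the1_equality[OF incr_enum_ex1])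
      (use card assms(1) in \<open>auto simp: monotone_on_def\<close>)
qed

lemma topspace_fin_sets_topology: "topspace fin_sets_topology = fin_sets"
  using bij_betw_fin_sets
  by (auto simp: fin_sets_topology_def topspace_pullback_topology bij_betw_def)

text \<open>The sets whose preimage under the coding has the Baire property form a sigma-algebra
  that contains the open sets and, by \<open>baire_property_souslin_op\<close>, is closed under the
  Souslin operation. Codes are restricted to increasing tuples, an open condition, so that each code
  yields an N-element set together with its increasing enumeration.\<close>

lemma baire_property_C_measurable:
  assumes F: "\<F> \<in> C_measurable_sets fin_sets_topology" and \<alpha>: "tree_emb \<alpha>" and N: "N > 0"
  defines "\<Omega> \<equiv> {z. monotone_on {..<N} (<) (\<sqsubset>) (deinterleave N z)}"
  shows "baire_property {z \<in> \<Omega>. (\<lambda>i. tlim \<alpha> (deinterleave N z i)) ` {..<N} \<in> \<F>}"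
proof -
  define x where "x z i = tlim \<alpha> (deinterleave N z i)" for z i
  define \<theta> where "\<theta> z = x z ` {..<N}" for z
  have mono: "monotone_on {..<N} (<) (\<sqsubset>) (x z)" if "z \<in> \<Omega>" for z
    using that tlim_less[OF \<alpha>] by (auto simp: \<Omega>_def x_def monotone_on_def)
  have pre_x: "pre (x z i) n = pre (x z' i) n" if "pre z (n * N) = pre z' (n * N)" "i < N" for z z' i n
    unfolding x_def using that by (intro tlim_pre_eq[OF \<alpha>] pre_deinterleave)
  have "open \<Omega>"
    unfolding open_cantor_iff
  proof
    fix z assume z: "z \<in> \<Omega>"
    have "\<forall>p\<in>{(i, k). i < k \<and> k < N}. \<exists>n. pre (deinterleave N z (fst p)) n \<prec>\<^sub>l pre (deinterleave N z (snd p)) n"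
      using z by (auto simp: \<Omega>_def monotone_on_def simp flip: cantor_less_iff)
    from bchoice[OF this] obtain h where "\<forall>p\<in>{(i, k). i < k \<and> k < N}.
        pre (deinterleave N z (fst p)) (h p) \<prec>\<^sub>l pre (deinterleave N z (snd p)) (h p)" ..
    then have h: "pre (deinterleave N z i) (h (i, k)) \<prec>\<^sub>l pre (deinterleave N z k) (h (i, k))"
      if "i < k" "k < N" for i k using that by auto
    define n where "n = Max (h ` ({..<N} \<times> {..<N}))"
    have "h (i, k) \<le> n" if "i < k" "k < N" for i k
      using that unfolding n_def by (intro Max_ge) auto
    then have n: "pre (deinterleave N z i) n \<prec>\<^sub>l pre (deinterleave N z k) n" if "i < k" "k < N" for i k
      using h[OF that] that node_less_pre_mono by blast
    have "z' \<in> \<Omega>" if "pre z' (n * N) = pre z (n * N)" for z'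
    proof -
      have "deinterleave N z' i \<sqsubset> deinterleave N z' k" if "i < k" "k < N" for i k
        using n[OF that] pre_deinterleave[OF \<open>pre z' (n * N) = pre z (n * N)\<close>] that cantor_less_iff
        by (metis order.strict_trans)
      then show ?thesis by (simp add: \<Omega>_def monotone_on_def)
    qed
    then show "\<exists>n. \<forall>y. pre y n = pre z n \<longrightarrow> y \<in> \<Omega>" by blast
  qed
  define M where "M = {A. A \<subseteq> fin_sets \<and> baire_property {z \<in> \<Omega>. \<theta> z \<in> A}}"
  have fin: "\<theta> z \<in> fin_sets" if "z \<in> \<Omega>" for z
    unfolding \<theta>_def using fin_sets_enum[OF mono[OF that] N] by blast
  have "sigma_algebra (topspace fin_sets_topology) M"
    unfolding sigma_algebra_iff2 topspace_fin_sets_topology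
  proof (intro conjI ballI allI impI)
    show "M \<subseteq> Pow fin_sets" "{} \<in> M"
      by (auto simp: M_def baire_property_meager)
    fix A assume "A \<in> M"
    then have "baire_property (\<Omega> - {z \<in> \<Omega>. \<theta> z \<in> A})"
      using \<open>open \<Omega>\<close> by (intro baire_property_Diff) (auto simp: M_def baire_property_open)
    moreover have "\<Omega> - {z \<in> \<Omega>. \<theta> z \<in> A} = {z \<in> \<Omega>. \<theta> z \<in> fin_sets - A}" using fin by auto
    ultimately show "fin_sets - A \<in> M" by (simp add: M_def)
  next
    fix A :: "nat \<Rightarrow> _" assume A: "range A \<subseteq> M"
    then have "baire_property (\<Union>n. {z \<in> \<Omega>. \<theta> z \<in> A n})"
      by (intro baire_property_UN) (auto simp: M_def)
    moreover have "(\<Union>n. {z \<in> \<Omega>. \<theta> z \<in> A n}) = {z \<in> \<Omega>. \<theta> z \<in> (\<Union>n. A n)}" by auto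
    ultimately show "(\<Union>n. A n) \<in> M" using A by (auto simp: M_def)
  qed
  moreover have "{U. openin fin_sets_topology U} \<subseteq> M"
  proof safe
    fix U assume "openin fin_sets_topology U"
    then obtain V where V: "openin (sum_topology incr_seqs {1..}) V"
        "U = (\<lambda>F. (card F, incr_enum F)) -` V \<inter> fin_sets"
      unfolding fin_sets_topology_def openin_pullback_topology by blast
    from V(1) N have "openin (incr_seqs N) {s. (N, s) \<in> V}"
      unfolding openin_sum_topology by simp
    then obtain T where T: "openin (product_topology (\<lambda>_. euclidean) {..<N}) T"
      "{s. (N, s) \<in> V} = T \<inter> {s. monotone_on {..<N} (<) (\<sqsubset>) s}"
      unfolding incr_seqs_def openin_subtopology by blast
    have mono': "monotone_on {..<N} (<) (\<sqsubset>) (restrict (x z) {..<N})" if "z \<in> \<Omega>" for z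
      using mono[OF that] by (auto simp: monotone_on_def)
    have *: "\<theta> z \<in> U \<longleftrightarrow> restrict (x z) {..<N} \<in> T" if "z \<in> \<Omega>" for z
    proof -
      have "\<theta> z \<in> U \<longleftrightarrow> (N, restrict (x z) {..<N}) \<in> V"
        using fin[OF that] fin_sets_enum[OF mono[OF that] N] by (simp add: V(2) \<theta>_def)
      also have "\<dots> \<longleftrightarrow> restrict (x z) {..<N} \<in> {s. (N, s) \<in> V}" by simp
      also have "\<dots> \<longleftrightarrow> restrict (x z) {..<N} \<in> T" unfolding T(2) using mono'[OF that] by simp
      finally show ?thesis .
    qed
    have "open {z. restrict (x z) {..<N} \<in> T}"
      unfolding open_cantor_iff
    proof
      fix z assume "z \<in> {z. restrict (x z) {..<N} \<in> T}"
      then obtain W where W: "\<forall>i\<in>{..<N}. openin euclidean (W i)"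
          "restrict (x z) {..<N} \<in> Pi\<^sub>E {..<N} W" "Pi\<^sub>E {..<N} W \<subseteq> T"
        using T(1) unfolding openin_product_topology_alt by blast
      have "\<forall>i\<in>{..<N}. \<exists>n. \<forall>y. pre y n = pre (x z i) n \<longrightarrow> y \<in> W i"
      proof
        fix i assume i: "i \<in> {..<N}"
        then have "open (W i)" using W(1) by (intro open_openin[THEN iffD2]) blast
        moreover have "x z i \<in> W i" using PiE_mem[OF W(2) i] i by simp
        ultimately show "\<exists>n. \<forall>y. pre y n = pre (x z i) n \<longrightarrow> y \<in> W i"
          unfolding open_cantor_iff by blast
      qed
      from bchoice[OF this] obtain h
        where "\<forall>i\<in>{..<N}. \<forall>y. pre y (h i) = pre (x z i) (h i) \<longrightarrow> y \<in> W i" ..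
      then have h: "y \<in> W i" if "i < N" "pre y (h i) = pre (x z i) (h i)" for i y
        using that by blast
      define n where "n = Max (h ` {..<N})"
      have n: "h i \<le> n" if "i < N" for i using that unfolding n_def by (intro Max_ge) auto
      have "restrict (x z') {..<N} \<in> T" if "pre z' (n * N) = pre z (n * N)" for z'
      proof -
        have "x z' i \<in> W i" if "i < N" for i
          using that by (intro h pre_eq_mono[OF pre_x n] \<open>pre z' (n * N) = pre z (n * N)\<close>)
        then show ?thesis using W(3) by (intro subsetD[OF W(3)]) auto
      qed
      then show "\<exists>n. \<forall>y. pre y n = pre z n \<longrightarrow> y \<in> {z. restrict (x z) {..<N} \<in> T}" by blast
    qed
    with \<open>open \<Omega>\<close> have "open (\<Omega> \<inter> {z. restrict (x z) {..<N} \<in> T})" by blast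
    moreover have "\<Omega> \<inter> {z. restrict (x z) {..<N} \<in> T} = {z \<in> \<Omega>. \<theta> z \<in> U}" using * by auto
    ultimately show "U \<in> M" using V(2) by (simp add: M_def baire_property_open)
  qed
  moreover have "souslin_op A \<in> M" if "range A \<subseteq> M" for A
  proof -
    have "baire_property (souslin_op (\<lambda>s. {z \<in> \<Omega>. \<theta> z \<in> A s}))"
      using that by (intro baire_property_souslin_op[OF _ topological_basis_cantor]) (auto simp: M_def)
    moreover have "souslin_op (\<lambda>s. {z \<in> \<Omega>. \<theta> z \<in> A s}) = {z \<in> \<Omega>. \<theta> z \<in> souslin_op A}"
      by (auto simp: souslin_op_def)
    moreover have "souslin_op A \<subseteq> fin_sets"
      using that by (fastforce simp: souslin_op_def M_def)
    ultimately show ?thesis by (simp add: M_def)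
  qed
  ultimately have "\<F> \<in> M" using F unfolding C_measurable_sets_def by blast
  then show ?thesis by (simp add: M_def \<theta>_def x_def)
qed

section \<open>Deciding tuples at a finite level\<close>

text \<open>The tuples are treated one after another. Extending the nodes for a new tuple does not
  spoil the earlier ones, as \<open>D\<close> passes to extensions, and distinctness allows the
  nodes of a tuple to be extended independently.\<close>

lemma simultaneous_extension:
  assumes "finite \<S>" and \<S>: "\<And>S. S \<in> \<S> \<Longrightarrow> distinct S \<and> length S = N"
    and dense: "\<And>V. length V = N \<Longrightarrow> \<exists>V'. list_all2 prefix V V' \<and> D V'"
    and mono: "\<And>V V'. D V \<Longrightarrow> list_all2 prefix V V' \<Longrightarrow> D V'"
  shows "\<exists>v'. (\<forall>\<sigma>. prefix (v \<sigma>) (v' \<sigma>)) \<and> (\<forall>S\<in>\<S>. D (map v' S))"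
  using assms(1,2)
proof (induction \<S>)
  case empty
  then show ?case by (intro exI[of _ v]) auto
next
  case (insert S \<S>)
  then obtain v' where v': "\<And>\<sigma>. prefix (v \<sigma>) (v' \<sigma>)" "\<And>S. S \<in> \<S> \<Longrightarrow> D (map v' S)" by auto
  have S: "distinct S" "length S = N" using insert.prems by auto
  obtain V where V: "list_all2 prefix (map v' S) V" "D V" using dense[of "map v' S"] S by auto
  have lenV: "length V = length S" using V(1) list_all2_lengthD by fastforce
  define v'' where "v'' \<sigma> = (case map_of (zip S V) \<sigma> of Some t \<Rightarrow> t | None \<Rightarrow> v' \<sigma>)" for \<sigma>
  have nth: "v'' (S ! k) = V ! k" if "k < length S" for k
    using that S(1) lenV by (simp add: v''_def map_of_zip_nth)
  then have mapS: "map v'' S = V" using lenV by (simp add: list_eq_iff_nth_eq)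
  have ext: "prefix (v' \<sigma>) (v'' \<sigma>)" for \<sigma>
  proof (cases "\<sigma> \<in> set S")
    case True
    then obtain k where "k < length S" "\<sigma> = S ! k" by (auto simp: in_set_conv_nth)
    then show ?thesis using nth V(1) by (simp add: list_all2_conv_all_nth)
  next
    case False
    then have "map_of (zip S V) \<sigma> = None" using lenV by (simp add: map_of_zip_is_None)
    then show ?thesis by (simp add: v''_def)
  qed
  have "D (map v'' T)" if "T \<in> \<S>" for T
    using v'(2)[OF that] by (rule mono) (simp add: list_all2_conv_all_nth ext)
  moreover have "prefix (v \<sigma>) (v'' \<sigma>)" for \<sigma> using v'(1) ext prefix_order.trans by blast
  ultimately show ?case using mapS V(2) by (intro exI[of _ v'']) auto
qed

definition tuple_box :: "nat \<Rightarrow> bool list list \<Rightarrow> cantor set" where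
  "tuple_box N V = {z. \<forall>i<N. pre (deinterleave N z i) (length (V ! i)) = V ! i}"

lemma tuple_box_mono:
  assumes "list_all2 prefix V V'" "length V = N" shows "tuple_box N V' \<subseteq> tuple_box N V"
proof
  fix z assume z: "z \<in> tuple_box N V'"
  have "pre (deinterleave N z i) (length (V ! i)) = V ! i" if "i < N" for i
  proof -
    have "prefix (V ! i) (V' ! i)" using assms that by (simp add: list_all2_conv_all_nth)
    moreover have "V' ! i = pre (deinterleave N z i) (length (V' ! i))" using z that by (simp add: tuple_box_def)
    ultimately show ?thesis using prefix_pre_iff by metis
  qed
  then show "z \<in> tuple_box N V" by (simp add: tuple_box_def)
qed

lemma deinterleave_pre:
  assumes "\<And>i. i < N \<Longrightarrow> pre (deinterleave N z i) n = pre (deinterleave N z' i) n" "N > 0"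
  shows "pre z (n * N) = pre z' (n * N)"
  unfolding pre_eq_iff
proof (intro allI impI)
  fix k assume "k < n * N"
  then have "k div N < n" using assms(2) by (simp add: less_mult_imp_div_less)
  moreover have "k mod N < N" using assms(2) by simp
  ultimately have "deinterleave N z (k mod N) (k div N) = deinterleave N z' (k mod N) (k div N)"
    using assms(1)[of "k mod N"] by (simp add: pre_eq_iff)
  then show "z k = z' k" by (simp add: deinterleave_def)
qed

lemma open_Diff_nowhere_dense:
  fixes K :: "nat \<Rightarrow> 'a::topological_space set"
  assumes "open U" "U \<noteq> {}" "\<And>n. closed (K n) \<and> interior (K n) = {}"
  shows "open (U - (\<Union>k<n. K k)) \<and> U - (\<Union>k<n. K k) \<noteq> {}"
proof (induction n)
  case 0
  then show ?case using assms by simp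
next
  case (Suc n)
  let ?V = "U - (\<Union>k<n. K k)"
  have "U - (\<Union>k<Suc n. K k) = ?V - K n" by (auto simp: less_Suc_eq)
  moreover have "\<not> ?V \<subseteq> K n"
    using Suc assms(3)[of n] interior_maximal[of ?V "K n"] by auto
  ultimately show ?case using Suc assms(3)[of n] by (auto intro: open_Diff)
qed

lemma open_tuple_box:
  assumes "N > 0" shows "open (tuple_box N V)"
  unfolding open_cantor_iff
proof (intro ballI exI allI impI)
  let ?n = "Max ((\<lambda>i. length (V ! i)) ` {..<N})"
  fix z z' assume z: "z \<in> tuple_box N V" and eq: "pre z' (?n * N) = pre z (?n * N)"
  have "pre (deinterleave N z' i) (length (V ! i)) = V ! i" if "i < N" for i
  proof -
    have "length (V ! i) \<le> ?n" using that by (intro Max_ge) auto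
    then have "pre (deinterleave N z' i) (length (V ! i)) = pre (deinterleave N z i) (length (V ! i))"
      using pre_eq_mono[OF pre_deinterleave[OF eq that]] by blast
    then show ?thesis using z that by (simp add: tuple_box_def)
  qed
  then show "z' \<in> tuple_box N V" by (simp add: tuple_box_def)
qed

lemma tuple_box_nonempty:
  assumes "N > 0" shows "tuple_box N V \<noteq> {}"
proof -
  have "\<forall>i. \<exists>x. pre x (length (V ! i)) = V ! i" using ex_pre by blast
  then obtain x where x: "\<And>i. pre (x i) (length (V ! i)) = V ! i" by metis
  obtain z where "\<And>i. i < N \<Longrightarrow> deinterleave N z i = x i" using ex_deinterleave[OF assms] by blast
  with x have "z \<in> tuple_box N V" by (simp add: tuple_box_def)
  then show ?thesis by blast
qed

text \<open>The box either misses W or meets it in a nonempty open set; finitely many closed nowhere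
  dense sets can be removed from the open set so obtained.\<close>

lemma ex_decided_tuple_box:
  fixes K :: "nat \<Rightarrow> cantor set" and j :: nat
  assumes "N > 0" "open W" "\<And>n. closed (K n) \<and> interior (K n) = {}" "length V = N"
  shows "\<exists>V'. list_all2 prefix V V' \<and>
    (tuple_box N V' \<subseteq> W \<or> tuple_box N V' \<inter> W = {}) \<and> (\<forall>k<j. tuple_box N V' \<inter> K k = {})"
proof -
  define U where "U = (if tuple_box N V \<inter> W = {} then tuple_box N V else tuple_box N V \<inter> W)"
  have U: "open U" "U \<noteq> {}" "U \<subseteq> tuple_box N V" "U \<subseteq> W \<or> U \<inter> W = {}"
    using assms open_tuple_box tuple_box_nonempty by (auto simp: U_def)
  define O' where "O' = U - (\<Union>k<j. K k)"
  have "open O'" "O' \<noteq> {}" using open_Diff_nowhere_dense[where K = K and n = j, OF U(1,2) assms(3)] by (simp_all add: O'_def)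
  then obtain z L where z: "z \<in> O'" "\<And>y. pre y L = pre z L \<Longrightarrow> y \<in> O'"
    unfolding open_cantor_iff by blast
  define n where "n = Max (insert L ((\<lambda>i. length (V ! i)) ` {..<N}))"
  have n: "L \<le> n" "\<And>i. i < N \<Longrightarrow> length (V ! i) \<le> n" by (simp_all add: n_def)
  define V' where "V' = map (\<lambda>i. pre (deinterleave N z i) n) [0..<N]"
  have "z \<in> tuple_box N V" using z(1) U(3) by (auto simp: O'_def)
  then have "prefix (V ! i) (V' ! i)" if "i < N" for i
    using that n(2)[OF that] by (simp add: V'_def tuple_box_def prefix_pre_iff)
  then have "list_all2 prefix V V'" using assms(4) by (simp add: list_all2_conv_all_nth V'_def)
  moreover have "tuple_box N V' \<subseteq> O'"
  proof
    fix y assume "y \<in> tuple_box N V'"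
    then have "pre y (n * N) = pre z (n * N)"
      using assms(1) by (intro deinterleave_pre) (auto simp: tuple_box_def V'_def)
    moreover have "L \<le> n * N" using n(1) assms(1) by (intro order_trans[OF n(1)]) simp
    ultimately show "y \<in> O'" using z(2) pre_eq_mono by blast
  qed
  ultimately show ?thesis using U(4) by (intro exI[of _ V']) (auto simp: O'_def)
qed

text \<open>Mycielski's argument: the colour of an \<open>N\<close>-tuple of points becomes a function of any
  level at which the points are already separated.\<close>

lemma ex_strong_emb_decided:
  assumes S: "baire_property S" and N: "N > 0"
  shows "\<exists>g c. strong_emb g \<and> (\<forall>X z. level_tuple X \<longrightarrow> length X = N \<longrightarrow>
    (\<forall>i<N. \<exists>x. pre x (length (X ! i)) = X ! i \<and> deinterleave N z i = tlim g x) \<longrightarrow> z \<in> S \<longleftrightarrow> c X)"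
proof -
  obtain W where W: "open W" "meager ((S - W) \<union> (W - S))" using S unfolding baire_property_def by blast
  then obtain K :: "nat \<Rightarrow> cantor set" where K: "\<And>n. closed (K n) \<and> interior (K n) = {}"
    "(S - W) \<union> (W - S) \<subseteq> (\<Union>n. K n)" unfolding meager_def by blast
  \<comment> \<open>At level \<open>j\<close> the box is decided with respect to the open set
    \<open>W\<close> and avoids \<open>K 0\<close>, ..., \<open>K j\<close>.\<close>
  define D where "D j V \<longleftrightarrow> length V = N \<and> (tuple_box N V \<subseteq> W \<or> tuple_box N V \<inter> W = {}) \<and> (\<forall>k<Suc j. tuple_box N V \<inter> K k = {})"
    for j V
  define \<S> where "\<S> j = {X :: bool list list. distinct X \<and> length X = N \<and> set X \<subseteq> {\<sigma>. length \<sigma> = j}}" for j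
  define good where "good j v \<longleftrightarrow> (\<forall>X\<in>\<S> j. D j (map v X)) \<and>
      (\<forall>\<sigma> \<tau>. length \<sigma> = j \<longrightarrow> length \<tau> = j \<longrightarrow> length (v \<sigma>) = length (v \<tau>))"
    for j and v :: "bool list \<Rightarrow> bool list"
  have D_mono: "D j V'" if "D j V" "list_all2 prefix V V'" for j V V'
  proof -
    have "length V = N" using that by (simp add: D_def)
    then have "tuple_box N V' \<subseteq> tuple_box N V" "length V' = N"
      using tuple_box_mono that(2) list_all2_lengthD[OF that(2)] by auto
    moreover have "tuple_box N V \<subseteq> W \<or> tuple_box N V \<inter> W = {}"
      "\<And>k. k < Suc j \<Longrightarrow> tuple_box N V \<inter> K k = {}"
      using that(1) by (simp_all add: D_def)
    ultimately show ?thesis unfolding D_def by (intro conjI allI impI) (assumption, blast, blast)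
  qed
  have fin_lev: "finite {\<sigma> :: bool list. length \<sigma> = j}" for j
    using finite_lists_length_eq[of "UNIV :: bool set" j] by simp
  have step: "\<exists>v. (\<forall>\<sigma>. length \<sigma> = j \<longrightarrow> prefix (v0 \<sigma>) (v \<sigma>)) \<and> good j v" for j v0
  proof -
    have "finite (\<S> j)"
      by (rule finite_subset[OF _ finite_lists_length_eq[OF fin_lev[of j], of N]]) (auto simp: \<S>_def)
    then have "\<exists>v'. (\<forall>\<sigma>. prefix (v0 \<sigma>) (v' \<sigma>)) \<and> (\<forall>X\<in>\<S> j. D j (map v' X))"
    proof (rule simultaneous_extension)
      show "distinct X \<and> length X = N" if "X \<in> \<S> j" for X using that by (simp add: \<S>_def)
      show "\<exists>V'. list_all2 prefix V V' \<and> D j V'" if V: "length V = N" for V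
      proof -
        from ex_decided_tuple_box[where K = K and j = "Suc j", OF N W(1) K(1) V]
        obtain V' where V': "list_all2 prefix V V'" "tuple_box N V' \<subseteq> W \<or> tuple_box N V' \<inter> W = {}"
            "\<forall>k<Suc j. tuple_box N V' \<inter> K k = {}"
          by (elim exE conjE)
        moreover have "length V' = N" using list_all2_lengthD[OF V'(1)] V by simp
        ultimately show ?thesis unfolding D_def by blast
      qed
    qed (use D_mono in blast)
    then obtain v' where v': "\<And>\<sigma>. prefix (v0 \<sigma>) (v' \<sigma>)" "\<And>X. X \<in> \<S> j \<Longrightarrow> D j (map v' X)" by blast
    \<comment> \<open>Padding to a common length makes the embedding strong; decided boxes stay
      decided under extension.\<close>
    define M where "M = Max ((\<lambda>\<sigma>. length (v' \<sigma>)) ` {\<sigma>. length \<sigma> = j})"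
    define v where "v \<sigma> = v' \<sigma> @ replicate (M - length (v' \<sigma>)) False" for \<sigma>
    have "length (v' \<sigma>) \<le> M" if "length \<sigma> = j" for \<sigma>
      unfolding M_def using fin_lev that by (intro Max_ge) auto
    then have "length (v \<sigma>) = M" if "length \<sigma> = j" for \<sigma> using that by (simp add: v_def)
    moreover have "D j (map v X)" if "X \<in> \<S> j" for X
      by (rule D_mono[OF v'(2)[OF that]]) (simp add: list_all2_conv_all_nth v_def)
    moreover have "prefix (v0 \<sigma>) (v \<sigma>)" for \<sigma>
      using v'(1)[of \<sigma>] by (simp add: v_def prefix_prefix)
    ultimately show ?thesis unfolding good_def by (intro exI[of _ v]) simp
  qed
  have "\<exists>v. \<forall>j. good j (v j) \<and> (\<forall>\<sigma>. length \<sigma> = Suc j \<longrightarrow> prefix (v j (butlast \<sigma>) @ [last \<sigma>]) (v (Suc j) \<sigma>))"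
  proof (rule dependent_nat_choice)
    show "\<exists>v. good 0 v" using step by blast
    show "\<exists>v'. good (Suc j) v' \<and> (\<forall>\<sigma>. length \<sigma> = Suc j \<longrightarrow> prefix (v (butlast \<sigma>) @ [last \<sigma>]) (v' \<sigma>))" for v j
      using step[of "Suc j" "\<lambda>\<sigma>. v (butlast \<sigma>) @ [last \<sigma>]"] by blast
  qed
  then obtain v where v: "\<And>j. good j (v j)"
      "\<And>j \<sigma>. length \<sigma> = Suc j \<Longrightarrow> prefix (v j (butlast \<sigma>) @ [last \<sigma>]) (v (Suc j) \<sigma>)" by blast
  define g where "g s = v (length s) s" for s
  have "prefix (g s @ [b]) (g (s @ [b]))" for s b
    using v(2)[of "s @ [b]" "length s"] by (simp add: g_def)
  moreover have "length (g s) = length (g t)" if "length s = length t" for s t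
    unfolding g_def that using v(1)[of "length t", unfolded good_def] that by blast
  ultimately have g: "strong_emb g" unfolding strong_emb_def tree_emb_def by blast
  have decided: "D l (map g X)" if X: "level_tuple X" "length X = N" "\<forall>s\<in>set X. length s = l" for X l
  proof -
    have "X \<in> \<S> l" using X level_tuple_distinct by (auto simp: \<S>_def)
    then have "D l (map (v l) X)" using v(1) by (simp add: good_def)
    moreover have "map (v l) X = map g X" using X(3) by (simp add: g_def)
    ultimately show ?thesis by simp
  qed
  have "z \<in> S \<longleftrightarrow> tuple_box N (map g X) \<subseteq> W"
    if X: "level_tuple X" "length X = N"
      and ex: "\<forall>i<N. \<exists>x. pre x (length (X ! i)) = X ! i \<and> deinterleave N z i = tlim g x" for X z
  proof -
    obtain l where l: "\<forall>s\<in>set X. length s = l" using X(1) by (auto simp: level_tuple_def)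
    obtain x where x: "\<And>i. i < N \<Longrightarrow> pre (x i) l = X ! i" "\<And>i. i < N \<Longrightarrow> deinterleave N z i = tlim g (x i)"
      using ex l X(2) by (metis nth_mem)
    have z_box: "z \<in> tuple_box N (map g (map (\<lambda>i. pre (x i) n) [0..<N]))" for n
      using x(2) tlim_pre[OF strong_embD[OF g]] by (simp add: tuple_box_def)
    have mapX: "map (\<lambda>i. pre (x i) l) [0..<N] = X"
      using X(2) x(1) by (simp add: list_eq_iff_nth_eq)
    \<comment> \<open>The points already differ at level \<open>l\<close>, so their prefixes also
      form a level tuple at \<open>max l k\<close>, and the box there avoids \<open>K k\<close>.
      Thus \<open>S\<close> and \<open>W\<close> agree on all tuples of branches through separated
      nodes.\<close>
    have "z \<notin> K k" for k
    proof -
      let ?n = "max l k"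
      let ?X = "map (\<lambda>i. pre (x i) ?n) [0..<N]"
      have "extends X ?X"
        unfolding extends_def by (auto simp: list_all2_conv_all_nth X(2) prefix_pre simp flip: x(1))
      then have "level_tuple ?X" using X(1) extends_level_tuple by blast
      then have "D ?n (map g ?X)" by (rule decided) auto
      then show ?thesis using z_box[of ?n] unfolding D_def by (metis IntI empty_iff less_Suc_eq_le max.cobounded2)
    qed
    then have "z \<in> S \<longleftrightarrow> z \<in> W" using K(2) by blast
    moreover have "z \<in> tuple_box N (map g X)" using z_box[of l] mapX by simp
    ultimately show ?thesis using decided[OF X l] unfolding D_def by blast
  qed
  then show ?thesis using g by (intro exI[of _ g] exI[of _ "\<lambda>X. tuple_box N (map g X) \<subseteq> W"]) blast
qed

section \<open>Splitting orders\<close>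

lemma ex_perfect_homogeneous:
  assumes F: "\<F> \<in> C_measurable_sets fin_sets_topology" and \<alpha>: "tree_emb \<alpha>" and N: "N > 0"
  shows "\<exists>\<gamma> C. tree_emb \<gamma> \<and>
    (\<forall>xs l. length xs = N \<longrightarrow> level_tuple (map (\<lambda>x. pre x l) xs) \<longrightarrow>
      tlim (\<alpha> \<circ> \<gamma>) ` set xs \<in> \<F> \<longleftrightarrow> C (map (\<lambda>x. pre x l) xs) []) \<and>
    (\<forall>m\<le>N. end_homogeneous N m C) \<and> (\<forall>m<N. split_compatible N m C)"
proof -
  define S where "S = {z \<in> {z. monotone_on {..<N} (<) (\<sqsubset>) (deinterleave N z)}.
    (\<lambda>i. tlim \<alpha> (deinterleave N z i)) ` {..<N} \<in> \<F>}"
  have "baire_property S" unfolding S_def by (rule baire_property_C_measurable[OF F \<alpha> N])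
  from ex_strong_emb_decided[OF this N] obtain g c where g: "strong_emb g"
    and c: "\<And>X z. level_tuple X \<Longrightarrow> length X = N \<Longrightarrow>
      (\<forall>i<N. \<exists>x. pre x (length (X ! i)) = X ! i \<and> deinterleave N z i = tlim g x) \<Longrightarrow> z \<in> S \<longleftrightarrow> c X"
    by blast
  \<comment> \<open>Branches through \<open>X\<close> also pass through \<open>Z\<close>, so both
    colours decide the membership of the same \<open>z\<close>.\<close>
  have "c X = c Z" if Z: "level_tuple Z" "length Z = N" "extends Z X" for Z X
  proof -
    have "\<forall>i. \<exists>x. pre x (length (X ! i)) = X ! i" using ex_pre by blast
    then obtain x where x: "\<And>i. pre (x i) (length (X ! i)) = X ! i" by metis
    obtain z where z: "\<And>i. i < N \<Longrightarrow> deinterleave N z i = tlim g (x i)"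
      by (rule ex_deinterleave[OF N, of "\<lambda>i. tlim g (x i)"]) blast
    have X: "level_tuple X" "length X = N"
      using extends_level_tuple[OF Z(1,3)] Z(2,3) by (auto simp: extends_def dest: list_all2_lengthD)
    have "prefix (Z ! i) (X ! i)" if "i < N" for i
      using Z(2,3) that by (simp add: extends_def list_all2_conv_all_nth)
    then have "pre (x i) (length (Z ! i)) = Z ! i" if "i < N" for i
      using that x prefix_pre_iff by metis
    then have "z \<in> S \<longleftrightarrow> c Z" using Z z by (intro c) auto
    moreover have "z \<in> S \<longleftrightarrow> c X" using X z x by (intro c) auto
    ultimately show ?thesis by simp
  qed
  then obtain \<psi> C where \<psi>: "strong_emb \<psi>" and C: "\<And>X. length X = N \<Longrightarrow> C X [] = c (map \<psi> X)"
    and hom: "\<forall>m\<le>N. end_homogeneous N m C" "\<forall>m<N. split_compatible N m C"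
    using ex_end_homogeneous_chain[of N c] by blast
  have emb: "tree_emb g" "tree_emb \<psi>" "tree_emb (g \<circ> \<psi>)" using g \<psi> tree_emb_comp by auto
  have "tlim (\<alpha> \<circ> (g \<circ> \<psi>)) ` set xs \<in> \<F> \<longleftrightarrow> C (map (\<lambda>x. pre x l) xs) []"
    if xs: "length xs = N" "level_tuple (map (\<lambda>x. pre x l) xs)" for xs l
  proof -
    let ?X = "map (\<lambda>x. pre x l) xs"
    obtain z where z: "\<And>i. i < N \<Longrightarrow> deinterleave N z i = tlim (g \<circ> \<psi>) (xs ! i)"
      by (rule ex_deinterleave[OF N, of "\<lambda>i. tlim (g \<circ> \<psi>) (xs ! i)"]) blast
    have less: "xs ! i \<sqsubset> xs ! k" if "i < k" "k < N" for i k
      using xs that unfolding level_tuple_def sorted_wrt_iff_nth_less cantor_less_iff by auto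
    have "monotone_on {..<N} (<) (\<sqsubset>) (deinterleave N z)"
      using less z tlim_less[OF emb(3)] by (auto simp: monotone_on_def)
    moreover have "(\<lambda>i. tlim \<alpha> (deinterleave N z i)) ` {..<N} = tlim (\<alpha> \<circ> (g \<circ> \<psi>)) ` set xs"
    proof -
      have "(\<lambda>i. tlim \<alpha> (deinterleave N z i)) ` {..<N} = (\<lambda>i. tlim (\<alpha> \<circ> (g \<circ> \<psi>)) (xs ! i)) ` {..<N}"
        using z tlim_comp[OF \<alpha> emb(3)] by (intro image_cong) auto
      also have "\<dots> = tlim (\<alpha> \<circ> (g \<circ> \<psi>)) ` (\<lambda>i. xs ! i) ` {..<N}" by (simp add: image_image)
      also have "(\<lambda>i. xs ! i) ` {..<N} = set xs" using xs(1) by (auto simp: set_conv_nth)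
      finally show ?thesis .
    qed
    ultimately have "tlim (\<alpha> \<circ> (g \<circ> \<psi>)) ` set xs \<in> \<F> \<longleftrightarrow> z \<in> S" by (simp add: S_def)
    also have "\<dots> \<longleftrightarrow> c (map \<psi> ?X)"
    proof (rule c)
      show "level_tuple (map \<psi> ?X)" by (rule level_tuple_map[OF \<psi> xs(2)])
      show "length (map \<psi> ?X) = N" using xs(1) by simp
      have "pre (tlim \<psi> (xs ! i)) (length (map \<psi> ?X ! i)) = map \<psi> ?X ! i"
          "deinterleave N z i = tlim g (tlim \<psi> (xs ! i))" if "i < N" for i
        using that xs(1) z tlim_pre[OF emb(2)] tlim_comp[OF emb(1,2)] by simp_all
      then show "\<forall>i<N. \<exists>x. pre x (length (map \<psi> ?X ! i)) = map \<psi> ?X ! i \<and> deinterleave N z i = tlim g x"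
        by blast
    qed
    also have "\<dots> \<longleftrightarrow> C ?X []" using C[of ?X] xs(1) by simp
    finally show ?thesis .
  qed
  with emb(3) hom show ?thesis by blast
qed

text \<open>\<open>split_trace X \<kappa>\<close>: the tuple \<open>X\<close> arises from the root by splitting its nodes one at a time, the
  \<open>k\<close>-th of these splittings being at the node with index \<open>\<kappa> ! k\<close>.\<close>

inductive split_trace :: "bool list list \<Rightarrow> nat list \<Rightarrow> bool" where
  root: "split_trace [[]] []"
| ext: "split_trace X \<kappa> \<Longrightarrow> extends X Y \<Longrightarrow> split_trace Y \<kappa>"
| split: "split_trace X \<kappa> \<Longrightarrow> i < length X \<Longrightarrow> split_trace (split_at X i) (\<kappa> @ [i])"

lemma split_trace_level_tuple: "split_trace X \<kappa> \<Longrightarrow> level_tuple X"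
  by (induction rule: split_trace.induct)
    (auto intro: extends_level_tuple level_tuple_split_at simp: level_tuple_def[of "[[]]"])

lemma split_trace_length: "split_trace X \<kappa> \<Longrightarrow> length X = Suc (length \<kappa>)"
  by (induction rule: split_trace.induct) (auto simp: extends_def length_split_at dest: list_all2_lengthD)

text \<open>When the splitting number k is made, counted from 0, there are k + 1 nodes to choose
  from.\<close>

lemma split_trace_valid: "split_trace X \<kappa> \<Longrightarrow> k < length \<kappa> \<Longrightarrow> \<kappa> ! k \<le> k"
proof (induction rule: split_trace.induct)
  case (split X \<kappa> i)
  then show ?case using split_trace_length[OF split.hyps(1)] by (auto simp: nth_append less_Suc_eq)
qed auto

text \<open>Extensions keep the colour by end-homogeneity, and a splitting moves one entry from the
  tuple to the code. For empty \<open>\<kappa>'\<close> the colour of an N-tuple becomes a function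
  of its splitting order.\<close>

lemma split_trace_colour:
  assumes "split_trace X \<kappa>" "length X \<le> N" "length \<kappa>' = N - length X" "set \<kappa>' \<subseteq> {..<N}"
    and eh: "\<forall>m\<le>N. end_homogeneous N m C" and sp: "\<forall>m<N. split_compatible N m C"
  shows "C X \<kappa>' = C [[]] (\<kappa> @ \<kappa>')"
  using assms(1-4)
proof (induction arbitrary: \<kappa>' rule: split_trace.induct)
  case (ext X \<kappa> Y)
  have len: "length Y = length X" using ext(2) list_all2_lengthD by (fastforce simp: extends_def)
  have "C Y \<kappa>' = C X \<kappa>'"
    using eh ext.prems ext(2) split_trace_level_tuple[OF ext(1)] len
    unfolding end_homogeneous_def by metis
  also have "\<dots> = C [[]] (\<kappa> @ \<kappa>')" using ext len by simp
  finally show ?case .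
next
  case (split X \<kappa> i)
  have len: "length (split_at X i) = Suc (length X)" using split by (simp add: length_split_at)
  have "C (split_at X i) \<kappa>' = C X (i # \<kappa>')"
    using sp[rule_format, of "length X"] split.prems split.hyps split_trace_level_tuple[OF split.hyps(1)] len
    unfolding split_compatible_def by auto
  also have "\<dots> = C [[]] (\<kappa> @ i # \<kappa>')"
    using split.prems split.hyps len by (intro split.IH) auto
  finally show ?case by simp
qed simp

text \<open>A skew subtree: the node \<open>s\<close> splits at level \<open>node_index s\<close>, and no other node splits there.\<close>

definition node_index :: "bool list \<Rightarrow> nat" where
  "node_index s = foldl (\<lambda>m b. 2 * m + of_bool b) 1 s"

definition skew :: "cantor \<Rightarrow> cantor" where
  "skew x p \<longleftrightarrow> (\<exists>n. p = node_index (pre x n) \<and> x n)"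

definition skew_emb :: "bool list \<Rightarrow> bool list" where
  "skew_emb s = map (\<lambda>p. \<exists>n<length s. p = node_index (take n s) \<and> s ! n) [0..<node_index s]"

lemma node_index_Nil [simp]: "node_index [] = 1"
  and node_index_snoc [simp]: "node_index (s @ [b]) = 2 * node_index s + of_bool b"
  by (simp_all add: node_index_def)

text \<open>The nodes of length n occupy one dyadic block of levels; this is the origin of the
  levels \<open>2 ^ n\<close> in \<open>skew_node\<close>.\<close>

lemma node_index_bounds: "2 ^ length s \<le> node_index s \<and> node_index s < 2 ^ Suc (length s)"
  by (induction s rule: rev_induct) auto

lemma node_index_length_less: "length s < length t \<Longrightarrow> node_index s < node_index t"
  using node_index_bounds[of s] node_index_bounds[of t]
    power_increasing[of "Suc (length s)" "length t" "2::nat"] by linarith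

lemma node_index_inj: "node_index s = node_index t \<Longrightarrow> s = t"
proof (induction s arbitrary: t rule: rev_induct)
  case Nil
  then show ?case using node_index_length_less[of "[]" t] by (cases t) auto
next
  case (snoc b s)
  have "t \<noteq> []" using snoc.prems node_index_length_less[of "[]" "s @ [b]"] by auto
  then obtain t' b' where t: "t = t' @ [b']" by (metis rev_exhaust)
  have eq: "2 * node_index s + of_bool b = 2 * node_index t' + (of_bool b' :: nat)"
    using snoc.prems t by simp
  have "b = b'" using arg_cong[OF eq, of even] by (cases b; cases b') simp_all
  with eq have "node_index s = node_index t'" by simp
  with snoc.IH \<open>b = b'\<close> t show ?case by simp
qed

lemma skew_node_index: "skew x (node_index (pre x n)) = x n"
proof -
  have "n' = n" if "node_index (pre x n) = node_index (pre x n')" for n'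
    using node_index_inj[OF that] by (metis length_pre)
  then show ?thesis unfolding skew_def by auto
qed

lemma length_skew_emb [simp]: "length (skew_emb s) = node_index s"
  by (simp add: skew_emb_def)

lemma skew_emb_pre: "skew_emb (pre x n) = pre (skew x) (node_index (pre x n))"
proof (rule nth_equalityI)
  fix p assume "p < length (skew_emb (pre x n))"
  then have p: "p < node_index (pre x n)" by simp
  have "skew_emb (pre x n) ! p \<longleftrightarrow> (\<exists>m<n. p = node_index (pre x m) \<and> x m)"
    using p by (auto simp: skew_emb_def min_def)
  also have "\<dots> \<longleftrightarrow> skew x p"
  proof -
    have "m < n" if "p = node_index (pre x m)" for m
      using p that node_index_length_less[of "pre x n" "pre x m"]
      by (cases m n rule: linorder_cases) auto
    then show ?thesis unfolding skew_def by blast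
  qed
  finally show "skew_emb (pre x n) ! p = pre (skew x) (node_index (pre x n)) ! p" using p by simp
qed simp

lemma tree_emb_skew_emb: "tree_emb skew_emb"
  unfolding tree_emb_def
proof (intro allI)
  fix s :: "bool list" and b
  obtain x where x: "pre x (length (s @ [b])) = s @ [b]" using ex_pre by blast
  let ?n = "length s"
  have s: "pre x ?n = s" "x ?n = b" "pre x (Suc ?n) = s @ [b]" using x by (simp_all add: pre_Suc)
  have "skew_emb s @ [b] = pre (skew x) (Suc (node_index s))"
    using skew_emb_pre[of x ?n] skew_node_index[of x ?n] s by (simp add: pre_Suc)
  moreover have "skew_emb (s @ [b]) = pre (skew x) (node_index (s @ [b]))"
    using skew_emb_pre[of x "Suc ?n"] s by simp
  moreover have "Suc (node_index s) \<le> node_index (s @ [b])"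
    by (intro Suc_leI node_index_length_less) simp
  ultimately show "prefix (skew_emb s @ [b]) (skew_emb (s @ [b]))" by (simp add: prefix_pre)
qed

lemma tlim_skew_emb: "tlim skew_emb x = skew x"
  by (rule tlim_eqI[OF tree_emb_skew_emb]) (simp add: skew_emb_pre)

lemma inj_skew: "inj skew"
  using inj_tlim[OF tree_emb_skew_emb] by (simp add: tlim_skew_emb[abs_def])

text \<open>A \<open>True\<close> at level \<open>p\<close> can only come from the one node with
  index \<open>p\<close>.\<close>

lemma skew_split_unique:
  assumes "skew x p" "skew y p" shows "pre (skew x) p = pre (skew y) p"
proof -
  obtain n m where "p = node_index (pre x n)" "p = node_index (pre y m)"
    using assms unfolding skew_def by blast
  then show ?thesis using skew_emb_pre[of x n] skew_emb_pre[of y m] node_index_inj by metis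
qed

lemma set_split_at:
  assumes "i < length X"
  shows "set (split_at X i) = insert (X ! i @ [True]) ((\<lambda>s. s @ [False]) ` set X)"
proof -
  have "set (take (Suc i) X) \<union> set (drop (Suc i) X) = set X"
    by (metis append_take_drop_id set_append)
  then show ?thesis unfolding split_at_def by auto
qed

text \<open>Induction on the level. At most one node of the tuple splits at level \<open>p\<close>,
  and then all others continue with \<open>False\<close>, which is a \<open>split\<close> step. If
  none splits, every node has a unique continuation, which is an \<open>ext\<close> step.\<close>

lemma ex_split_trace:
  assumes "Y \<noteq> {}"
  shows "\<exists>X \<kappa>. split_trace X \<kappa> \<and> set X = (\<lambda>y. pre (skew y) p) ` Y"
proof (induction p)
  case 0
  then show ?case using assms split_trace.root by (intro exI[of _ "[[]]"] exI[of _ "[]"]) auto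
next
  case (Suc p)
  then obtain X \<kappa> where X: "split_trace X \<kappa>" "set X = (\<lambda>y. pre (skew y) p) ` Y" by blast
  show ?case
  proof (cases "\<exists>y1\<in>Y. \<exists>y2\<in>Y. pre (skew y1) p = pre (skew y2) p \<and> \<not> skew y1 p \<and> skew y2 p")
    case True
    then obtain y1 y2 where y: "y1 \<in> Y" "y2 \<in> Y" "pre (skew y1) p = pre (skew y2) p"
      "\<not> skew y1 p" "skew y2 p" by blast
    then have "pre (skew y2) p \<in> set X" using X(2) by blast
    then obtain i where i: "i < length X" "X ! i = pre (skew y2) p" by (auto simp: in_set_conv_nth)
    have eq: "pre (skew y) (Suc p) = pre (skew y2) p @ [True]" if "skew y p" for y
      using skew_split_unique[OF that y(5)] that by (simp add: pre_Suc)
    have "set (split_at X i) = (\<lambda>y. pre (skew y) (Suc p)) ` Y" (is "?L = ?R")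
    proof
      show "?R \<subseteq> ?L"
      proof
        fix s assume "s \<in> ?R"
        then obtain y where "y \<in> Y" "s = pre (skew y) (Suc p)" by blast
        then show "s \<in> ?L" using eq[of y] X(2) i
          by (cases "skew y p") (auto simp: set_split_at pre_Suc)
      qed
      have "pre (skew y) p @ [False] \<in> ?R" if "y \<in> Y" for y
      proof (cases "skew y p")
        \<comment> \<open>\<open>y\<close> leaves the splitting node to the right, but
          \<open>y1\<close> passes through the same node and leaves it to the left.\<close>
        case True
        then have "pre (skew y) p @ [False] = pre (skew y1) (Suc p)"
          using skew_split_unique[OF True y(5)] y by (simp add: pre_Suc)
        then show ?thesis using y(1) by simp
      next
        case False
        then have "pre (skew y) p @ [False] = pre (skew y) (Suc p)" by (simp add: pre_Suc)
        then show ?thesis using that by blast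
      qed
      moreover have "X ! i @ [True] \<in> ?R" using eq[OF y(5)] i y(2) by (metis imageI)
      ultimately show "?L \<subseteq> ?R" using X(2) i(1) by (auto simp: set_split_at)
    qed
    then show ?thesis using split_trace.split[OF X(1) i(1)] by blast
  next
    case False
    define b where "b s \<longleftrightarrow> (\<exists>y\<in>Y. pre (skew y) p = s \<and> skew y p)" for s
    have b: "s @ [b s] = pre (skew y) (Suc p)" if "y \<in> Y" "s = pre (skew y) p" for y s
    proof -
      have "skew y p" if "skew y' p" "y' \<in> Y" "pre (skew y') p = s" for y'
      proof (rule ccontr)
        assume "\<not> skew y p"
        moreover have "pre (skew y) p = pre (skew y') p"
          using that(3) \<open>s = pre (skew y) p\<close> by simp
        ultimately show False using False \<open>y \<in> Y\<close> that(1,2) by blast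
      qed
      then have "b s = skew y p" unfolding b_def using that by blast
      then show ?thesis using that by (simp add: pre_Suc)
    qed
    obtain n where "\<forall>s\<in>set X. length s = n"
      using split_trace_level_tuple[OF X(1)] by (auto simp: level_tuple_def)
    then have "extends X (map (\<lambda>s. s @ [b s]) X)"
      unfolding extends_def by (intro conjI exI[of _ "Suc n"]) (auto simp: list_all2_conv_all_nth)
    then have "split_trace (map (\<lambda>s. s @ [b s]) X) \<kappa>" using X(1) split_trace.ext by blast
    moreover have "set (map (\<lambda>s. s @ [b s]) X) = (\<lambda>y. pre (skew y) (Suc p)) ` Y"
      using b by (auto simp: X(2) image_image)
    ultimately show ?thesis by blast
  qed
qed

section \<open>Order shattering\<close>

text \<open>The entries \<open>True\<close> mark the levels at which every node of a binary subtree
  has both successors. At the other levels one direction is followed, and it may depend on the node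
  reached; this distinguishes the notion from ordinary shattering.\<close>

primrec shatters :: "bool list \<Rightarrow> bool list set \<Rightarrow> bool" where
  "shatters [] G \<longleftrightarrow> [] \<in> G"
| "shatters (d # \<pi>) G \<longleftrightarrow> (if d
     then shatters \<pi> {g. False # g \<in> G} \<and> shatters \<pi> {g. True # g \<in> G}
     else shatters \<pi> {g. False # g \<in> G} \<or> shatters \<pi> {g. True # g \<in> G})"

lemma finite_patterns: "finite {\<pi> :: bool list. length \<pi> = n \<and> P \<pi>}"
  by (rule finite_subset[OF _ finite_lists_length_eq[of "UNIV :: bool set" n]]) auto

text \<open>The Sauer--Shelah lemma in the form of Anstee, Ronyai and Sali (order shattering).\<close>

lemma card_le_card_shattered:
  assumes "\<forall>g\<in>G. length g = n"
  shows "card G \<le> card {\<pi>. length \<pi> = n \<and> shatters \<pi> G}"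
  using assms
proof (induction n arbitrary: G)
  case 0
  then have "G \<subseteq> {[]}" by auto
  then consider "G = {}" | "G = {[]}" by blast
  then show ?case
  proof cases
    case 2
    have "{\<pi>. length \<pi> = 0 \<and> shatters \<pi> G} = {[]}" using 2 by auto
    then show ?thesis using 2 by simp
  qed simp
next
  case (Suc n)
  define H where "H b = {g. b # g \<in> G}" for b
  define T where "T b = {\<pi>. length \<pi> = n \<and> shatters \<pi> (H b)}" for b
  have fin: "finite (T b)" for b unfolding T_def by (rule finite_patterns)
  have len: "\<forall>g\<in>H b. length g = n" for b using Suc.prems by (auto simp: H_def)
  have finH: "finite (H b)" for b
    by (rule finite_subset[OF _ finite_patterns[of n "\<lambda>_. True"]]) (use len in auto)
  have "G = (#) False ` H False \<union> (#) True ` H True"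
  proof
    show "G \<subseteq> (#) False ` H False \<union> (#) True ` H True"
    proof
      fix g assume g: "g \<in> G"
      then obtain b g' where "g = b # g'" using Suc.prems by (cases g) auto
      then show "g \<in> (#) False ` H False \<union> (#) True ` H True" using g by (cases b) (auto simp: H_def)
    qed
  qed (auto simp: H_def)
  then have "card G = card ((#) False ` H False \<union> (#) True ` H True)" by (rule arg_cong)
  also have "\<dots> = card ((#) False ` H False) + card ((#) True ` H True)"
    using finH by (intro card_Un_disjoint) auto
  also have "\<dots> = card (H False) + card (H True)" by (simp add: card_image)
  also have "\<dots> \<le> card (T False) + card (T True)"
    using Suc.IH[OF len] by (simp add: T_def add_mono)
  \<comment> \<open>\<open>False # \<pi>\<close> is shattered if \<pi> is shattered by at least one
    half of \<open>G\<close>, and \<open>True # \<pi>\<close> if \<pi> is shattered by both; so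
    union and intersection count the patterns by their first entry.\<close>
  also have "\<dots> = card (T False \<union> T True) + card (T False \<inter> T True)"
    by (rule card_Un_Int[OF fin fin])
  also have "\<dots> = card ((#) False ` (T False \<union> T True)) + card ((#) True ` (T False \<inter> T True))"
    by (simp add: card_image)
  also have "\<dots> = card ((#) False ` (T False \<union> T True) \<union> (#) True ` (T False \<inter> T True))"
    using fin by (intro card_Un_disjoint[symmetric]) auto
  also have "\<dots> \<le> card {\<pi>. length \<pi> = Suc n \<and> shatters \<pi> G}"
    by (rule card_mono[OF finite_patterns]) (auto simp: T_def H_def)
  finally show ?case .
qed

text \<open>A crude bound for a sum of binomial coefficients, by Pascal's recursion on the first
  entry.\<close>

lemma card_sparse_patterns:
  "card {\<pi>. length \<pi> = n \<and> count_list \<pi> True < M} \<le> (n + 1) ^ M"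
proof (induction n arbitrary: M)
  case 0
  have "{\<pi> :: bool list. length \<pi> = 0 \<and> count_list \<pi> True < M} \<subseteq> {[]}" by auto
  then show ?case using card_mono[of "{[] :: bool list}"] by fastforce
next
  case (Suc n)
  define B where "B M = {\<pi>. length \<pi> = n \<and> count_list \<pi> True < M}" for M
  show ?case
  proof (cases M)
    case (Suc M')
    have "{\<pi>. length \<pi> = Suc n \<and> count_list \<pi> True < M} \<subseteq> (#) False ` B M \<union> (#) True ` B M'"
    proof
      fix \<pi> assume "\<pi> \<in> {\<pi>. length \<pi> = Suc n \<and> count_list \<pi> True < M}"
      then obtain d \<pi>' where "\<pi> = d # \<pi>'" "length \<pi>' = n" "count_list (d # \<pi>') True < Suc M'"
        by (auto simp: Suc length_Suc_conv simp del: count_list.simps)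
      then show "\<pi> \<in> (#) False ` B M \<union> (#) True ` B M'" by (cases d) (auto simp: B_def Suc)
    qed
    then have "card {\<pi>. length \<pi> = Suc n \<and> count_list \<pi> True < M} \<le> card ((#) False ` B M \<union> (#) True ` B M')"
      by (intro card_mono) (auto simp: B_def finite_patterns)
    also have "\<dots> \<le> card (B M) + card (B M')"
      using card_Un_le[of "(#) False ` B M" "(#) True ` B M'"] by (simp add: card_image)
    also have "\<dots> \<le> (n + 1) ^ M + (n + 1) ^ M'"
      unfolding B_def by (intro add_mono Suc.IH)
    also have "\<dots> = (n + 2) * (n + 1) ^ M'" by (simp add: Suc)
    also have "\<dots> \<le> (n + 2) * (n + 2) ^ M'" by (intro mult_le_mono2 power_mono) auto
    finally show ?thesis by (simp add: Suc)
  qed simp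
qed

lemma ex_shattered:
  assumes "\<forall>g\<in>G. length g = n" "card G > (n + 1) ^ M"
  obtains \<pi> where "length \<pi> = n" "shatters \<pi> G" "count_list \<pi> True \<ge> M"
proof -
  have "\<not> {\<pi>. length \<pi> = n \<and> shatters \<pi> G} \<subseteq> {\<pi>. length \<pi> = n \<and> count_list \<pi> True < M}"
  proof
    assume "{\<pi>. length \<pi> = n \<and> shatters \<pi> G} \<subseteq> {\<pi>. length \<pi> = n \<and> count_list \<pi> True < M}"
    from card_mono[OF finite_patterns this] show False
      using card_le_card_shattered[OF assms(1)] card_sparse_patterns[of n M] assms(2) by linarith
  qed
  then obtain \<pi> where "length \<pi> = n" "shatters \<pi> G" "\<not> count_list \<pi> True < M" by blast
  then show thesis by (intro that) auto
qed

section \<open>Realization of splitting orders in the skew subtree\<close>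

definition zext :: "bool list \<Rightarrow> cantor" where
  "zext s n \<longleftrightarrow> n < length s \<and> s ! n"

text \<open>\<open>2 ^ length s\<close> is the lowest level at which a node as long as
  \<open>s\<close> can split. Up to it \<open>skew\<close> depends only on \<open>s\<close>, by
  \<open>pre_skew_cong\<close>, so any branch through \<open>s\<close> could replace
  \<open>zext s\<close>.\<close>

definition skew_node :: "bool list \<Rightarrow> bool list" where
  "skew_node s = pre (skew (zext s)) (2 ^ length s)"

lemma pre_zext [simp]: "pre (zext s) (length s) = s"
  by (simp add: list_eq_iff_nth_eq zext_def)

lemma pre_zext_snoc: "pre (zext (s @ [b])) (length s) = s"
  by (simp add: list_eq_iff_nth_eq zext_def nth_append)

lemma zext_snoc_length: "zext (s @ [b]) (length s) = b"
  by (simp add: zext_def)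

lemma length_skew_node [simp]: "length (skew_node s) = 2 ^ length s"
  by (simp add: skew_node_def)

lemma pre_skew_cong:
  assumes "pre x n = pre y n" "p \<le> 2 ^ n" shows "pre (skew x) p = pre (skew y) p"
proof -
  have "node_index (pre x n) \<ge> 2 ^ n" using node_index_bounds[of "pre x n"] by simp
  then show ?thesis
    using assms skew_emb_pre[of x n] skew_emb_pre[of y n] pre_eq_mono[of "skew x" "node_index (pre x n)" "skew y" p]
    by simp
qed

text \<open>Among the words one longer than \<open>s\<close>, only \<open>s @ [True]\<close> can
  have a \<open>True\<close> at the level of \<open>s\<close>.\<close>

lemma skew_snoc:
  assumes "node_index s = p" "skew (zext (t @ [b])) p" "length t = length s"
  shows "t = s \<and> b"
proof -
  obtain n where n: "p = node_index (pre (zext (t @ [b])) n)" "zext (t @ [b]) n"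
    using assms(2) unfolding skew_def by blast
  then have "s = pre (zext (t @ [b])) n" using assms(1) node_index_inj by blast
  then have "n = length t" using assms(3) by simp
  with n(2) \<open>s = _\<close> show ?thesis by (simp add: pre_zext_snoc zext_snoc_length)
qed

lemma split_trace_nosplit:
  assumes "split_trace (map skew_node X) \<kappa>" "\<forall>s\<in>set X. length s = i"
  shows "split_trace (map (\<lambda>s. skew_node (s @ [b s])) X) \<kappa>"
proof (rule split_trace.ext[OF assms(1)])
  have "prefix (skew_node s) (skew_node (s @ [b s]))" for s
  proof -
    have "skew_node s = pre (skew (zext (s @ [b s]))) (2 ^ length s)"
      unfolding skew_node_def by (rule pre_skew_cong[of _ "length s"]) (simp_all add: pre_zext_snoc)
    then show ?thesis unfolding skew_node_def by (simp add: prefix_pre)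
  qed
  then show "extends (map skew_node X) (map (\<lambda>s. skew_node (s @ [b s])) X)"
    using assms(2) by (auto simp: extends_def list_all2_conv_all_nth)
qed

text \<open>Between the levels \<open>2 ^ i\<close> and \<open>2 ^ Suc i\<close> only images of
  nodes of length \<open>i\<close> can split, and of these just \<open>X ! k\<close> does, as all
  other nodes follow \<open>False\<close>. \<open>Z\<close> is the tuple at the level
  \<open>p\<close> of this splitting.\<close>

lemma split_trace_split:
  assumes tr: "split_trace (map skew_node X) \<kappa>" and X: "\<forall>s\<in>set X. length s = i" and k: "k < length X"
  shows "split_trace (map skew_node (split_at X k)) (\<kappa> @ [k])"
proof -
  let ?t = "X ! k"
  define p where "p = node_index ?t"
  have len: "length ?t = i" using X k by simp
  have p: "2 ^ i \<le> p" "Suc p \<le> 2 ^ Suc i"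
    using node_index_bounds[of ?t] len by (auto simp: p_def)
  define Z where "Z = map (\<lambda>s. pre (skew (zext (s @ [False]))) p) X"
  have "prefix (skew_node s) (pre (skew (zext (s @ [False]))) p)" if "s \<in> set X" for s
  proof -
    have "skew_node s = pre (skew (zext (s @ [False]))) (2 ^ length s)"
      unfolding skew_node_def by (rule pre_skew_cong[of _ "length s"]) (simp_all add: pre_zext_snoc)
    then show ?thesis using X that p by (simp add: prefix_pre)
  qed
  then have "extends (map skew_node X) Z"
    by (auto simp: extends_def list_all2_conv_all_nth Z_def)
  with tr have "split_trace Z \<kappa>" by (rule split_trace.ext)
  then have "split_trace (split_at Z k) (\<kappa> @ [k])" using k by (intro split_trace.split) (simp_all add: Z_def)
  moreover have "split_at Z k = map (\<lambda>s. pre (skew (zext s)) (Suc p)) (split_at X k)"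
  proof -
    have F: "pre (skew (zext (s @ [False]))) (Suc p) = pre (skew (zext (s @ [False]))) p @ [False]"
      if "s \<in> set X" for s
      using skew_snoc[of ?t p s False] that X len by (auto simp: pre_Suc p_def)
    have T: "pre (skew (zext (?t @ [True]))) (Suc p) = pre (skew (zext (?t @ [False]))) p @ [True]"
    proof -
      have "skew (zext (?t @ [True])) p"
        using skew_node_index[of "zext (?t @ [True])" "length ?t"]
        by (simp add: p_def pre_zext_snoc zext_snoc_length)
      moreover have "pre (skew (zext (?t @ [b]))) p = skew_emb ?t" for b
        using skew_emb_pre[of "zext (?t @ [b])" "length ?t"] by (simp add: p_def pre_zext_snoc)
      ultimately show ?thesis by (simp add: pre_Suc)
    qed
    show ?thesis
      using k F T by (auto simp: split_at_def Z_def take_map drop_map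
          dest: in_set_takeD in_set_dropD)
  qed
  ultimately have "split_trace (map (\<lambda>s. pre (skew (zext s)) (Suc p)) (split_at X k)) (\<kappa> @ [k])" by simp
  then show ?thesis
  proof (rule split_trace.ext)
    have "length s = Suc i" if "s \<in> set (split_at X k)" for s
      using that X k len by (auto simp: set_split_at)
    then show "extends (map (\<lambda>s. pre (skew (zext s)) (Suc p)) (split_at X k)) (map skew_node (split_at X k))"
      using p by (auto simp: extends_def list_all2_conv_all_nth skew_node_def intro!: prefix_pre)
  qed
qed

text \<open>In an order shattered set, the required splittings are carried out at the levels marked by
  the pattern; at the other levels one follows a direction that remains shattered.\<close>

lemma ex_realization:
  assumes "split_trace (map skew_node X) \<kappa>0"
    "\<forall>s\<in>set X. length s = i \<and> shatters \<pi> {g. s @ g \<in> G}"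
    "length \<kappa> \<le> count_list \<pi> True" "\<forall>k<length \<kappa>. \<kappa> ! k < length X + k"
  shows "\<exists>Y. set Y \<subseteq> G \<and> split_trace (map skew_node Y) (\<kappa>0 @ \<kappa>) \<and> (\<forall>s\<in>set Y. length s = i + length \<pi>)"
  using assms
proof (induction \<pi> arbitrary: X \<kappa> \<kappa>0 i)
  case Nil
  then show ?case by (intro exI[of _ X]) auto
next
  case (Cons d \<pi>)
  show ?case
  proof (cases "d \<and> \<kappa> \<noteq> []")
    \<comment> \<open>Both directions stay shattered at every node, so the node \<open>k\<close> may
      take both and the others may take \<open>False\<close>.\<close>
    case True
    then obtain k \<kappa>' where \<kappa>: "\<kappa> = k # \<kappa>'" by (cases \<kappa>) auto
    have k: "k < length X" using Cons.prems(4) \<kappa> by force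
    have "\<exists>Y. set Y \<subseteq> G \<and> split_trace (map skew_node Y) ((\<kappa>0 @ [k]) @ \<kappa>') \<and>
        (\<forall>s\<in>set Y. length s = Suc i + length \<pi>)"
    proof (rule Cons.IH)
      show "split_trace (map skew_node (split_at X k)) (\<kappa>0 @ [k])"
        using Cons.prems(1,2) k by (intro split_trace_split[of _ _ i]) auto
      show "\<forall>s\<in>set (split_at X k). length s = Suc i \<and> shatters \<pi> {g. s @ g \<in> G}"
        using Cons.prems(2) True k by (auto simp: set_split_at)
      show "length \<kappa>' \<le> count_list \<pi> True" using Cons.prems(3) \<kappa> True by simp
      show "\<forall>k'<length \<kappa>'. \<kappa>' ! k' < length (split_at X k) + k'"
        using Cons.prems(4) \<kappa> k by (force simp: length_split_at)
    qed
    then show ?thesis by (simp add: \<kappa>)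
  next
    \<comment> \<open>This includes marked levels once \<open>\<kappa>\<close> is exhausted: any
      direction will do there.\<close>
    case False
    have "\<forall>s. \<exists>b. s \<in> set X \<longrightarrow> shatters \<pi> {g. s @ b # g \<in> G}"
      using Cons.prems(2) by (auto split: if_splits)
    then obtain b where b: "\<And>s. s \<in> set X \<Longrightarrow> shatters \<pi> {g. s @ b s # g \<in> G}" by metis
    have "\<exists>Y. set Y \<subseteq> G \<and> split_trace (map skew_node Y) (\<kappa>0 @ \<kappa>) \<and>
        (\<forall>s\<in>set Y. length s = Suc i + length \<pi>)"
    proof (rule Cons.IH)
      show "split_trace (map skew_node (map (\<lambda>s. s @ [b s]) X)) \<kappa>0"
        using split_trace_nosplit[of X \<kappa>0 i b] Cons.prems(1,2) by (simp add: comp_def)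
      show "\<forall>s\<in>set (map (\<lambda>s. s @ [b s]) X). length s = Suc i \<and> shatters \<pi> {g. s @ g \<in> G}"
        using Cons.prems(2) b by auto
      show "length \<kappa> \<le> count_list \<pi> True" using Cons.prems(3) False by auto
      show "\<forall>k<length \<kappa>. \<kappa> ! k < length (map (\<lambda>s. s @ [b s]) X) + k" using Cons.prems(4) by simp
    qed
    then show ?thesis by simp
  qed
qed

section \<open>Perfect sets with all subsets of a given size in the family\<close>

lemma sorted_wrt_unique:
  assumes "\<And>x y. R x y \<Longrightarrow> R y x \<Longrightarrow> False" "sorted_wrt R xs" "sorted_wrt R ys" "set xs = set ys"
  shows "xs = ys"
  using assms(2-4)
proof (induction xs arbitrary: ys)
  case (Cons x xs)
  then obtain y ys' where ys: "ys = y # ys'" by (cases ys) auto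
  have "x = y"
  proof (rule ccontr)
    assume "x \<noteq> y"
    then have "y \<in> set xs" "x \<in> set ys'" using Cons.prems(3) ys by auto
    then show False using Cons.prems ys assms(1)[of x y] by auto
  qed
  moreover have "x \<notin> set xs" "y \<notin> set ys'" using Cons.prems ys assms(1)[of x x] assms(1)[of y y] by auto
  ultimately show ?case using Cons.IH[of ys'] Cons.prems ys by (simp add: insert_ident)
qed simp

lemma node_less_asym: "s \<prec>\<^sub>l t \<Longrightarrow> t \<prec>\<^sub>l s \<Longrightarrow> False"
proof -
  assume "s \<prec>\<^sub>l t" "t \<prec>\<^sub>l s"
  moreover obtain x y where x: "pre x (length s) = s" and y: "pre y (length t) = t" using ex_pre by metis
  let ?n = "max (length s) (length t)"
  have "prefix s (pre x ?n)" "prefix t (pre y ?n)"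
    using prefix_pre[of "length s" ?n x] prefix_pre[of "length t" ?n y] x y by simp_all
  ultimately have "x \<sqsubset> y" "y \<sqsubset> x" using cantor_less_iff node_less_prefix by blast+
  then show False using cantor_less_trans cantor_less_irrefl by blast
qed

lemma eventually_sorted_pre:
  "sorted_wrt (\<sqsubset>) xs \<Longrightarrow> \<forall>\<^sub>F p in sequentially. sorted_wrt (\<prec>\<^sub>l) (map (\<lambda>x. pre x p) xs)"
proof (induction xs)
  case (Cons x xs)
  have "\<forall>\<^sub>F p in sequentially. pre x p \<prec>\<^sub>l pre y p" if "y \<in> set xs" for y
  proof -
    from that Cons.prems obtain n where "pre x n \<prec>\<^sub>l pre y n" using cantor_less_iff by auto
    then show ?thesis unfolding eventually_sequentially using node_less_pre_mono by blast
  qed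
  then have "\<forall>\<^sub>F p in sequentially. \<forall>y\<in>set xs. pre x p \<prec>\<^sub>l pre y p"
    by (intro eventually_ball_finite) auto
  moreover have "\<forall>\<^sub>F p in sequentially. sorted_wrt (\<prec>\<^sub>l) (map (\<lambda>x. pre x p) xs)"
    using Cons by simp
  ultimately show ?case by eventually_elim auto
qed simp

lemma ex_sorted_list_cantor:
  assumes "finite (Y :: cantor set)"
  obtains xs where "sorted_wrt (\<sqsubset>) xs" "set xs = Y" "length xs = card Y"
proof -
  interpret C: linorder "\<lambda>x y. x \<sqsubset> y \<or> x = y" "(\<sqsubset>)" by (rule linorder_cantor)
  obtain xs where "sorted_wrt (\<sqsubset>) xs" "set xs = Y"
    using C.ex1_sorted_list_for_set_if_finite[OF assms] by blast
  moreover have "length xs = card Y"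
    using calculation C.strict_sorted_iff distinct_card by metis
  ultimately show thesis using that by blast
qed

lemma min_filling_witness:
  assumes "finite F" "card F = n" "min_filling \<F> n > m"
  obtains G where "G \<subseteq> F" "G \<in> \<F>" "card G > m"
proof -
  define V where "V F = insert 0 (card ` {G. G \<subseteq> F \<and> G \<in> \<F>})" for F
  have V: "finite (V F)" "V F \<subseteq> {..card F}" if "finite F" for F
  proof -
    show "V F \<subseteq> {..card F}" using that by (auto simp: V_def card_mono)
    then show "finite (V F)" using finite_subset by blast
  qed
  have "finite {Max (V F) | F. finite F \<and> card F = n}"
  proof (rule finite_subset)
    show "{Max (V F) | F. finite F \<and> card F = n} \<subseteq> {..n}"
    proof safe
      fix F :: "cantor set" assume "finite F" "n = card F"
      moreover have "V F \<noteq> {}" by (simp add: V_def)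
      ultimately show "Max (V F) \<le> card F" using V[of F] Max_in[of "V F"] by blast
    qed
  qed simp
  then have "min_filling \<F> n \<le> Max (V F)"
    unfolding min_filling_def V_def[symmetric] using assms by (intro Min_le) auto
  then have "Max (V F) > m" using assms(3) by simp
  moreover have "Max (V F) \<in> V F" using V[OF assms(1)] by (intro Max_in) (auto simp: V_def)
  ultimately show thesis using that by (auto simp: V_def)
qed

text \<open>Membership depends on the splitting order alone. The fact \<open>code\<close> realizes
  each order inside a member of the family, where heredity makes it good; conversely every N-subset
  of the skew copy has some splitting order.\<close>

lemma ex_perfect_clique:
  assumes her: "hereditary \<F>" and F: "\<F> \<in> C_measurable_sets fin_sets_topology"
    and large: "\<And>M. \<exists>n. min_filling \<F> (2 ^ n) > (n + 1) ^ M"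
    and \<alpha>: "tree_emb \<alpha>" and N: "N > 0"
  shows "\<exists>\<beta>. tree_emb \<beta> \<and> (\<forall>Y\<subseteq>range (tlim (\<alpha> \<circ> \<beta>)). finite Y \<longrightarrow> card Y = N \<longrightarrow> Y \<in> \<F>)"
proof -
  from ex_perfect_homogeneous[OF F \<alpha> N] obtain \<gamma> C where \<gamma>: "tree_emb \<gamma>"
    and C: "\<And>xs l. length xs = N \<Longrightarrow> level_tuple (map (\<lambda>x. pre x l) xs) \<Longrightarrow>
      tlim (\<alpha> \<circ> \<gamma>) ` set xs \<in> \<F> \<longleftrightarrow> C (map (\<lambda>x. pre x l) xs) []"
    and hom: "\<forall>m\<le>N. end_homogeneous N m C" "\<forall>m<N. split_compatible N m C"
    by blast
  have \<alpha>\<gamma>: "tree_emb (\<alpha> \<circ> \<gamma>)" using \<alpha> \<gamma> by (rule tree_emb_comp)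
  have code: "C [[]] \<kappa>" if \<kappa>: "length \<kappa> = N - 1" "\<forall>k<length \<kappa>. \<kappa> ! k \<le> k" for \<kappa>
  proof -
    \<comment> \<open>The exponent is N - 1 because that many marked levels let a single root grow
      into N points, one splitting per level.\<close>
    obtain n where n: "min_filling \<F> (2 ^ n) > (n + 1) ^ (N - 1)" using large by blast
    define pt where "pt s = tlim (\<alpha> \<circ> \<gamma>) (skew (zext s))" for s
    have inj: "inj_on pt {s. length s = n}"
    proof (rule inj_onI)
      fix s t assume st: "s \<in> {s. length s = n}" "t \<in> {s. length s = n}" "pt s = pt t"
      then have "zext s = zext t"
        using inj_tlim[OF \<alpha>\<gamma>] inj_skew by (simp add: pt_def inj_eq)
      then show "s = t" using st pre_zext[of s] pre_zext[of t] by simp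
    qed
    have "card (pt ` {s. length s = n}) = 2 ^ n"
      using card_image[OF inj] card_lists_length_eq[of "UNIV :: bool set" n] by simp
    moreover have "finite (pt ` {s. length s = n})"
      using finite_patterns[of n "\<lambda>_. True"] by simp
    ultimately obtain G0 where G0: "G0 \<subseteq> pt ` {s. length s = n}" "G0 \<in> \<F>" "card G0 > (n + 1) ^ (N - 1)"
      using n by (elim min_filling_witness[rotated -1]) 
    define G where "G = {s. length s = n \<and> pt s \<in> G0}"
    have "pt ` G = G0" using G0(1) by (auto simp: G_def)
    moreover have "inj_on pt G" by (rule inj_on_subset[OF inj]) (auto simp: G_def)
    ultimately have "card G > (n + 1) ^ (N - 1)" using G0(3) card_image by metis
    then obtain \<pi> where \<pi>: "length \<pi> = n" "shatters \<pi> G" "count_list \<pi> True \<ge> N - 1"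
      using ex_shattered[of G n "N - 1"] by (auto simp: G_def)
    \<comment> \<open>\<open>skew_node []\<close> has length 1; it is a mere extension of the root,
      since the indices start at 1 and no node splits at level 0.\<close>
    have "split_trace (map skew_node [[]]) []"
      by (rule split_trace.ext[OF split_trace.root]) (auto simp: extends_def)
    from ex_realization[OF this, of 0 \<pi> G \<kappa>] obtain Y where Y: "set Y \<subseteq> G"
        "split_trace (map skew_node Y) \<kappa>" "\<forall>s\<in>set Y. length s = n"
      using \<pi> \<kappa> by (auto simp: less_Suc_eq_le)
    have lenY: "length Y = N" using split_trace_length[OF Y(2)] \<kappa>(1) N by simp
    let ?xs = "map (\<lambda>s. skew (zext s)) Y"
    have mapY: "map skew_node Y = map (\<lambda>x. pre x (2 ^ n)) ?xs"
      using Y(3) by (simp add: skew_node_def)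
    have "tlim (\<alpha> \<circ> \<gamma>) ` set ?xs = pt ` set Y" by (simp add: pt_def image_image)
    also have "\<dots> \<subseteq> G0" using Y(1) by (auto simp: G_def)
    finally have "tlim (\<alpha> \<circ> \<gamma>) ` set ?xs \<in> \<F>"
      using her G0(2) lenY N unfolding hereditary_def by (metis image_is_empty length_0_conv length_map less_numeral_extra(3) set_empty)
    then have "C (map skew_node Y) []"
      using C[of ?xs "2 ^ n"] lenY split_trace_level_tuple[OF Y(2)] unfolding mapY by simp
    then show ?thesis using split_trace_colour[OF Y(2) _ _ _ hom, of "[]"] lenY by simp
  qed
  have "Y \<in> \<F>" if Y: "Y \<subseteq> range (tlim (\<alpha> \<circ> (\<gamma> \<circ> skew_emb)))" "finite Y" "card Y = N" for Y
  proof -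
    have eq: "tlim (\<alpha> \<circ> (\<gamma> \<circ> skew_emb)) x = tlim (\<alpha> \<circ> \<gamma>) (skew x)" for x
      using tlim_comp[OF \<alpha>\<gamma> tree_emb_skew_emb] by (simp add: tlim_skew_emb comp_assoc)
    then obtain Y' where Y': "Y = tlim (\<alpha> \<circ> \<gamma>) ` skew ` Y'"
      using Y(1) by (metis (no_types, lifting) image_cong image_image subset_imageE)
    have inj: "inj_on (tlim (\<alpha> \<circ> \<gamma>)) (skew ` Y')" by (rule inj_on_subset[OF inj_tlim[OF \<alpha>\<gamma>]]) simp
    then have Y'': "finite (skew ` Y')" "card (skew ` Y') = N"
      using Y(2,3) Y' finite_imageD[OF _ inj] card_image[OF inj] by auto
    then obtain xs where xs: "sorted_wrt (\<sqsubset>) xs" "set xs = skew ` Y'" "length xs = N"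
      using ex_sorted_list_cantor by metis
    obtain p where p: "sorted_wrt (\<prec>\<^sub>l) (map (\<lambda>x. pre x p) xs)"
      using eventually_happens'[OF sequentially_bot eventually_sorted_pre[OF xs(1)]] by blast
    have "Y' \<noteq> {}" using Y''(2) N by auto
    then obtain X \<kappa> where X: "split_trace X \<kappa>" "set X = (\<lambda>y. pre (skew y) p) ` Y'"
      using ex_split_trace by metis
    \<comment> \<open>Both lists enumerate the same nodes in increasing order, so the trace belongs
      to the tuple of the given points.\<close>
    have "set X = set (map (\<lambda>x. pre x p) xs)" using X(2) xs(2) by (simp add: image_image)
    then have X_eq: "X = map (\<lambda>x. pre x p) xs"
      using p split_trace_level_tuple[OF X(1)] node_less_asym
      by (intro sorted_wrt_unique[of "(\<prec>\<^sub>l)"]) (auto simp: level_tuple_def)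
    then have lenX: "length X = N" using xs(3) by simp
    have "C X [] = C [[]] (\<kappa> @ [])" using lenX by (intro split_trace_colour[OF X(1) _ _ _ hom]) auto
    also have "\<dots>" using code[of \<kappa>] split_trace_length[OF X(1)] split_trace_valid[OF X(1)] lenX by simp
    finally have "C (map (\<lambda>x. pre x p) xs) []" using X_eq by simp
    then have "tlim (\<alpha> \<circ> \<gamma>) ` set xs \<in> \<F>"
      using C[OF xs(3)] split_trace_level_tuple[OF X(1)] X_eq by simp
    then show ?thesis using xs(2) Y' by simp
  qed
  then show ?thesis using tree_emb_comp[OF \<gamma> tree_emb_skew_emb] by blast
qed

section \<open>Fusion\<close>

text \<open>As P has no isolated point, its tree of prefixes branches above each of its nodes. The
  embedding sends a node to the chosen branching node; closedness keeps the branches in P.\<close>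

lemma ex_tree_emb_perfect:
  assumes "perfect P" obtains \<alpha> where "tree_emb \<alpha>" "range (tlim \<alpha>) \<subseteq> P"
proof -
  have P: "P \<noteq> {}" "closed P" "\<And>x. \<not> x isolated_in P" using assms by (auto simp: perfect_def)
  define T where "T s \<longleftrightarrow> (\<exists>x\<in>P. pre x (length s) = s)" for s
  have T_prefix: "T s" if "T t" "prefix s t" for s t
  proof -
    from that(1) obtain x where x: "x \<in> P" "pre x (length t) = t" by (auto simp: T_def)
    then have "pre x (length s) = s" using that(2) prefix_pre_iff by metis
    then show ?thesis using x(1) by (auto simp: T_def)
  qed
  have "\<exists>u. prefix s u \<and> T (u @ [False]) \<and> T (u @ [True])" if "T s" for s
  proof -
    from that obtain x where x: "x \<in> P" "pre x (length s) = s" by (auto simp: T_def)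
    have "open {y. pre y (length s) = s}"
      using topological_basis_open[OF topological_basis_cantor] by blast
    then have "{y. pre y (length s) = s} \<inter> P \<noteq> {x}"
      using P(3)[of x] x by (auto simp: isolated_in_def)
    then obtain y where y: "y \<in> P" "pre y (length s) = s" "y \<noteq> x" using x by blast
    then have ex: "\<exists>n. x n \<noteq> y n" by (auto simp: fun_eq_iff)
    define n where "n = (LEAST n. x n \<noteq> y n)"
    have n: "x n \<noteq> y n" "\<forall>m<n. x m = y m"
      using LeastI_ex[OF ex] not_less_Least[of _ "\<lambda>n. x n \<noteq> y n"]
      unfolding n_def[symmetric] by blast+
    then have eq: "pre x n = pre y n" by (simp add: pre_eq_iff)
    have "length s \<le> n"
      using n(1) x(2) y(2) pre_eq_iff[of x "length s" y] by (metis not_le)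
    then have "prefix s (pre x n)" using x(2) by (simp add: prefix_pre_iff)
    moreover have "T (pre x n @ [x n])" "T (pre x n @ [y n])"
      using x(1) y(1) eq by (auto simp: T_def pre_Suc)
    ultimately show ?thesis using n(1) by (intro exI[of _ "pre x n"]) (cases "x n"; cases "y n"; auto)
  qed
  then obtain u where u: "\<And>s. T s \<Longrightarrow> prefix s (u s) \<and> T (u s @ [False]) \<and> T (u s @ [True])" by metis
  define \<alpha> where "\<alpha> s = foldl (\<lambda>t b. u (t @ [b])) (u []) s" for s
  have \<alpha>_simps: "\<alpha> [] = u []" "\<alpha> (s @ [b]) = u (\<alpha> s @ [b])" for s b by (simp_all add: \<alpha>_def)
  have "T []" using P(1) by (auto simp: T_def)
  have split: "T (\<alpha> s @ [False]) \<and> T (\<alpha> s @ [True])" for s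
  proof (induction s rule: rev_induct)
    case Nil
    then show ?case using u[OF \<open>T []\<close>] by (simp add: \<alpha>_simps)
  next
    case (snoc b s)
    then have "T (\<alpha> s @ [b])" by (cases b) auto
    then show ?case using u by (simp add: \<alpha>_simps)
  qed
  have "prefix (\<alpha> s @ [b]) (\<alpha> (s @ [b]))" for s b
  proof -
    have "T (\<alpha> s @ [b])" using split[of s] by (cases b) auto
    then show ?thesis using u by (simp add: \<alpha>_simps)
  qed
  then have \<alpha>: "tree_emb \<alpha>" by (simp add: tree_emb_def)
  have "tlim \<alpha> x \<in> P" for x
  proof (rule closed_cantorD[OF P(2)])
    fix n
    have "T (\<alpha> (pre x n))" using split[of "pre x n"] by (rule conjE) (auto intro: T_prefix)
    then obtain y where y: "y \<in> P" "pre y (length (\<alpha> (pre x n))) = \<alpha> (pre x n)" by (auto simp: T_def)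
    then have "pre y (length (\<alpha> (pre x n))) = pre (tlim \<alpha> x) (length (\<alpha> (pre x n)))"
      using tlim_pre[OF \<alpha>] by simp
    then have "pre y n = pre (tlim \<alpha> x) n"
      by (rule pre_eq_mono) (use tree_emb_length[OF \<alpha>, of "pre x n"] in simp)
    then show "\<exists>y\<in>P. pre y n = pre (tlim \<alpha> x) n" using y(1) by blast
  qed
  with \<alpha> show thesis by (intro that) auto
qed

lemma tlim_eventually_eqI:
  assumes \<phi>: "tree_emb \<phi>" and "\<And>n. pre y (length (\<phi> (pre x (k + n)))) = \<phi> (pre x (k + n))"
  shows "tlim \<phi> x = y"
proof (rule tlim_eqI[OF \<phi>])
  fix n
  have "prefix (\<phi> (pre x n)) (\<phi> (pre x (k + n)))"
    by (rule tree_emb_prefix[OF \<phi> prefix_pre]) simp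
  then have "prefix (\<phi> (pre x n)) (pre y (length (\<phi> (pre x (k + n)))))" by (simp only: assms(2))
  then show "pre y (length (\<phi> (pre x n))) = \<phi> (pre x n)" by (simp add: prefix_pre_iff)
qed

lemma tlim_fix:
  assumes "tree_emb \<phi>" "\<phi> (pre x n) = pre x n" shows "pre (tlim \<phi> x) n = pre x n"
  using tlim_pre[OF assms(1), of x n] unfolding assms(2) by simp

text \<open>\<open>ex_perfect_clique\<close> is applied separately in each cone of level
  \<open>j\<close>, and \<open>B\<close> acts only above that level. Sets with fewer than N points
  are completed to N points of the same cone, then heredity applies.\<close>

lemma ex_clique_cones:
  assumes her: "hereditary \<F>" and F: "\<F> \<in> C_measurable_sets fin_sets_topology"
    and large: "\<And>M. \<exists>n. min_filling \<F> (2 ^ n) > (n + 1) ^ M"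
    and \<alpha>: "tree_emb \<alpha>" and N: "N > 0"
  shows "\<exists>B. tree_emb B \<and> (\<forall>s. length s < j \<longrightarrow> B s = s) \<and>
    (\<forall>s Y. length s = j \<longrightarrow> Y \<subseteq> tlim (\<alpha> \<circ> B) ` {x. pre x j = s} \<longrightarrow> Y \<noteq> {} \<longrightarrow> finite Y \<longrightarrow>
      card Y \<le> N \<longrightarrow> Y \<in> \<F>)"
proof -
  define \<alpha>' where "\<alpha>' s r = \<alpha> (s @ r)" for s r
  have \<alpha>': "tree_emb (\<alpha>' s)" for s
    using \<alpha> unfolding tree_emb_def \<alpha>'_def by (metis append_assoc)
  have "\<exists>\<beta>. tree_emb \<beta> \<and> (\<forall>Y\<subseteq>range (tlim (\<alpha>' s \<circ> \<beta>)). finite Y \<longrightarrow> card Y = N \<longrightarrow> Y \<in> \<F>)" for s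
    by (rule ex_perfect_clique[OF her F large \<alpha>' N])
  then obtain \<beta> where \<beta>: "\<And>s. tree_emb (\<beta> s)"
    and clique: "\<And>s Y. Y \<subseteq> range (tlim (\<alpha>' s \<circ> \<beta> s)) \<Longrightarrow> finite Y \<Longrightarrow> card Y = N \<Longrightarrow> Y \<in> \<F>"
    by metis
  define B where "B t = (if length t < j then t else take j t @ \<beta> (take j t) (drop j t))" for t
  have B: "tree_emb B"
    unfolding tree_emb_def
  proof (intro allI)
    fix t :: "bool list" and b
    consider "Suc (length t) < j" | "Suc (length t) = j" | "j \<le> length t" by linarith
    then show "prefix (B t @ [b]) (B (t @ [b]))"
      by cases (use \<beta> in \<open>auto simp: B_def tree_emb_def\<close>)
  qed
  have cone: "tlim (\<alpha> \<circ> B) x \<in> range (tlim (\<alpha>' s \<circ> \<beta> s))" if x: "pre x j = s" for x s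
  proof -
    define x' where "x' n = x (j + n)" for n
    have split: "pre x (j + n) = s @ pre x' n" for n
      using x by (induction n) (simp_all add: pre_Suc x'_def)
    have s: "length s = j" using x by auto
    have eq: "(\<alpha> \<circ> B) (pre x (j + n)) = (\<alpha>' s \<circ> \<beta> s) (pre x' n)" for n
      unfolding split using s by (simp add: B_def \<alpha>'_def)
    have "tlim (\<alpha> \<circ> B) x = tlim (\<alpha>' s \<circ> \<beta> s) x'"
      by (rule tlim_eventually_eqI[of _ _ _ j])
        (unfold eq, rule tree_emb_comp[OF \<alpha> B], rule tlim_pre[OF tree_emb_comp[OF \<alpha>' \<beta>]])
    then show ?thesis by simp
  qed
  have "Y \<in> \<F>" if Y: "Y \<subseteq> tlim (\<alpha> \<circ> B) ` {x. pre x j = s}" "Y \<noteq> {}" "finite Y" "card Y \<le> N" for s Y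
  proof -
    let ?R = "range (tlim (\<alpha>' s \<circ> \<beta> s))"
    have YR: "Y \<subseteq> ?R" using Y(1) cone by blast
    \<comment> \<open>This leaves room in the cone for enlarging \<open>Y\<close> to exactly N
      points.\<close>
    have "infinite ?R"
    proof
      assume "finite ?R"
      then have "finite (UNIV :: cantor set)"
        using finite_imageD inj_tlim[OF tree_emb_comp[OF \<alpha>' \<beta>]] by blast
      moreover have "inj (\<lambda>n m :: nat. m = n)" by (rule injI) (metis)
      ultimately show False using finite_imageD finite_subset[OF subset_UNIV] infinite_UNIV_nat by metis
    qed
    then have "infinite (?R - Y)" using Y(3) by simp
    then obtain Z where Z: "finite Z" "card Z = N - card Y" "Z \<subseteq> ?R - Y"
      using infinite_arbitrarily_large by blast
    have "card (Y \<union> Z) = card Y + card Z" using Y(3) Z by (intro card_Un_disjoint) auto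
    then have "Y \<union> Z \<in> \<F>" using YR Y(3,4) Z by (intro clique[of _ s]) auto
    with her Y(2) show ?thesis unfolding hereditary_def by blast
  qed
  then show ?thesis using B by (intro exI[of _ B]) (simp add: B_def)
qed

lemma filling_fusion:
  assumes her: "hereditary \<F>" and F: "\<F> \<in> C_measurable_sets fin_sets_topology"
    and large: "\<And>M. \<exists>n. min_filling \<F> (2 ^ n) > (n + 1) ^ M"
    and f: "\<forall>n\<ge>1. n \<ge> f n \<and> f n > 0" and lim: "(\<lambda>n. real (f n) / real n) \<longlonglongrightarrow> 0"
    and \<alpha>0: "tree_emb \<alpha>0"
  shows "\<exists>\<psi>. tree_emb \<psi> \<and> filling f \<F> (range (tlim (\<alpha>0 \<circ> \<psi>)))"
proof -
  \<comment> \<open>The exponent is \<open>Suc j\<close> because a set too large for the cones of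
    level \<open>j\<close> is divided among those of a later level. The bound
    \<open>Suc j \<le> N\<close> makes the thresholds positive and unbounded, so every n is below
    one of them.\<close>
  have "\<exists>N. Suc j \<le> N \<and> (\<forall>n>N. f n * 2 ^ Suc j \<le> n)" for j
  proof -
    have "\<forall>\<^sub>F n in sequentially. real (f n) / real n < 1 / 2 ^ Suc j"
      using lim by (rule order_tendstoD) simp
    then obtain N where N: "\<And>n. n \<ge> N \<Longrightarrow> real (f n) / real n < 1 / 2 ^ Suc j"
      unfolding eventually_sequentially by blast
    have "f n * 2 ^ Suc j \<le> n" if "n > max N (Suc j)" for n
    proof -
      have "real (f n) / real n < 1 / 2 ^ Suc j" using that by (intro N) simp
      then have "real (f n) * 2 ^ Suc j < real n" using that by (simp add: field_simps)
      then have "real (f n * 2 ^ Suc j) < real n" by simp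
      then show ?thesis by linarith
    qed
    then show ?thesis by (intro exI[of _ "max N (Suc j)"]) simp
  qed
  then obtain N where N: "\<And>j. Suc j \<le> N j" "\<And>j n. n > N j \<Longrightarrow> f n * 2 ^ Suc j \<le> n" by metis
  have Npos: "N j > 0" for j using N(1)[of j] by simp
  define clq where "clq j \<alpha> \<longleftrightarrow> (\<forall>s Y. length s = j \<longrightarrow> Y \<subseteq> tlim \<alpha> ` {x. pre x j = s} \<longrightarrow> Y \<noteq> {} \<longrightarrow>
      finite Y \<longrightarrow> card Y \<le> N j \<longrightarrow> Y \<in> \<F>)" for j \<alpha>
  have ex: "\<exists>B. tree_emb B \<and> (\<forall>s. length s < j \<longrightarrow> B s = s) \<and> clq j (\<alpha> \<circ> B)" if "tree_emb \<alpha>" for j \<alpha>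
    unfolding clq_def by (rule ex_clique_cones[OF her F large that Npos])
  define Th where "Th j \<alpha> = (SOME B. tree_emb B \<and> (\<forall>s. length s < j \<longrightarrow> B s = s) \<and> clq j (\<alpha> \<circ> B))" for j \<alpha>
  have Th: "tree_emb (Th j \<alpha>) \<and> (\<forall>s. length s < j \<longrightarrow> Th j \<alpha> s = s) \<and> clq j (\<alpha> \<circ> Th j \<alpha>)"
    if "tree_emb \<alpha>" for j \<alpha>
    unfolding Th_def by (rule someI_ex[OF ex[OF that]])
  define \<alpha> where "\<alpha> = rec_nat \<alpha>0 (\<lambda>j \<alpha>. \<alpha> \<circ> Th j \<alpha>)"
  define B where "B j = Th j (\<alpha> j)" for j
  have \<alpha>_Suc: "\<alpha> (Suc j) = \<alpha> j \<circ> B j" for j by (simp add: \<alpha>_def B_def)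
  have \<alpha>: "tree_emb (\<alpha> j)" for j
  proof (induction j)
    case (Suc j)
    then show ?case unfolding \<alpha>_Suc B_def using Th tree_emb_comp by blast
  qed (simp add: \<alpha>_def \<alpha>0)
  have B: "\<And>j. tree_emb (B j)" "\<And>j s. length s < j \<Longrightarrow> B j s = s" "\<And>j. clq j (\<alpha> (Suc j))"
    unfolding \<alpha>_Suc B_def using Th[OF \<alpha>] by blast+
  have \<gamma>: "\<alpha>0 \<circ> fuse B 0 = \<alpha> j \<circ> fuse B j" for j
  proof (induction j)
    case (Suc j)
    then show ?case using fuse_unfold[of j B] B(2) by (simp add: \<alpha>_Suc comp_assoc)
  qed (simp add: \<alpha>_def)
  have fuse: "tree_emb (fuse B j)" for j using B(1,2) by (rule tree_emb_fuse)
  let ?\<gamma> = "tlim (\<alpha>0 \<circ> fuse B 0)"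
  \<comment> \<open>The factors of the fusion after number \<open>j\<close> fix the nodes of length
    \<open>j\<close>, so the cones of the final set at this level stay inside those treated at step
    \<open>j\<close>.\<close>
  have clique: "Y \<in> \<F>"
    if Y: "Y \<subseteq> ?\<gamma> ` {x. pre x j = s}" "Y \<noteq> {}" "finite Y" "card Y \<le> N j" "length s = j" for j s Y
  proof -
    have "?\<gamma> x \<in> tlim (\<alpha> (Suc j)) ` {x. pre x j = s}" if "pre x j = s" for x
    proof -
      have "?\<gamma> x = tlim (\<alpha> (Suc j)) (tlim (fuse B (Suc j)) x)"
        unfolding \<gamma>[of "Suc j"] by (rule tlim_comp[OF \<alpha> fuse])
      moreover have "pre (tlim (fuse B (Suc j)) x) j = s"
        unfolding that[symmetric] by (rule tlim_fix[OF fuse]) (simp add: fuse_id)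
      ultimately show ?thesis by blast
    qed
    then have "Y \<subseteq> tlim (\<alpha> (Suc j)) ` {x. pre x j = s}" using Y(1) by blast
    then show ?thesis using B(3)[of j] Y(2-5) unfolding clq_def by blast
  qed
  have "\<exists>G\<subseteq>Y. G \<in> \<F> \<and> f n \<le> card G" if n: "n \<ge> 1" and Y: "Y \<subseteq> range ?\<gamma>" "finite Y" "card Y = n" for n Y
  proof -
    have "\<exists>j. n \<le> N j" using N(1)[of n] by (intro exI[of _ n]) simp
    define j where "j = (LEAST j. n \<le> N j)"
    have j: "n \<le> N j" "\<And>i. i < j \<Longrightarrow> N i < n"
      unfolding j_def using LeastI_ex[OF \<open>\<exists>j. n \<le> N j\<close>] not_less_Least not_le by blast+
    have size: "f n * 2 ^ j \<le> n"
    proof (cases j)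
      \<comment> \<open>There is a single cone, and f n \<le> n takes the place of the growth
        condition.\<close>
      case 0
      then show ?thesis using f n by simp
    next
      case (Suc i)
      then show ?thesis using N(2)[of i n] j(2)[of i] by simp
    qed
    define Z where "Z s = Y \<inter> ?\<gamma> ` {x. pre x j = s}" for s
    let ?L = "{s :: bool list. length s = j}"
    have finL: "finite ?L" using finite_patterns[of j "\<lambda>_. True"] by simp
    have "Y \<subseteq> (\<Union>s\<in>?L. Z s)"
    proof
      fix y assume "y \<in> Y"
      moreover from this obtain x where "y = ?\<gamma> x" using Y(1) by blast
      ultimately have "y \<in> Z (pre x j)" by (simp add: Z_def)
      then show "y \<in> (\<Union>s\<in>?L. Z s)" by (intro UN_I[of "pre x j"]) simp_all
    qed
    then have "Y = (\<Union>s\<in>?L. Z s)" by (auto simp: Z_def)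
    then have "n \<le> (\<Sum>s\<in>?L. card (Z s))" using card_UN_le[OF finL, of Z] Y(3) by simp
    \<comment> \<open>Pigeonhole over the \<open>2 ^ j\<close> cones of level
      \<open>j\<close>.\<close>
    have "\<exists>s\<in>?L. f n \<le> card (Z s)"
    proof (rule ccontr)
      assume "\<not> ?thesis"
      then have "(\<Sum>s\<in>?L. card (Z s)) < (\<Sum>s\<in>?L. f n)"
        using finL by (intro sum_strict_mono) (auto simp: not_le intro: exI[of _ "replicate j False"])
      also have "\<dots> = 2 ^ j * f n" using card_lists_length_eq[of "UNIV :: bool set" j] by simp
      finally show False using \<open>n \<le> (\<Sum>s\<in>?L. card (Z s))\<close> size by (simp add: mult.commute)
    qed
    then obtain s where s: "length s = j" "f n \<le> card (Z s)" by blast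
    have "Z s \<in> \<F>"
    proof (rule clique[OF _ _ _ _ s(1)])
      show "Z s \<subseteq> ?\<gamma> ` {x. pre x j = s}" by (auto simp: Z_def)
      show "Z s \<noteq> {}" using s(2) f n by fastforce
      show "finite (Z s)" using Y(2) by (simp add: Z_def)
      show "card (Z s) \<le> N j" using card_mono[OF Y(2), of "Z s"] Y(3) j(1) by (simp add: Z_def)
    qed
    then show ?thesis using s(2) by (intro exI[of _ "Z s"]) (simp add: Z_def)
  qed
  then have "filling f \<F> (range ?\<gamma>)" by (simp add: filling_def)
  then show ?thesis using fuse by blast
qed

lemma limsup_min_filling:
  assumes "limsup (\<lambda>n. ereal (log 2 (real (min_filling \<F> (2 ^ n))) / log 2 (real n))) = \<infinity>"
  shows "\<exists>n. min_filling \<F> (2 ^ n) > (n + 1) ^ M"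
proof -
  let ?d = "\<lambda>n. log 2 (real (min_filling \<F> (2 ^ n))) / log 2 (real n)"
  \<comment> \<open>The factor 2 pays for passing from n to n + 1, as n + 1 \<le> n * n for n \<ge>
    2.\<close>
  have "\<exists>\<^sub>F n in sequentially. ereal (?d n) > ereal (real (2 * M))"
  proof (rule ccontr)
    assume "\<not> ?thesis"
    then have "\<forall>\<^sub>F n in sequentially. ereal (?d n) \<le> ereal (real (2 * M))"
      by (simp add: not_frequently not_less)
    then have "limsup (\<lambda>n. ereal (?d n)) \<le> ereal (real (2 * M))" by (rule Limsup_bounded)
    with assms show False by simp
  qed
  then obtain n where n: "n \<ge> 2" "?d n > real (2 * M)"
    unfolding frequently_sequentially by (metis ereal_less_eq(3) less_ereal.simps(1))
  let ?m = "min_filling \<F> (2 ^ n)"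
  have "log 2 (real n) > 0" using n(1) by simp
  then have gt: "log 2 (real ?m) > real (2 * M) * log 2 (real n)"
    using n(2) by (simp add: pos_less_divide_eq)
  \<comment> \<open>At 0 the formal value of the logarithm is 0, which \<open>gt\<close>
    excludes.\<close>
  have pos: "real ?m > 0"
  proof (rule ccontr)
    assume "\<not> ?thesis"
    then have "log 2 (real ?m) = 0" by (simp add: log_def)
    with gt \<open>log 2 (real n) > 0\<close> show False by (simp add: mult_less_0_iff)
  qed
  have "log 2 (real (n ^ (2 * M))) = real (2 * M) * log 2 (real n)"
    using n(1) by (simp add: log_nat_power)
  then have "real (n ^ (2 * M)) < real ?m"
    using gt pos n(1) by (metis log_less_cancel_iff of_nat_0_less_iff one_less_numeral_iff semiring_norm(76) zero_less_power order.strict_trans2 zero_less_numeral)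
  then have "n ^ (2 * M) < ?m" by linarith
  moreover have "(n + 1) ^ M \<le> n ^ (2 * M)"
  proof -
    have "n + 1 \<le> n * n" using n(1) by (cases n rule: nat.exhaust) (auto intro: le_trans[of _ "2 * n"])
    then have "(n + 1) ^ M \<le> (n * n) ^ M" by (intro power_mono) auto
    then show ?thesis by (simp add: power_mult power2_eq_square)
  qed
  ultimately show ?thesis by (intro exI[of _ n]) linarith
qed

theorem corollary18:
  fixes \<F> :: "cantor set set" and f :: "nat \<Rightarrow> nat"
  assumes "\<F> \<subseteq> fin_sets"
    and "hereditary \<F>"
    and "\<F> \<in> C_measurable_sets fin_sets_topology"
    and "limsup (\<lambda>n. ereal (log 2 (real (min_filling \<F> (2 ^ n))) / log 2 (real n))) = \<infinity>"
    and "\<forall>n\<ge>1. n \<ge> f n \<and> f n > 0"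
    and "(\<lambda>n. real (f n) / real n) \<longlonglongrightarrow> 0"
  shows "\<forall>P :: cantor set. perfect P \<longrightarrow> (\<exists>Q\<subseteq>P. perfect Q \<and> filling f \<F> Q)"
proof (intro allI impI)
  fix P :: "cantor set" assume "perfect P"
  then obtain \<alpha> where \<alpha>: "tree_emb \<alpha>" "range (tlim \<alpha>) \<subseteq> P" by (rule ex_tree_emb_perfect)
  obtain \<psi> where \<psi>: "tree_emb \<psi>" "filling f \<F> (range (tlim (\<alpha> \<circ> \<psi>)))"
    using filling_fusion[OF assms(2,3) limsup_min_filling[OF assms(4)] assms(5,6) \<alpha>(1)] by blast
  have "range (tlim (\<alpha> \<circ> \<psi>)) \<subseteq> P" using tlim_comp[OF \<alpha>(1) \<psi>(1)] \<alpha>(2) by auto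
  then show "\<exists>Q\<subseteq>P. perfect Q \<and> filling f \<F> Q"
    using \<psi>(2) perfect_range_tlim[OF tree_emb_comp[OF \<alpha>(1) \<psi>(1)]] by blast
qed

end
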